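(* Let $\mathcal C$ and $\mathcal D$ be (unimodular) spherical finite tensor categories over an algebraically closed field $k$, let $\mathbf u_{\mathcal C}:\mathbf 1\to\mathbb D_{\mathcal C}^{-1}$ and $\mathbf u_{\mathcal D}:\mathbf 1\to\mathbb D_{\mathcal D}^{-1}$ be isomorphisms, and let ${}_{\mathcal C}\mathcal L_{\mathcal D}$ be a $(\mathbf u_{\mathcal C},\mathbf u_{\mathcal D})$-spherical bimodule category. Then ${}_{\mathcal C}\mathcal L_{\mathcal D}$ is $(\mathbf u_{\mathcal C},\mathbf u_{\mathcal D})$-trace-spherical, for the same $\mathbf u_{\mathcal C},\mathbf u_{\mathcal D}$; that is, for every projective object $p\in\mathcal L$ and every $f\in\mathrm{Hom}_{\mathcal L}(p,p)$, the left and right traces agree: $$\mathrm{tr}^{\mathcal L}_{{\rm l};p}(f)=\mathrm{tr}^{\mathcal L}_{{\rm r};p}(f).$$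
   Context: $k$ is algebraically closed; all categories are finite $k$-linear abelian. A finite tensor category is a finite rigid monoidal category with bilinear tensor product and simple unit $\mathbf 1$. A right dual $a^\vee$ has $a^\vee\otimes a\to\mathbf 1$, $\mathbf 1\to a\otimes a^\vee$; a left dual ${}^\vee a$ has $a\otimes{}^\vee a\to\mathbf 1$, $\mathbf 1\to{}^\vee a\otimes a$. (Bi)module categories have exact action functors $\triangleright,\triangleleft$; $\overline{\mathcal D}$ is $\mathcal D$ with reversed tensor product; a right $\mathcal D$-module category is a left $\overline{\mathcal D}$-module category. **Twisted trace.** $\mathbb N^r_{\mathcal X}=\int^{x\in\mathcal X}\mathrm{Hom}_{\mathcal X}(-,x)^*\otimes x$ is the Nakayama functor (for $\mathcal X=R$-mod: $R^*\otimes_R-$). For $p$ projective there is a canonical isomorphism $\mathfrak n_{p;x}:\mathrm{Hom}(p,x)\to\mathrm{Hom}(x,\mathbb N^r(p))^*$, natural in $p,x$, and $\mathbf t^{\mathcal X}_p=\mathfrak n_{p;p}(\mathrm{id}_p):\mathrm{Hom}(p,\mathbb N^r(p))\to k$. There are canonical isomorphisms $\mathbb N^r\circ F\cong F^{\rm rra}\circ\mathbb N^r$ (rra: double right adjoint) for $F$ with right exact right adjoint. **Distinguished object, spherical tensor categories.** $\mathbb D_{\mathcal C}^{-1}:=\mathbb N^r_{\mathcal C}(\mathbf 1)$ is invertible with inverse $\mathbb D_{\mathcal C}$; $\mathcal C$ is unimodular if $\mathbb D_{\mathcal C}\cong\mathbf 1$. The isomorphisms ${}^{\vee\vee}c\otimes\mathbb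 D_{\mathcal C}^{-1}\cong\mathbb N^r_{\mathcal C}(c)\cong\mathbb D_{\mathcal C}^{-1}\otimes c^{\vee\vee}$ give the Radford isomorphism $\mathbb D_{\mathcal C}\otimes c\otimes\mathbb D_{\mathcal C}^{-1}\cong c^{\vee\vee\vee\vee}$, hence for unimodular $\mathcal C$ a canonical $\overline r_{\mathcal C}:\mathrm{id}\Rightarrow(-)^{\vee\vee\vee\vee}$ (independent of the trivialization of $\mathbb D_{\mathcal C}$). A unimodular pivotal $\mathcal C$ with pivotal structure $\mathrm p:\mathrm{id}\Rightarrow(-)^{\vee\vee}$ is spherical if $\mathrm p^{\vee\vee}\circ\mathrm p=\overline r_{\mathcal C}$. **Relative Serre functors.** For an exact left $\mathcal C$-module category $\mathcal L$ with internal Hom $\underline{\mathrm{Hom}}$, $\mathbb S^{\mathcal C}_{\mathcal L}$ is the endofunctor with $\underline{\mathrm{Hom}}(y,z)^\vee\cong\underline{\mathrm{Hom}}(z,\mathbb S^{\mathcal C}_{\mathcal L}(y))$. There is a canonical isomorphism $\mathbb D_{\mathcal C}^{-1}\triangleright\mathbb S^{\mathcal C}_{\mathcal L}\cong\mathbb N^r_{\mathcal L}$ (from $\mathbb N^r_{\mathcal L}\circ(-\triangleright y)\cong(-\triangleright y)^{\rm rra}\circ\mathbb N^r_{\mathcal C}$ evaluated at $\mathbf 1$), and similarly $\mathbb S^{\overline{\mathcal D}}_{\mathcal L}\triangleleft\mathbb D_{\mathcal D}^{-1}\cong\mathbb N^r_{\mathcal L}$ for an exact right $\mathcal D$-module category.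 For an exact $(\mathcal C,\mathcal D)$-bimodule category, the Radford isomorphism $\mathcal R_{\mathcal L}:\mathbb D_{\mathcal C}^{-1}\triangleright\mathbb S^{\mathcal C}_{\mathcal L}\Rightarrow\mathbb S^{\overline{\mathcal D}}_{\mathcal L}\triangleleft\mathbb D_{\mathcal D}^{-1}$ is the composite of these two isomorphisms through $\mathbb N^r_{\mathcal L}$. **Pivotal and spherical bimodules.** For pivotal $\mathcal C,\mathcal D$, the functors $\mathbb S^{\mathcal C}_{\mathcal L}$, $\mathbb S^{\overline{\mathcal D}}_{\mathcal L}$ (which are bimodule functors up to double-dual twists, e.g. $\mathbb S^{\mathcal C}_{\mathcal L}(c\triangleright y\triangleleft d)\cong c^{\vee\vee}\triangleright\mathbb S^{\mathcal C}_{\mathcal L}(y)\triangleleft d^{\vee\vee}$) become bimodule functors; a pivotal bimodule category is an exact one with bimodule natural isomorphisms $\tilde{\mathrm p}:\mathrm{id}_{\mathcal L}\Rightarrow\mathbb S^{\mathcal C}_{\mathcal L}$ and $\tilde{\mathrm q}:\mathrm{id}_{\mathcal L}\Rightarrow\mathbb S^{\overline{\mathcal D}}_{\mathcal L}$. For $\mathcal C,\mathcal D$ unimodular spherical, it is $(\mathbf u_{\mathcal C},\mathbf u_{\mathcal D})$-spherical if $\overline{\mathcal R}_{\mathcal L}\circ\tilde{\mathrm p}=\tilde{\mathrm q}$, where $\overline{\mathcal R}_{\mathcal L}=(\mathrm{id}\triangleleft\mathbf u_{\mathcal D}^{-1})\circ\mathcal R_{\mathcal L}\circ(\mathbf u_{\mathcal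 C}\triangleright\mathrm{id}):\mathbb S^{\mathcal C}_{\mathcal L}\Rightarrow\mathbb S^{\overline{\mathcal D}}_{\mathcal L}$. **Left and right traces.** For $p\in\mathcal L$ projective and $f\in\mathrm{Hom}_{\mathcal L}(p,p)$: $\mathrm{tr}^{\mathcal L}_{{\rm l};p}(f)$ is $\mathbf t^{\mathcal L}_p$ applied to $p\xrightarrow{f}p\xrightarrow{\mathbf u_{\mathcal C}\triangleright\tilde{\mathrm p}_p}\mathbb D_{\mathcal C}^{-1}\triangleright\mathbb S^{\mathcal C}_{\mathcal L}(p)\cong\mathbb N^r_{\mathcal L}(p)$, and $\mathrm{tr}^{\mathcal L}_{{\rm r};p}(f)$ is $\mathbf t^{\mathcal L}_p$ applied to $p\xrightarrow{f}p\xrightarrow{\tilde{\mathrm q}_p\triangleleft\mathbf u_{\mathcal D}}\mathbb S^{\overline{\mathcal D}}_{\mathcal L}(p)\triangleleft\mathbb D_{\mathcal D}^{-1}\cong\mathbb N^r_{\mathcal L}(p)$. *)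

theory Defs
  imports "HOL-Library.FuncSet" "HOL-Computational_Algebra.Polynomial"
begin

section \<open>Finite linear abelian categories\<close>

text \<open>Categories over a field whose morphisms carry their source and target, that is, different
  hom-sets are disjoint. The morphism \<open>g \<cdot> f\<close> is \<open>g\<close> after \<open>f\<close>.\<close>

record ('o, 'm, 'k) lincat =
  Obj :: "'o set"
  Hom :: "'o \<Rightarrow> 'o \<Rightarrow> 'm set"
  ide :: "'o \<Rightarrow> 'm"
  mcomp :: "'m \<Rightarrow> 'm \<Rightarrow> 'm"  (infixr "\<cdot>\<index>" 70)
  madd :: "'m \<Rightarrow> 'm \<Rightarrow> 'm"  (infixl "\<oplus>\<index>" 65)
  mzero :: "'o \<Rightarrow> 'o \<Rightarrow> 'm"
  msmul :: "'k \<Rightarrow> 'm \<Rightarrow> 'm"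

locale linear_category =
  fixes C :: "('o, 'm, 'k::field, 'z) lincat_scheme" (structure)
  assumes hom_obj: "f \<in> Hom C a b \<Longrightarrow> a \<in> Obj C \<and> b \<in> Obj C"
    and hom_disjoint: "f \<in> Hom C a b \<Longrightarrow> f \<in> Hom C a' b' \<Longrightarrow> a = a' \<and> b = b'"
    and ide_hom: "a \<in> Obj C \<Longrightarrow> ide C a \<in> Hom C a a"
    and comp_hom: "f \<in> Hom C a b \<Longrightarrow> g \<in> Hom C b c \<Longrightarrow> g \<cdot> f \<in> Hom C a c"
    and comp_ide: "f \<in> Hom C a b \<Longrightarrow> f \<cdot> ide C a = f"
    and ide_comp: "f \<in> Hom C a b \<Longrightarrow> ide C b \<cdot> f = f"
    and comp_assoc: "f \<in> Hom C a b \<Longrightarrow> g \<in> Hom C b c \<Longrightarrow> h \<in> Hom C c d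
          \<Longrightarrow> (h \<cdot> g) \<cdot> f = h \<cdot> (g \<cdot> f)"
    and add_hom: "f \<in> Hom C a b \<Longrightarrow> g \<in> Hom C a b \<Longrightarrow> f \<oplus> g \<in> Hom C a b"
    and zero_hom: "a \<in> Obj C \<Longrightarrow> b \<in> Obj C \<Longrightarrow> mzero C a b \<in> Hom C a b"
    and smul_hom: "f \<in> Hom C a b \<Longrightarrow> msmul C s f \<in> Hom C a b"
    and add_assoc: "f \<in> Hom C a b \<Longrightarrow> g \<in> Hom C a b \<Longrightarrow> h \<in> Hom C a b
          \<Longrightarrow> (f \<oplus> g) \<oplus> h = f \<oplus> (g \<oplus> h)"
    and add_commute: "f \<in> Hom C a b \<Longrightarrow> g \<in> Hom C a b \<Longrightarrow> f \<oplus> g = g \<oplus> f"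
    and add_zero: "f \<in> Hom C a b \<Longrightarrow> f \<oplus> mzero C a b = f"
    and add_inverse: "f \<in> Hom C a b \<Longrightarrow> \<exists>g \<in> Hom C a b. f \<oplus> g = mzero C a b"
    and smul_one: "f \<in> Hom C a b \<Longrightarrow> msmul C 1 f = f"
    and smul_smul: "f \<in> Hom C a b \<Longrightarrow> msmul C s (msmul C t f) = msmul C (s * t) f"
    and smul_add_left: "f \<in> Hom C a b \<Longrightarrow> msmul C (s + t) f = msmul C s f \<oplus> msmul C t f"
    and smul_add_right: "f \<in> Hom C a b \<Longrightarrow> g \<in> Hom C a b
          \<Longrightarrow> msmul C s (f \<oplus> g) = msmul C s f \<oplus> msmul C s g"
    and comp_add_left: "f \<in> Hom C a b \<Longrightarrow> g \<in> Hom C b c \<Longrightarrow> h \<in> Hom C b c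
          \<Longrightarrow> (g \<oplus> h) \<cdot> f = (g \<cdot> f) \<oplus> (h \<cdot> f)"
    and comp_add_right: "f \<in> Hom C a b \<Longrightarrow> g \<in> Hom C a b \<Longrightarrow> h \<in> Hom C b c
          \<Longrightarrow> h \<cdot> (f \<oplus> g) = (h \<cdot> f) \<oplus> (h \<cdot> g)"
    and comp_smul_left: "f \<in> Hom C a b \<Longrightarrow> g \<in> Hom C b c
          \<Longrightarrow> msmul C s g \<cdot> f = msmul C s (g \<cdot> f)"
    and comp_smul_right: "f \<in> Hom C a b \<Longrightarrow> g \<in> Hom C b c
          \<Longrightarrow> g \<cdot> msmul C s f = msmul C s (g \<cdot> f)"

context
  fixes C :: "('o, 'm, 'k::field, 'z) lincat_scheme" (structure)
begin

definition is_iso :: "'o \<Rightarrow> 'o \<Rightarrow> 'm \<Rightarrow> bool" where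
  "is_iso a b f \<longleftrightarrow> f \<in> Hom C a b \<and> (\<exists>g \<in> Hom C b a. g \<cdot> f = ide C a \<and> f \<cdot> g = ide C b)"

definition isomorphic :: "'o \<Rightarrow> 'o \<Rightarrow> bool" where
  "isomorphic a b \<longleftrightarrow> (\<exists>f. is_iso a b f)"

definition minv :: "'m \<Rightarrow> 'm" where
  "minv f = (THE g. \<exists>a b. f \<in> Hom C a b \<and> g \<in> Hom C b a \<and> g \<cdot> f = ide C a \<and> f \<cdot> g = ide C b)"

definition is_mono :: "'o \<Rightarrow> 'o \<Rightarrow> 'm \<Rightarrow> bool" where
  "is_mono a b f \<longleftrightarrow> f \<in> Hom C a b \<and>
     (\<forall>x. \<forall>g \<in> Hom C x a. \<forall>h \<in> Hom C x a. f \<cdot> g = f \<cdot> h \<longrightarrow> g = h)"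

definition is_epi :: "'o \<Rightarrow> 'o \<Rightarrow> 'm \<Rightarrow> bool" where
  "is_epi a b f \<longleftrightarrow> f \<in> Hom C a b \<and>
     (\<forall>x. \<forall>g \<in> Hom C b x. \<forall>h \<in> Hom C b x. g \<cdot> f = h \<cdot> f \<longrightarrow> g = h)"

definition is_zero :: "'o \<Rightarrow> bool" where
  "is_zero z \<longleftrightarrow> z \<in> Obj C \<and>
     (\<forall>a \<in> Obj C. Hom C a z = {mzero C a z} \<and> Hom C z a = {mzero C z a})"

text \<open>\<open>j : w \<rightarrow> a\<close> is a kernel of \<open>f : a \<rightarrow> b\<close>; dually for cokernels.\<close>

definition is_kernel :: "'o \<Rightarrow> 'o \<Rightarrow> 'o \<Rightarrow> 'm \<Rightarrow> 'm \<Rightarrow> bool" where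
  "is_kernel w a b j f \<longleftrightarrow> j \<in> Hom C w a \<and> f \<in> Hom C a b \<and> f \<cdot> j = mzero C w b \<and>
     (\<forall>x. \<forall>h \<in> Hom C x a. f \<cdot> h = mzero C x b \<longrightarrow> (\<exists>!g. g \<in> Hom C x w \<and> j \<cdot> g = h))"

definition is_cokernel :: "'o \<Rightarrow> 'o \<Rightarrow> 'o \<Rightarrow> 'm \<Rightarrow> 'm \<Rightarrow> bool" where
  "is_cokernel a b w f q \<longleftrightarrow> f \<in> Hom C a b \<and> q \<in> Hom C b w \<and> q \<cdot> f = mzero C a w \<and>
     (\<forall>x. \<forall>h \<in> Hom C b x. h \<cdot> f = mzero C a x \<longrightarrow> (\<exists>!g. g \<in> Hom C w x \<and> g \<cdot> q = h))"

definition short_exact :: "'o \<Rightarrow> 'o \<Rightarrow> 'o \<Rightarrow> 'm \<Rightarrow> 'm \<Rightarrow> bool" where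
  "short_exact a b c f g \<longleftrightarrow> is_kernel a b c f g \<and> is_cokernel a b c f g"

definition simple :: "'o \<Rightarrow> bool" where
  "simple s \<longleftrightarrow> s \<in> Obj C \<and> \<not> is_zero s \<and>
     (\<forall>a f. is_mono a s f \<longrightarrow> is_zero a \<or> is_iso a s f)"

definition projective :: "'o \<Rightarrow> bool" where
  "projective p \<longleftrightarrow> p \<in> Obj C \<and>
     (\<forall>a b e. \<forall>f \<in> Hom C p b. is_epi a b e \<longrightarrow> (\<exists>g \<in> Hom C p a. e \<cdot> g = f))"

inductive finite_length :: "'o \<Rightarrow> bool" where
  zero: "is_zero a \<Longrightarrow> finite_length a"
| extension: "finite_length a \<Longrightarrow> simple s \<Longrightarrow> short_exact a b s f g \<Longrightarrow> finite_length b"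

definition lincomb :: "'o \<Rightarrow> 'o \<Rightarrow> ('k \<times> 'm) list \<Rightarrow> 'm" where
  "lincomb a b xs = foldr (\<lambda>(s, f) r. msmul C s f \<oplus> r) xs (mzero C a b)"

definition finite_dim_hom :: "'o \<Rightarrow> 'o \<Rightarrow> bool" where
  "finite_dim_hom a b \<longleftrightarrow> (\<exists>fs. set fs \<subseteq> Hom C a b \<and>
     (\<forall>g \<in> Hom C a b. \<exists>ss. length ss = length fs \<and> g = lincomb a b (zip ss fs)))"

end

locale finite_abelian_category = linear_category +
  assumes ex_zero: "\<exists>z. is_zero C z"
    and ex_biproduct: "a \<in> Obj C \<Longrightarrow> b \<in> Obj C \<Longrightarrow>
          \<exists>s. \<exists>i1 \<in> Hom C a s. \<exists>i2 \<in> Hom C b s. \<exists>p1 \<in> Hom C s a. \<exists>p2 \<in> Hom C s b.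
            p1 \<cdot> i1 = ide C a \<and> p2 \<cdot> i2 = ide C b \<and> p1 \<cdot> i2 = mzero C b a \<and>
            p2 \<cdot> i1 = mzero C a b \<and> (i1 \<cdot> p1) \<oplus> (i2 \<cdot> p2) = ide C s"
    and ex_kernel: "f \<in> Hom C a b \<Longrightarrow> \<exists>w j. is_kernel C w a b j f"
    and ex_cokernel: "f \<in> Hom C a b \<Longrightarrow> \<exists>w q. is_cokernel C a b w f q"
    and mono_kernel: "is_mono C a b f \<Longrightarrow> \<exists>c g. is_kernel C a b c f g"
    and epi_cokernel: "is_epi C b c g \<Longrightarrow> \<exists>a f. is_cokernel C a b c f g"
    and finite_dim: "a \<in> Obj C \<Longrightarrow> b \<in> Obj C \<Longrightarrow> finite_dim_hom C a b"
    and finite_len: "a \<in> Obj C \<Longrightarrow> finite_length C a"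
    and enough_projectives: "a \<in> Obj C \<Longrightarrow> \<exists>p e. projective C p \<and> is_epi C p a e"
    and finite_simples: "\<exists>S. finite S \<and> (\<forall>s. simple C s \<longrightarrow> (\<exists>t \<in> S. isomorphic C s t))"

definition linear_functor ::
  "('o1, 'm1, 'k::field, 'y) lincat_scheme \<Rightarrow> ('o2, 'm2, 'k, 'z) lincat_scheme
     \<Rightarrow> ('o1 \<Rightarrow> 'o2) \<Rightarrow> ('m1 \<Rightarrow> 'm2) \<Rightarrow> bool" where
  "linear_functor X Y fo fm \<longleftrightarrow>
     (\<forall>a \<in> Obj X. fo a \<in> Obj Y \<and> fm (ide X a) = ide Y (fo a)) \<and>
     (\<forall>a b. \<forall>f \<in> Hom X a b. fm f \<in> Hom Y (fo a) (fo b)) \<and>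
     (\<forall>a b c. \<forall>f \<in> Hom X a b. \<forall>g \<in> Hom X b c. fm (g \<cdot>\<^bsub>X\<^esub> f) = fm g \<cdot>\<^bsub>Y\<^esub> fm f) \<and>
     (\<forall>a b. \<forall>f \<in> Hom X a b. \<forall>g \<in> Hom X a b. fm (f \<oplus>\<^bsub>X\<^esub> g) = fm f \<oplus>\<^bsub>Y\<^esub> fm g) \<and>
     (\<forall>a b s. \<forall>f \<in> Hom X a b. fm (msmul X s f) = msmul Y s (fm f))"

definition exact_functor ::
  "('o1, 'm1, 'k::field, 'y) lincat_scheme \<Rightarrow> ('o2, 'm2, 'k, 'z) lincat_scheme
     \<Rightarrow> ('o1 \<Rightarrow> 'o2) \<Rightarrow> ('m1 \<Rightarrow> 'm2) \<Rightarrow> bool" where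
  "exact_functor X Y fo fm \<longleftrightarrow> linear_functor X Y fo fm \<and>
     (\<forall>a b c f g. short_exact X a b c f g \<longrightarrow> short_exact Y (fo a) (fo b) (fo c) (fm f) (fm g))"

definition bilinear_bifunctor ::
  "('o1, 'm1, 'k::field, 'x) lincat_scheme \<Rightarrow> ('o2, 'm2, 'k, 'y) lincat_scheme
     \<Rightarrow> ('o3, 'm3, 'k, 'z) lincat_scheme \<Rightarrow> ('o1 \<Rightarrow> 'o2 \<Rightarrow> 'o3) \<Rightarrow> ('m1 \<Rightarrow> 'm2 \<Rightarrow> 'm3) \<Rightarrow> bool" where
  "bilinear_bifunctor X Y Z bo bm \<longleftrightarrow>
     (\<forall>a \<in> Obj X. linear_functor Y Z (bo a) (bm (ide X a))) \<and>
     (\<forall>b \<in> Obj Y. linear_functor X Z (\<lambda>a. bo a b) (\<lambda>f. bm f (ide Y b))) \<and>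
     (\<forall>a a' b b'. \<forall>f \<in> Hom X a a'. \<forall>g \<in> Hom Y b b'.
        bm f g = bm f (ide Y b') \<cdot>\<^bsub>Z\<^esub> bm (ide X a) g \<and>
        bm f g = bm (ide X a') g \<cdot>\<^bsub>Z\<^esub> bm f (ide Y b))"

section \<open>The Nakayama functor and the twisted trace\<close>

text \<open>The linear dual of a hom-space; functionals are extensional functions on it.\<close>

definition hom_dual :: "('o, 'm, 'k::field, 'z) lincat_scheme \<Rightarrow> 'o \<Rightarrow> 'o \<Rightarrow> ('m \<Rightarrow> 'k) set" where
  "hom_dual X a b = {\<phi> \<in> extensional (Hom X a b).
     (\<forall>f \<in> Hom X a b. \<forall>g \<in> Hom X a b. \<phi> (f \<oplus>\<^bsub>X\<^esub> g) = \<phi> f + \<phi> g) \<and>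
     (\<forall>s. \<forall>f \<in> Hom X a b. \<phi> (msmul X s f) = s * \<phi> f)}"

text \<open>Dinatural families \<open>Hom(y,x)\<^sup>* \<otimes> x \<rightarrow> z\<close>, \<open>x \<in> X\<close>. By the defining property of the copower
  \<open>V \<otimes> x\<close>, a morphism \<open>V \<otimes> x \<rightarrow> z\<close> is a linear map \<open>V \<rightarrow> Hom(x,z)\<close>; so the component at \<open>x\<close> is
  given as a linear map \<open>j x : Hom(y,x)\<^sup>* \<rightarrow> Hom(x,z)\<close>, and the last clause is dinaturality.\<close>

definition nakayama_wedge ::
  "('o, 'm, 'k::field, 'z) lincat_scheme \<Rightarrow> 'o \<Rightarrow> 'o \<Rightarrow> ('o \<Rightarrow> ('m \<Rightarrow> 'k) \<Rightarrow> 'm) \<Rightarrow> bool" where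
  "nakayama_wedge X y z j \<longleftrightarrow>
     (\<forall>x \<in> Obj X. \<forall>\<phi> \<in> hom_dual X y x. j x \<phi> \<in> Hom X x z) \<and>
     (\<forall>x \<in> Obj X. \<forall>\<phi> \<in> hom_dual X y x. \<forall>\<psi> \<in> hom_dual X y x.
        j x (\<lambda>f\<in>Hom X y x. \<phi> f + \<psi> f) = j x \<phi> \<oplus>\<^bsub>X\<^esub> j x \<psi>) \<and>
     (\<forall>x \<in> Obj X. \<forall>s. \<forall>\<phi> \<in> hom_dual X y x. j x (\<lambda>f\<in>Hom X y x. s * \<phi> f) = msmul X s (j x \<phi>)) \<and>
     (\<forall>x x'. \<forall>h \<in> Hom X x x'. \<forall>\<phi> \<in> hom_dual X y x'.
        j x' \<phi> \<cdot>\<^bsub>X\<^esub> h = j x (\<lambda>f\<in>Hom X y x. \<phi> (h \<cdot>\<^bsub>X\<^esub> f)))"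

text \<open>The object \<open>nob y\<close> is the coend of \<open>Hom(y,x)\<^sup>* \<otimes> x\<close> over \<open>x\<close>, with dinatural family \<open>ninc y\<close>.\<close>

record ('o, 'm, 'k) nakayama_data =
  nob :: "'o \<Rightarrow> 'o"
  ninc :: "'o \<Rightarrow> 'o \<Rightarrow> ('m \<Rightarrow> 'k) \<Rightarrow> 'm"

definition nakayama ::
  "('o, 'm, 'k::field, 'z) lincat_scheme \<Rightarrow> ('o, 'm, 'k) nakayama_data \<Rightarrow> bool" where
  "nakayama X N \<longleftrightarrow> (\<forall>y \<in> Obj X. nob N y \<in> Obj X \<and> nakayama_wedge X y (nob N y) (ninc N y) \<and>
     (\<forall>z \<in> Obj X. \<forall>j. nakayama_wedge X y z j \<longrightarrow>
        (\<exists>!g. g \<in> Hom X (nob N y) z \<and>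
           (\<forall>x \<in> Obj X. \<forall>\<phi> \<in> hom_dual X y x. g \<cdot>\<^bsub>X\<^esub> ninc N y x \<phi> = j x \<phi>))))"

definition nmor ::
  "('o, 'm, 'k::field, 'z) lincat_scheme \<Rightarrow> ('o, 'm, 'k) nakayama_data \<Rightarrow> 'o \<Rightarrow> 'o \<Rightarrow> 'm \<Rightarrow> 'm" where
  "nmor X N y y' f = (THE g. g \<in> Hom X (nob N y) (nob N y') \<and>
     (\<forall>x \<in> Obj X. \<forall>\<phi> \<in> hom_dual X y x.
        g \<cdot>\<^bsub>X\<^esub> ninc N y x \<phi> = ninc N y' x (\<lambda>h\<in>Hom X y' x. \<phi> (h \<cdot>\<^bsub>X\<^esub> f))))"

text \<open>For projective \<open>p\<close> the component \<open>ninc p x : Hom(p,x)\<^sup>* \<rightarrow> Hom(x, N p)\<close> of the coend is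
  bijective. The isomorphism \<open>Hom(p,x) \<rightarrow> Hom(x, N p)\<^sup>*\<close> sends \<open>f\<close> to the functional that takes \<open>g\<close> to
  \<open>\<phi>(f)\<close>, where \<open>\<phi>\<close> is the preimage of \<open>g\<close>.\<close>

definition nakayama_pairing ::
  "('o, 'm, 'k::field, 'z) lincat_scheme \<Rightarrow> ('o, 'm, 'k) nakayama_data \<Rightarrow> 'o \<Rightarrow> 'o \<Rightarrow> 'm \<Rightarrow> 'm \<Rightarrow> 'k" where
  "nakayama_pairing X N p x f =
     (\<lambda>g \<in> Hom X x (nob N p). (THE \<phi>. \<phi> \<in> hom_dual X p x \<and> ninc N p x \<phi> = g) f)"

definition twisted_trace ::
  "('o, 'm, 'k::field, 'z) lincat_scheme \<Rightarrow> ('o, 'm, 'k) nakayama_data \<Rightarrow> 'o \<Rightarrow> 'm \<Rightarrow> 'k" where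
  "twisted_trace X N p = nakayama_pairing X N p p (ide X p)"

text \<open>The canonical morphism \<open>N\<^sub>Y(F x) \<rightarrow> H(N\<^sub>X x)\<close> for adjunctions \<open>F \<stileturn> G \<stileturn> H\<close> with \<open>F, H : X \<rightarrow> Y\<close>
  (so \<open>H\<close> is the double right adjoint of \<open>F\<close>), where \<open>eps y : F(G y) \<rightarrow> y\<close> is the counit of
  \<open>F \<stileturn> G\<close> and \<open>eta y : y \<rightarrow> H(G y)\<close> the unit of \<open>G \<stileturn> H\<close>. It is the comparison of coends
  \<open>Hom(F x, y)\<^sup>* \<otimes> y \<cong> Hom(x, G y)\<^sup>* \<otimes> y \<rightarrow> Hom(x, G y)\<^sup>* \<otimes> H(G y) \<rightarrow> H(N\<^sub>X x)\<close>.\<close>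

definition nakayama_comparison ::
  "('o1, 'm1, 'k::field, 'y) lincat_scheme \<Rightarrow> ('o2, 'm2, 'k, 'z) lincat_scheme
     \<Rightarrow> ('o1, 'm1, 'k) nakayama_data \<Rightarrow> ('o2, 'm2, 'k) nakayama_data
     \<Rightarrow> ('o1 \<Rightarrow> 'o2) \<Rightarrow> ('m1 \<Rightarrow> 'm2) \<Rightarrow> ('o2 \<Rightarrow> 'o1) \<Rightarrow> ('o2 \<Rightarrow> 'm2)
     \<Rightarrow> ('o1 \<Rightarrow> 'o2) \<Rightarrow> ('m1 \<Rightarrow> 'm2) \<Rightarrow> ('o2 \<Rightarrow> 'm2) \<Rightarrow> 'o1 \<Rightarrow> 'm2" where
  "nakayama_comparison X Y NX NY Fo Fm Go eps Ho Hm eta x =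
     (THE \<psi>. \<psi> \<in> Hom Y (nob NY (Fo x)) (Ho (nob NX x)) \<and>
        (\<forall>y \<in> Obj Y. \<forall>\<phi> \<in> hom_dual Y (Fo x) y.
           \<psi> \<cdot>\<^bsub>Y\<^esub> ninc NY (Fo x) y \<phi> =
           Hm (ninc NX x (Go y) (\<lambda>h\<in>Hom X x (Go y). \<phi> (eps y \<cdot>\<^bsub>Y\<^esub> Fm h))) \<cdot>\<^bsub>Y\<^esub> eta y))"

section \<open>Finite tensor categories\<close>

text \<open>The associator is \<open>assoc a b c : (a \<otimes> b) \<otimes> c \<rightarrow> a \<otimes> (b \<otimes> c)\<close>. Conventions for duals:
  \<open>evr a : a\<^sup>\<or> \<otimes> a \<rightarrow> 1\<close>, \<open>coevr a : 1 \<rightarrow> a \<otimes> a\<^sup>\<or>\<close> with \<open>a\<^sup>\<or> = rdual a\<close>;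
  \<open>evl a : a \<otimes> \<^sup>\<or>a \<rightarrow> 1\<close>, \<open>coevl a : 1 \<rightarrow> \<^sup>\<or>a \<otimes> a\<close> with \<open>\<^sup>\<or>a = ldual a\<close>.\<close>

record ('o, 'm, 'k) tencat = "('o, 'm, 'k) lincat" +
  ten :: "'o \<Rightarrow> 'o \<Rightarrow> 'o"  (infixr "\<otimes>\<index>" 75)
  tenm :: "'m \<Rightarrow> 'm \<Rightarrow> 'm"  (infixr "\<boxtimes>\<index>" 75)
  one :: "'o"  ("\<one>\<index>")
  assoc :: "'o \<Rightarrow> 'o \<Rightarrow> 'o \<Rightarrow> 'm"
  lunit :: "'o \<Rightarrow> 'm"
  runit :: "'o \<Rightarrow> 'm"
  rdual :: "'o \<Rightarrow> 'o"
  evr :: "'o \<Rightarrow> 'm"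
  coevr :: "'o \<Rightarrow> 'm"
  ldual :: "'o \<Rightarrow> 'o"
  evl :: "'o \<Rightarrow> 'm"
  coevl :: "'o \<Rightarrow> 'm"

text \<open>\<open>d\<close> is a right dual of \<open>a\<close> (equivalently, \<open>a\<close> is a left dual of \<open>d\<close>).\<close>

definition dual_pair ::
  "('o, 'm, 'k::field) tencat \<Rightarrow> 'o \<Rightarrow> 'o \<Rightarrow> 'm \<Rightarrow> 'm \<Rightarrow> bool" where
  "dual_pair C d a ev coev \<longleftrightarrow> d \<in> Obj C \<and>
     ev \<in> Hom C (d \<otimes>\<^bsub>C\<^esub> a) \<one>\<^bsub>C\<^esub> \<and> coev \<in> Hom C \<one>\<^bsub>C\<^esub> (a \<otimes>\<^bsub>C\<^esub> d) \<and>
     runit C a \<cdot>\<^bsub>C\<^esub> (ide C a \<boxtimes>\<^bsub>C\<^esub> ev) \<cdot>\<^bsub>C\<^esub> assoc C a d a \<cdot>\<^bsub>C\<^esub> (coev \<boxtimes>\<^bsub>C\<^esub> ide C a) = lunit C a \<and>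
     lunit C d \<cdot>\<^bsub>C\<^esub> (ev \<boxtimes>\<^bsub>C\<^esub> ide C d) \<cdot>\<^bsub>C\<^esub> minv C (assoc C d a d) \<cdot>\<^bsub>C\<^esub> (ide C d \<boxtimes>\<^bsub>C\<^esub> coev) = runit C d"

locale finite_tensor_category =
  finite_abelian_category C for C :: "('o, 'm, 'k::field) tencat" (structure) +
  assumes tensor: "bilinear_bifunctor C C C (ten C) (tenm C)"
    and assoc_iso: "a \<in> Obj C \<Longrightarrow> b \<in> Obj C \<Longrightarrow> c \<in> Obj C
          \<Longrightarrow> is_iso C ((a \<otimes> b) \<otimes> c) (a \<otimes> (b \<otimes> c)) (assoc C a b c)"
    and assoc_nat: "f \<in> Hom C a a' \<Longrightarrow> g \<in> Hom C b b' \<Longrightarrow> h \<in> Hom C c c'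
          \<Longrightarrow> assoc C a' b' c' \<cdot> ((f \<boxtimes> g) \<boxtimes> h) = (f \<boxtimes> (g \<boxtimes> h)) \<cdot> assoc C a b c"
    and lunit_iso: "a \<in> Obj C \<Longrightarrow> is_iso C (\<one> \<otimes> a) a (lunit C a)"
    and lunit_nat: "f \<in> Hom C a b \<Longrightarrow> lunit C b \<cdot> (ide C \<one> \<boxtimes> f) = f \<cdot> lunit C a"
    and runit_iso: "a \<in> Obj C \<Longrightarrow> is_iso C (a \<otimes> \<one>) a (runit C a)"
    and runit_nat: "f \<in> Hom C a b \<Longrightarrow> runit C b \<cdot> (f \<boxtimes> ide C \<one>) = f \<cdot> runit C a"
    and pentagon: "a \<in> Obj C \<Longrightarrow> b \<in> Obj C \<Longrightarrow> c \<in> Obj C \<Longrightarrow> d \<in> Obj C \<Longrightarrow>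
          assoc C a b (c \<otimes> d) \<cdot> assoc C (a \<otimes> b) c d =
          (ide C a \<boxtimes> assoc C b c d) \<cdot> assoc C a (b \<otimes> c) d \<cdot> (assoc C a b c \<boxtimes> ide C d)"
    and triangle: "a \<in> Obj C \<Longrightarrow> b \<in> Obj C \<Longrightarrow>
          (ide C a \<boxtimes> lunit C b) \<cdot> assoc C a \<one> b = runit C a \<boxtimes> ide C b"
    and right_dual: "a \<in> Obj C \<Longrightarrow> dual_pair C (rdual C a) a (evr C a) (coevr C a)"
    and left_dual: "a \<in> Obj C \<Longrightarrow> ldual C a \<in> Obj C \<and> dual_pair C a (ldual C a) (evl C a) (coevl C a)"
    and unit_simple: "simple C \<one>"

text \<open>The same category with reversed tensor product; left and right duals are exchanged.\<close>

definition rev_tensor :: "('o, 'm, 'k::field) tencat \<Rightarrow> ('o, 'm, 'k) tencat" where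
  "rev_tensor C = C\<lparr>
     ten := (\<lambda>a b. b \<otimes>\<^bsub>C\<^esub> a), tenm := (\<lambda>f g. g \<boxtimes>\<^bsub>C\<^esub> f),
     assoc := (\<lambda>a b c. minv C (assoc C c b a)), lunit := runit C, runit := lunit C,
     rdual := ldual C, evr := evl C, coevr := coevl C,
     ldual := rdual C, evl := evr C, coevl := coevr C\<rparr>"

text \<open>The morphism \<open>x \<rightarrow> a\<^sup>\<or>\<close> corresponding to \<open>h : x \<otimes> a \<rightarrow> 1\<close>.\<close>

definition rmate :: "('o, 'm, 'k::field) tencat \<Rightarrow> 'o \<Rightarrow> 'o \<Rightarrow> 'm \<Rightarrow> 'm" where
  "rmate C x a h = (THE g. g \<in> Hom C x (rdual C a) \<and> evr C a \<cdot>\<^bsub>C\<^esub> (g \<boxtimes>\<^bsub>C\<^esub> ide C a) = h)"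

text \<open>\<open>f\<^sup>\<or> : b\<^sup>\<or> \<rightarrow> a\<^sup>\<or>\<close> for \<open>f : a \<rightarrow> b\<close>\<close>

definition rdualm :: "('o, 'm, 'k::field) tencat \<Rightarrow> 'o \<Rightarrow> 'o \<Rightarrow> 'm \<Rightarrow> 'm" where
  "rdualm C a b f = rmate C (rdual C b) a (evr C b \<cdot>\<^bsub>C\<^esub> (ide C (rdual C b) \<boxtimes>\<^bsub>C\<^esub> f))"

text \<open>\<open>b\<^sup>\<or> \<otimes> a\<^sup>\<or> \<rightarrow> (a \<otimes> b)\<^sup>\<or>\<close> and \<open>1 \<rightarrow> 1\<^sup>\<or>\<close>\<close>

definition dual_ten :: "('o, 'm, 'k::field) tencat \<Rightarrow> 'o \<Rightarrow> 'o \<Rightarrow> 'm" where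
  "dual_ten C a b = (let a' = rdual C a; b' = rdual C b in
     rmate C (b' \<otimes>\<^bsub>C\<^esub> a') (a \<otimes>\<^bsub>C\<^esub> b)
       (evr C b \<cdot>\<^bsub>C\<^esub> (ide C b' \<boxtimes>\<^bsub>C\<^esub> (lunit C b \<cdot>\<^bsub>C\<^esub> (evr C a \<boxtimes>\<^bsub>C\<^esub> ide C b) \<cdot>\<^bsub>C\<^esub> minv C (assoc C a' a b)))
          \<cdot>\<^bsub>C\<^esub> assoc C b' a' (a \<otimes>\<^bsub>C\<^esub> b)))"

definition dual_one :: "('o, 'm, 'k::field) tencat \<Rightarrow> 'm" where
  "dual_one C = rmate C \<one>\<^bsub>C\<^esub> \<one>\<^bsub>C\<^esub> (lunit C \<one>\<^bsub>C\<^esub>)"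

abbreviation rddual :: "('o, 'm, 'k::field) tencat \<Rightarrow> 'o \<Rightarrow> 'o" where
  "rddual C a \<equiv> rdual C (rdual C a)"

abbreviation lddual :: "('o, 'm, 'k::field) tencat \<Rightarrow> 'o \<Rightarrow> 'o" where
  "lddual C a \<equiv> ldual C (ldual C a)"

definition rddualm :: "('o, 'm, 'k::field) tencat \<Rightarrow> 'o \<Rightarrow> 'o \<Rightarrow> 'm \<Rightarrow> 'm" where
  "rddualm C a b f = rdualm C (rdual C b) (rdual C a) (rdualm C a b f)"

text \<open>Canonical isomorphisms \<open>a \<rightarrow> (\<^sup>\<or>a)\<^sup>\<or>\<close> and \<open>a \<rightarrow> (\<^sup>\<or>\<^sup>\<or>a)\<^sup>\<or>\<^sup>\<or>\<close>. For \<open>rev_tensor C\<close> they read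
  \<open>a \<rightarrow> \<^sup>\<or>(a\<^sup>\<or>)\<close> and \<open>a \<rightarrow> \<^sup>\<or>\<^sup>\<or>(a\<^sup>\<or>\<^sup>\<or>)\<close>.\<close>

definition dual_cancel :: "('o, 'm, 'k::field) tencat \<Rightarrow> 'o \<Rightarrow> 'm" where
  "dual_cancel C a = rmate C a (ldual C a) (evl C a)"

definition ddual_cancel :: "('o, 'm, 'k::field) tencat \<Rightarrow> 'o \<Rightarrow> 'm" where
  "ddual_cancel C a =
     minv C (rdualm C (ldual C a) (rdual C (lddual C a)) (dual_cancel C (ldual C a)))
       \<cdot>\<^bsub>C\<^esub> dual_cancel C a"

text \<open>A pivotal structure is a monoidal natural isomorphism \<open>p : id \<Rightarrow> (-)\<^sup>\<or>\<^sup>\<or>\<close>; the monoidal structure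
  \<open>a\<^sup>\<or>\<^sup>\<or> \<otimes> b\<^sup>\<or>\<^sup>\<or> \<cong> (b\<^sup>\<or> \<otimes> a\<^sup>\<or>)\<^sup>\<or> \<cong> (a \<otimes> b)\<^sup>\<or>\<^sup>\<or>\<close>, \<open>1 \<cong> 1\<^sup>\<or> \<cong> 1\<^sup>\<or>\<^sup>\<or>\<close> of the double dual is built from
  \<open>dual_ten\<close> and \<open>dual_one\<close>.\<close>

definition pivotal :: "('o, 'm, 'k::field) tencat \<Rightarrow> ('o \<Rightarrow> 'm) \<Rightarrow> bool" where
  "pivotal C p \<longleftrightarrow>
     (\<forall>a \<in> Obj C. is_iso C a (rddual C a) (p a)) \<and>
     (\<forall>a b. \<forall>f \<in> Hom C a b. p b \<cdot>\<^bsub>C\<^esub> f = rddualm C a b f \<cdot>\<^bsub>C\<^esub> p a) \<and>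
     (\<forall>a \<in> Obj C. \<forall>b \<in> Obj C.
        p (a \<otimes>\<^bsub>C\<^esub> b) =
        minv C (rdualm C (rdual C b \<otimes>\<^bsub>C\<^esub> rdual C a) (rdual C (a \<otimes>\<^bsub>C\<^esub> b)) (dual_ten C a b))
          \<cdot>\<^bsub>C\<^esub> dual_ten C (rdual C b) (rdual C a) \<cdot>\<^bsub>C\<^esub> (p a \<boxtimes>\<^bsub>C\<^esub> p b)) \<and>
     p \<one>\<^bsub>C\<^esub> = minv C (rdualm C \<one>\<^bsub>C\<^esub> (rdual C \<one>\<^bsub>C\<^esub>) (dual_one C)) \<cdot>\<^bsub>C\<^esub> dual_one C"

text \<open>The isomorphism \<open>a \<rightarrow> \<^sup>\<or>\<^sup>\<or>a\<close> induced by a pivotal structure: the inverse of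
  \<open>p : \<^sup>\<or>\<^sup>\<or>a \<rightarrow> (\<^sup>\<or>\<^sup>\<or>a)\<^sup>\<or>\<^sup>\<or> \<cong> a\<close>. It is a pivotal structure on \<open>rev_tensor C\<close>.\<close>

definition left_pivotal :: "('o, 'm, 'k::field) tencat \<Rightarrow> ('o \<Rightarrow> 'm) \<Rightarrow> 'o \<Rightarrow> 'm" where
  "left_pivotal C p a = minv C (minv C (ddual_cancel C a) \<cdot>\<^bsub>C\<^esub> p (lddual C a))"

section \<open>Module and bimodule categories\<close>

text \<open>Left actions: \<open>massoc a b y : (a \<otimes> b) \<rhd> y \<rightarrow> a \<rhd> (b \<rhd> y)\<close> and \<open>munit y : 1 \<rhd> y \<rightarrow> y\<close>.\<close>

record ('oc, 'mc, 'ol, 'ml) action =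
  act :: "'oc \<Rightarrow> 'ol \<Rightarrow> 'ol"  (infixr "\<rhd>\<index>" 75)
  actm :: "'mc \<Rightarrow> 'ml \<Rightarrow> 'ml"  (infixr "\<unrhd>\<index>" 75)
  massoc :: "'oc \<Rightarrow> 'oc \<Rightarrow> 'ol \<Rightarrow> 'ml"
  munit :: "'ol \<Rightarrow> 'ml"

locale module_category =
  fixes C :: "('oc, 'mc, 'k::field) tencat"
    and L :: "('ol, 'ml, 'k) lincat" (structure)
    and M :: "('oc, 'mc, 'ol, 'ml) action" (structure)
  assumes base: "finite_abelian_category L"
    and action: "bilinear_bifunctor C L L (act M) (actm M)"
    and act_exact_right: "c \<in> Obj C \<Longrightarrow> exact_functor L L (act M c) (actm M (ide C c))"
    and act_exact_left: "y \<in> Obj L \<Longrightarrow> exact_functor C L (\<lambda>c. c \<rhd>\<^bsub>M\<^esub> y) (\<lambda>f. f \<unrhd>\<^bsub>M\<^esub> ide L y)"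
    and massoc_iso: "a \<in> Obj C \<Longrightarrow> b \<in> Obj C \<Longrightarrow> y \<in> Obj L
          \<Longrightarrow> is_iso L ((a \<otimes>\<^bsub>C\<^esub> b) \<rhd>\<^bsub>M\<^esub> y) (a \<rhd>\<^bsub>M\<^esub> (b \<rhd>\<^bsub>M\<^esub> y)) (massoc M a b y)"
    and massoc_nat: "f \<in> Hom C a a' \<Longrightarrow> g \<in> Hom C b b' \<Longrightarrow> h \<in> Hom L y y'
          \<Longrightarrow> massoc M a' b' y' \<cdot>\<^bsub>L\<^esub> ((f \<boxtimes>\<^bsub>C\<^esub> g) \<unrhd>\<^bsub>M\<^esub> h) = (f \<unrhd>\<^bsub>M\<^esub> (g \<unrhd>\<^bsub>M\<^esub> h)) \<cdot>\<^bsub>L\<^esub> massoc M a b y"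
    and munit_iso: "y \<in> Obj L \<Longrightarrow> is_iso L (\<one>\<^bsub>C\<^esub> \<rhd>\<^bsub>M\<^esub> y) y (munit M y)"
    and munit_nat: "h \<in> Hom L y y' \<Longrightarrow> munit M y' \<cdot>\<^bsub>L\<^esub> (ide C \<one>\<^bsub>C\<^esub> \<unrhd>\<^bsub>M\<^esub> h) = h \<cdot>\<^bsub>L\<^esub> munit M y"
    and mpentagon: "a \<in> Obj C \<Longrightarrow> b \<in> Obj C \<Longrightarrow> c \<in> Obj C \<Longrightarrow> y \<in> Obj L \<Longrightarrow>
          massoc M a b (c \<rhd>\<^bsub>M\<^esub> y) \<cdot>\<^bsub>L\<^esub> massoc M (a \<otimes>\<^bsub>C\<^esub> b) c y =
          (ide C a \<unrhd>\<^bsub>M\<^esub> massoc M b c y) \<cdot>\<^bsub>L\<^esub> massoc M a (b \<otimes>\<^bsub>C\<^esub> c) y \<cdot>\<^bsub>L\<^esub> (assoc C a b c \<unrhd>\<^bsub>M\<^esub> ide L y)"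
    and mtriangle: "a \<in> Obj C \<Longrightarrow> y \<in> Obj L \<Longrightarrow>
          (ide C a \<unrhd>\<^bsub>M\<^esub> munit M y) \<cdot>\<^bsub>L\<^esub> massoc M a \<one>\<^bsub>C\<^esub> y = runit C a \<unrhd>\<^bsub>M\<^esub> ide L y"

definition exact_module_category ::
  "('oc, 'mc, 'k::field) tencat \<Rightarrow> ('ol, 'ml, 'k) lincat \<Rightarrow> ('oc, 'mc, 'ol, 'ml) action \<Rightarrow> bool" where
  "exact_module_category C L M \<longleftrightarrow> module_category C L M \<and>
     (\<forall>p y. projective C p \<longrightarrow> y \<in> Obj L \<longrightarrow> projective L (p \<rhd>\<^bsub>M\<^esub> y))"

definition regular_action :: "('o, 'm, 'k::field) tencat \<Rightarrow> ('o, 'm, 'o, 'm) action" where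
  "regular_action C = \<lparr>act = ten C, actm = tenm C, massoc = assoc C, munit = lunit C\<rparr>"

text \<open>A \<open>(C, D)\<close>-bimodule category. The right \<open>D\<close>-action is stored as the left action \<open>ract\<close> of
  \<open>rev_tensor D\<close>, so \<open>y \<lhd> d\<close> is \<open>d \<rhd>\<^bsub>ract B\<^esub> y\<close>; the constraint is
  \<open>bassoc c y d : (c \<rhd> y) \<lhd> d \<rightarrow> c \<rhd> (y \<lhd> d)\<close>.\<close>

record ('oc, 'mc, 'od, 'md, 'ol, 'ml, 'k) bimod =
  cat :: "('ol, 'ml, 'k) lincat"
  lact :: "('oc, 'mc, 'ol, 'ml) action"
  ract :: "('od, 'md, 'ol, 'ml) action"
  bassoc :: "'oc \<Rightarrow> 'ol \<Rightarrow> 'od \<Rightarrow> 'ml"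

definition exact_bimodule_category ::
  "('oc, 'mc, 'k::field) tencat \<Rightarrow> ('od, 'md, 'k) tencat
     \<Rightarrow> ('oc, 'mc, 'od, 'md, 'ol, 'ml, 'k) bimod \<Rightarrow> bool" where
  "exact_bimodule_category C D B \<longleftrightarrow> (let L = cat B; M = lact B; R = ract B in
     exact_module_category C L M \<and> exact_module_category (rev_tensor D) L R \<and>
     (\<forall>c \<in> Obj C. \<forall>y \<in> Obj L. \<forall>d \<in> Obj D.
        is_iso L (d \<rhd>\<^bsub>R\<^esub> (c \<rhd>\<^bsub>M\<^esub> y)) (c \<rhd>\<^bsub>M\<^esub> (d \<rhd>\<^bsub>R\<^esub> y)) (bassoc B c y d)) \<and>
     (\<forall>c c' d d' y y'. \<forall>f \<in> Hom C c c'. \<forall>g \<in> Hom D d d'. \<forall>h \<in> Hom L y y'.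
        bassoc B c' y' d' \<cdot>\<^bsub>L\<^esub> (g \<unrhd>\<^bsub>R\<^esub> (f \<unrhd>\<^bsub>M\<^esub> h)) = (f \<unrhd>\<^bsub>M\<^esub> (g \<unrhd>\<^bsub>R\<^esub> h)) \<cdot>\<^bsub>L\<^esub> bassoc B c y d) \<and>
     (\<forall>a \<in> Obj C. \<forall>c \<in> Obj C. \<forall>y \<in> Obj L. \<forall>d \<in> Obj D.
        massoc M a c (d \<rhd>\<^bsub>R\<^esub> y) \<cdot>\<^bsub>L\<^esub> bassoc B (a \<otimes>\<^bsub>C\<^esub> c) y d =
        (ide C a \<unrhd>\<^bsub>M\<^esub> bassoc B c y d) \<cdot>\<^bsub>L\<^esub> bassoc B a (c \<rhd>\<^bsub>M\<^esub> y) d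
          \<cdot>\<^bsub>L\<^esub> (ide D d \<unrhd>\<^bsub>R\<^esub> massoc M a c y)) \<and>
     (\<forall>c \<in> Obj C. \<forall>y \<in> Obj L. \<forall>d \<in> Obj D. \<forall>e \<in> Obj D.
        (ide C c \<unrhd>\<^bsub>M\<^esub> massoc R e d y) \<cdot>\<^bsub>L\<^esub> bassoc B c y (d \<otimes>\<^bsub>D\<^esub> e) =
        bassoc B c (d \<rhd>\<^bsub>R\<^esub> y) e \<cdot>\<^bsub>L\<^esub> (ide D e \<unrhd>\<^bsub>R\<^esub> bassoc B c y d)
          \<cdot>\<^bsub>L\<^esub> massoc R e d (c \<rhd>\<^bsub>M\<^esub> y)) \<and>
     (\<forall>y \<in> Obj L. \<forall>d \<in> Obj D.
        munit M (d \<rhd>\<^bsub>R\<^esub> y) \<cdot>\<^bsub>L\<^esub> bassoc B \<one>\<^bsub>C\<^esub> y d = ide D d \<unrhd>\<^bsub>R\<^esub> munit M y) \<and>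
     (\<forall>c \<in> Obj C. \<forall>y \<in> Obj L.
        (ide C c \<unrhd>\<^bsub>M\<^esub> munit R y) \<cdot>\<^bsub>L\<^esub> bassoc B c y \<one>\<^bsub>D\<^esub> = munit R (c \<rhd>\<^bsub>M\<^esub> y)))"

text \<open>Units and counits of adjunctions between the actions of an object and of its duals:
  \<open>y \<rightarrow> \<^sup>\<or>c \<rhd> (c \<rhd> y)\<close>, \<open>c \<rhd> (\<^sup>\<or>c \<rhd> y) \<rightarrow> y\<close> and \<open>c\<^sup>\<or> \<rhd> (c \<rhd> y) \<rightarrow> y\<close>.\<close>

definition act_unit ::
  "('oc, 'mc, 'k::field) tencat \<Rightarrow> ('ol, 'ml, 'k, 'z) lincat_scheme
     \<Rightarrow> ('oc, 'mc, 'ol, 'ml) action \<Rightarrow> 'oc \<Rightarrow> 'ol \<Rightarrow> 'ml" where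
  "act_unit C L M c y =
     massoc M (ldual C c) c y \<cdot>\<^bsub>L\<^esub> (coevl C c \<unrhd>\<^bsub>M\<^esub> ide L y) \<cdot>\<^bsub>L\<^esub> minv L (munit M y)"

definition act_counit_left ::
  "('oc, 'mc, 'k::field) tencat \<Rightarrow> ('ol, 'ml, 'k, 'z) lincat_scheme
     \<Rightarrow> ('oc, 'mc, 'ol, 'ml) action \<Rightarrow> 'oc \<Rightarrow> 'ol \<Rightarrow> 'ml" where
  "act_counit_left C L M c y =
     munit M y \<cdot>\<^bsub>L\<^esub> (evl C c \<unrhd>\<^bsub>M\<^esub> ide L y) \<cdot>\<^bsub>L\<^esub> minv L (massoc M c (ldual C c) y)"

definition act_counit_right ::
  "('oc, 'mc, 'k::field) tencat \<Rightarrow> ('ol, 'ml, 'k, 'z) lincat_scheme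
     \<Rightarrow> ('oc, 'mc, 'ol, 'ml) action \<Rightarrow> 'oc \<Rightarrow> 'ol \<Rightarrow> 'ml" where
  "act_counit_right C L M c y =
     munit M y \<cdot>\<^bsub>L\<^esub> (evr C c \<unrhd>\<^bsub>M\<^esub> ide L y) \<cdot>\<^bsub>L\<^esub> minv L (massoc M (rdual C c) c y)"

section \<open>The distinguished object and spherical tensor categories\<close>

definition inverse_objects :: "('o, 'm, 'k::field) tencat \<Rightarrow> 'o \<Rightarrow> 'o \<Rightarrow> bool" where
  "inverse_objects C a b \<longleftrightarrow> a \<in> Obj C \<and> b \<in> Obj C \<and>
     isomorphic C (a \<otimes>\<^bsub>C\<^esub> b) \<one>\<^bsub>C\<^esub> \<and> isomorphic C (b \<otimes>\<^bsub>C\<^esub> a) \<one>\<^bsub>C\<^esub>"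

text \<open>The inverse \<open>\<D>\<^sup>-\<^sup>1 = N(1)\<close> of the distinguished object.\<close>

abbreviation dist_inv :: "('o, 'm, 'k::field) tencat \<Rightarrow> ('o, 'm, 'k) nakayama_data \<Rightarrow> 'o" where
  "dist_inv C N \<equiv> nob N \<one>\<^bsub>C\<^esub>"

definition unimodular :: "('o, 'm, 'k::field) tencat \<Rightarrow> ('o, 'm, 'k) nakayama_data \<Rightarrow> bool" where
  "unimodular C N \<longleftrightarrow> (\<exists>d. inverse_objects C d (dist_inv C N) \<and> isomorphic C d \<one>\<^bsub>C\<^esub>)"

text \<open>\<open>N(c) \<cong> N(c \<otimes> 1) \<rightarrow> \<^sup>\<or>\<^sup>\<or>c \<otimes> \<D>\<^sup>-\<^sup>1\<close>, from \<open>c \<otimes> - \<stileturn> \<^sup>\<or>c \<otimes> - \<stileturn> \<^sup>\<or>\<^sup>\<or>c \<otimes> -\<close>. For \<open>rev_tensor C\<close> this is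
  \<open>N(c) \<cong> N(1 \<otimes> c) \<rightarrow> \<D>\<^sup>-\<^sup>1 \<otimes> c\<^sup>\<or>\<^sup>\<or>\<close>.\<close>

definition nakayama_tensor ::
  "('o, 'm, 'k::field) tencat \<Rightarrow> ('o, 'm, 'k) nakayama_data \<Rightarrow> 'o \<Rightarrow> 'm" where
  "nakayama_tensor C N c =
     nakayama_comparison C C N N
       (ten C c) (tenm C (ide C c))
       (ten C (ldual C c)) (act_counit_left C C (regular_action C) c)
       (ten C (lddual C c)) (tenm C (ide C (lddual C c)))
       (act_unit C C (regular_action C) (ldual C c)) \<one>\<^bsub>C\<^esub>
     \<cdot>\<^bsub>C\<^esub> nmor C N c (c \<otimes>\<^bsub>C\<^esub> \<one>\<^bsub>C\<^esub>) (minv C (runit C c))"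

text \<open>The Radford isomorphism of a unimodular category, for a trivialization \<open>u : 1 \<rightarrow> \<D>\<^sup>-\<^sup>1\<close>:
  \<open>c \<cong> c \<otimes> \<D>\<^sup>-\<^sup>1 \<cong> \<^sup>\<or>\<^sup>\<or>(c\<^sup>\<or>\<^sup>\<or>) \<otimes> \<D>\<^sup>-\<^sup>1 \<cong> N(c\<^sup>\<or>\<^sup>\<or>) \<cong> \<D>\<^sup>-\<^sup>1 \<otimes> c\<^sup>\<or>\<^sup>\<or>\<^sup>\<or>\<^sup>\<or> \<cong> c\<^sup>\<or>\<^sup>\<or>\<^sup>\<or>\<^sup>\<or>\<close>.\<close>

definition radford_tensor ::
  "('o, 'm, 'k::field) tencat \<Rightarrow> ('o, 'm, 'k) nakayama_data \<Rightarrow> 'm \<Rightarrow> 'o \<Rightarrow> 'm" where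
  "radford_tensor C N u c = (let c2 = rddual C c; c4 = rddual C c2 in
     lunit C c4 \<cdot>\<^bsub>C\<^esub> (minv C u \<boxtimes>\<^bsub>C\<^esub> ide C c4) \<cdot>\<^bsub>C\<^esub> nakayama_tensor (rev_tensor C) N c2
       \<cdot>\<^bsub>C\<^esub> minv C (nakayama_tensor C N c2)
       \<cdot>\<^bsub>C\<^esub> (ddual_cancel (rev_tensor C) c \<boxtimes>\<^bsub>C\<^esub> u) \<cdot>\<^bsub>C\<^esub> minv C (runit C c))"

text \<open>As \<open>radford_tensor C N u c\<close> does not depend on \<open>u\<close>, the quantifier over \<open>u\<close> is immaterial.\<close>

definition spherical ::
  "('o, 'm, 'k::field) tencat \<Rightarrow> ('o, 'm, 'k) nakayama_data \<Rightarrow> ('o \<Rightarrow> 'm) \<Rightarrow> bool" where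
  "spherical C N p \<longleftrightarrow> unimodular C N \<and> pivotal C p \<and>
     (\<forall>u. is_iso C \<one>\<^bsub>C\<^esub> (dist_inv C N) u \<longrightarrow>
        (\<forall>c \<in> Obj C. rddualm C c (rddual C c) (p c) \<cdot>\<^bsub>C\<^esub> p c = radford_tensor C N u c))"

section \<open>Internal Homs and relative Serre functors\<close>

text \<open>The internal Hom of a left module category with its universal evaluations
  \<open>ihev y z : ihom y z \<rhd> y \<rightarrow> z\<close>.\<close>

record ('oc, 'ol, 'ml) inthom =
  ihom :: "'ol \<Rightarrow> 'ol \<Rightarrow> 'oc"
  ihev :: "'ol \<Rightarrow> 'ol \<Rightarrow> 'ml"

definition internal_hom ::
  "('oc, 'mc, 'k::field) tencat \<Rightarrow> ('ol, 'ml, 'k) lincat \<Rightarrow> ('oc, 'mc, 'ol, 'ml) action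
     \<Rightarrow> ('oc, 'ol, 'ml, 'z) inthom_scheme \<Rightarrow> bool" where
  "internal_hom C L M I \<longleftrightarrow> (\<forall>y \<in> Obj L. \<forall>z \<in> Obj L.
     ihom I y z \<in> Obj C \<and> ihev I y z \<in> Hom L (ihom I y z \<rhd>\<^bsub>M\<^esub> y) z \<and>
     (\<forall>c \<in> Obj C. \<forall>f \<in> Hom L (c \<rhd>\<^bsub>M\<^esub> y) z.
        \<exists>!g. g \<in> Hom C c (ihom I y z) \<and> ihev I y z \<cdot>\<^bsub>L\<^esub> (g \<unrhd>\<^bsub>M\<^esub> ide L y) = f))"

text \<open>The morphism \<open>c \<rightarrow> ihom y z\<close> corresponding to \<open>f : c \<rhd> y \<rightarrow> z\<close>\<close>

definition imate ::
  "('oc, 'mc, 'k::field) tencat \<Rightarrow> ('ol, 'ml, 'k) lincat \<Rightarrow> ('oc, 'mc, 'ol, 'ml) action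
     \<Rightarrow> ('oc, 'ol, 'ml, 'z) inthom_scheme \<Rightarrow> 'oc \<Rightarrow> 'ol \<Rightarrow> 'ol \<Rightarrow> 'ml \<Rightarrow> 'mc" where
  "imate C L M I c y z f =
     (THE g. g \<in> Hom C c (ihom I y z) \<and> ihev I y z \<cdot>\<^bsub>L\<^esub> (g \<unrhd>\<^bsub>M\<^esub> ide L y) = f)"

text \<open>Functoriality: \<open>ihom y z \<rightarrow> ihom y z'\<close> for \<open>h : z \<rightarrow> z'\<close>, and \<open>ihom y' z \<rightarrow> ihom y z\<close> for
  \<open>g : y \<rightarrow> y'\<close>.\<close>

definition ihom_post ::
  "('oc, 'mc, 'k::field) tencat \<Rightarrow> ('ol, 'ml, 'k) lincat \<Rightarrow> ('oc, 'mc, 'ol, 'ml) action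
     \<Rightarrow> ('oc, 'ol, 'ml, 'z) inthom_scheme \<Rightarrow> 'ol \<Rightarrow> 'ol \<Rightarrow> 'ol \<Rightarrow> 'ml \<Rightarrow> 'mc" where
  "ihom_post C L M I y z z' h = imate C L M I (ihom I y z) y z' (h \<cdot>\<^bsub>L\<^esub> ihev I y z)"

definition ihom_pre ::
  "('oc, 'mc, 'k::field) tencat \<Rightarrow> ('ol, 'ml, 'k) lincat \<Rightarrow> ('oc, 'mc, 'ol, 'ml) action
     \<Rightarrow> ('oc, 'ol, 'ml, 'z) inthom_scheme \<Rightarrow> 'ol \<Rightarrow> 'ol \<Rightarrow> 'ol \<Rightarrow> 'ml \<Rightarrow> 'mc" where
  "ihom_pre C L M I y y' z g = imate C L M I (ihom I y' z) y z
     (ihev I y' z \<cdot>\<^bsub>L\<^esub> (ide C (ihom I y' z) \<unrhd>\<^bsub>M\<^esub> g))"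

text \<open>The relative Serre functor \<open>S = (sob, smor)\<close> with natural isomorphisms
  \<open>siso y z : (ihom y z)\<^sup>\<or> \<rightarrow> ihom z (S y)\<close>.\<close>

record ('oc, 'mc, 'ol, 'ml) serre_data = "('oc, 'ol, 'ml) inthom" +
  sob :: "'ol \<Rightarrow> 'ol"
  smor :: "'ml \<Rightarrow> 'ml"
  siso :: "'ol \<Rightarrow> 'ol \<Rightarrow> 'mc"

definition relative_serre ::
  "('oc, 'mc, 'k::field) tencat \<Rightarrow> ('ol, 'ml, 'k) lincat \<Rightarrow> ('oc, 'mc, 'ol, 'ml) action
     \<Rightarrow> ('oc, 'mc, 'ol, 'ml) serre_data \<Rightarrow> bool" where
  "relative_serre C L M S \<longleftrightarrow> internal_hom C L M S \<and> linear_functor L L (sob S) (smor S) \<and>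
     (\<forall>y \<in> Obj L. \<forall>z \<in> Obj L.
        is_iso C (rdual C (ihom S y z)) (ihom S z (sob S y)) (siso S y z)) \<and>
     (\<forall>y y'. \<forall>z \<in> Obj L. \<forall>g \<in> Hom L y y'.
        siso S y' z \<cdot>\<^bsub>C\<^esub> rdualm C (ihom S y' z) (ihom S y z) (ihom_pre C L M S y y' z g) =
        ihom_post C L M S z (sob S y) (sob S y') (smor S g) \<cdot>\<^bsub>C\<^esub> siso S y z) \<and>
     (\<forall>y \<in> Obj L. \<forall>z z'. \<forall>h \<in> Hom L z z'.
        siso S y z \<cdot>\<^bsub>C\<^esub> rdualm C (ihom S y z) (ihom S y z') (ihom_post C L M S y z z' h) =
        ihom_pre C L M S z z' (sob S y) h \<cdot>\<^bsub>C\<^esub> siso S y z')"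

text \<open>Canonical isomorphisms of internal Homs: \<open>ihom(y,z) \<otimes> c\<^sup>\<or> \<rightarrow> ihom(c \<rhd> y, z)\<close> and
  \<open>c \<otimes> ihom(z,w) \<rightarrow> ihom(z, c \<rhd> w)\<close>.\<close>

definition ihom_act_left ::
  "('oc, 'mc, 'k::field) tencat \<Rightarrow> ('ol, 'ml, 'k) lincat \<Rightarrow> ('oc, 'mc, 'ol, 'ml) action
     \<Rightarrow> ('oc, 'ol, 'ml, 'z) inthom_scheme \<Rightarrow> 'oc \<Rightarrow> 'ol \<Rightarrow> 'ol \<Rightarrow> 'mc" where
  "ihom_act_left C L M I c y z = (let x = ihom I y z in
     imate C L M I (x \<otimes>\<^bsub>C\<^esub> rdual C c) (c \<rhd>\<^bsub>M\<^esub> y) z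
       (ihev I y z \<cdot>\<^bsub>L\<^esub> (ide C x \<unrhd>\<^bsub>M\<^esub> act_counit_right C L M c y) \<cdot>\<^bsub>L\<^esub> massoc M x (rdual C c) (c \<rhd>\<^bsub>M\<^esub> y)))"

definition ihom_act_right ::
  "('oc, 'mc, 'k::field) tencat \<Rightarrow> ('ol, 'ml, 'k) lincat \<Rightarrow> ('oc, 'mc, 'ol, 'ml) action
     \<Rightarrow> ('oc, 'ol, 'ml, 'z) inthom_scheme \<Rightarrow> 'oc \<Rightarrow> 'ol \<Rightarrow> 'ol \<Rightarrow> 'mc" where
  "ihom_act_right C L M I c z w = (let x = ihom I z w in
     imate C L M I (c \<otimes>\<^bsub>C\<^esub> x) z (c \<rhd>\<^bsub>M\<^esub> w)
       ((ide C c \<unrhd>\<^bsub>M\<^esub> ihev I z w) \<cdot>\<^bsub>L\<^esub> massoc M c x z))"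

text \<open>Now let \<open>E\<close> act from the left on \<open>L\<close> by \<open>M'\<close>, commuting with the action \<open>M\<close> of \<open>C\<close> via
  \<open>K x b w : x \<rhd>\<^bsub>M\<^esub> (b \<rhd>\<^bsub>M'\<^esub> w) \<rightarrow> b \<rhd>\<^bsub>M'\<^esub> (x \<rhd>\<^bsub>M\<^esub> w)\<close>. The adjunction \<open>b \<rhd>\<^bsub>M'\<^esub> - \<stileturn> \<^sup>\<or>b \<rhd>\<^bsub>M'\<^esub> -\<close> gives
  \<open>ihom(b \<rhd>\<^bsub>M'\<^esub> y, z) \<rightarrow> ihom(y, \<^sup>\<or>b \<rhd>\<^bsub>M'\<^esub> z)\<close>.\<close>

definition ihom_shift ::
  "('oc, 'mc, 'k::field) tencat \<Rightarrow> ('oe, 'me, 'k) tencat \<Rightarrow> ('ol, 'ml, 'k) lincat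
     \<Rightarrow> ('oc, 'mc, 'ol, 'ml) action \<Rightarrow> ('oe, 'me, 'ol, 'ml) action
     \<Rightarrow> ('oc \<Rightarrow> 'oe \<Rightarrow> 'ol \<Rightarrow> 'ml) \<Rightarrow> ('oc, 'ol, 'ml, 'z) inthom_scheme
     \<Rightarrow> 'oe \<Rightarrow> 'ol \<Rightarrow> 'ol \<Rightarrow> 'mc" where
  "ihom_shift C E L M M' K I b y z = (let w = b \<rhd>\<^bsub>M'\<^esub> y; x = ihom I w z; b' = ldual E b in
     imate C L M I x y (b' \<rhd>\<^bsub>M'\<^esub> z)
       ((ide E b' \<unrhd>\<^bsub>M'\<^esub> ihev I w z) \<cdot>\<^bsub>L\<^esub> K x b' w \<cdot>\<^bsub>L\<^esub> (ide C x \<unrhd>\<^bsub>M\<^esub> act_unit E L M' b y)))"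

text \<open>The canonical isomorphism \<open>S(c \<rhd> y) \<rightarrow> c\<^sup>\<or>\<^sup>\<or> \<rhd> S(y)\<close> is obtained by the Yoneda lemma from
  \<open>ihom(z, S(c \<rhd> y)) \<cong> ihom(c \<rhd> y, z)\<^sup>\<or> \<cong> (ihom(y,z) \<otimes> c\<^sup>\<or>)\<^sup>\<or> \<cong> c\<^sup>\<or>\<^sup>\<or> \<otimes> ihom(y,z)\<^sup>\<or> \<cong> c\<^sup>\<or>\<^sup>\<or> \<otimes> ihom(z, S y)
  \<cong> ihom(z, c\<^sup>\<or>\<^sup>\<or> \<rhd> S y)\<close>. Since \<open>Hom(z,w) \<cong> Hom(1, ihom(z,w))\<close>, the Yoneda lemma refers to
  morphisms \<open>a\<close> out of the unit object.\<close>

definition serre_twist ::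
  "('oc, 'mc, 'k::field) tencat \<Rightarrow> ('ol, 'ml, 'k) lincat \<Rightarrow> ('oc, 'mc, 'ol, 'ml) action
     \<Rightarrow> ('oc, 'mc, 'ol, 'ml) serre_data \<Rightarrow> 'oc \<Rightarrow> 'ol \<Rightarrow> 'ml" where
  "serre_twist C L M S c y = (let c1 = rdual C c; c2 = rdual C c1 in
     THE m. m \<in> Hom L (sob S (c \<rhd>\<^bsub>M\<^esub> y)) (c2 \<rhd>\<^bsub>M\<^esub> sob S y) \<and>
       (\<forall>z \<in> Obj L. \<forall>a \<in> Hom C \<one>\<^bsub>C\<^esub> (rdual C (ihom S (c \<rhd>\<^bsub>M\<^esub> y) z)).
          ihom_post C L M S z (sob S (c \<rhd>\<^bsub>M\<^esub> y)) (c2 \<rhd>\<^bsub>M\<^esub> sob S y) m \<cdot>\<^bsub>C\<^esub> siso S (c \<rhd>\<^bsub>M\<^esub> y) z \<cdot>\<^bsub>C\<^esub> a =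
          ihom_act_right C L M S c2 z (sob S y)
            \<cdot>\<^bsub>C\<^esub> (ide C c2 \<boxtimes>\<^bsub>C\<^esub> siso S y z)
            \<cdot>\<^bsub>C\<^esub> minv C (dual_ten C (ihom S y z) c1)
            \<cdot>\<^bsub>C\<^esub> rdualm C (ihom S y z \<otimes>\<^bsub>C\<^esub> c1) (ihom S (c \<rhd>\<^bsub>M\<^esub> y) z) (ihom_act_left C L M S c y z)
            \<cdot>\<^bsub>C\<^esub> a))"

text \<open>Likewise \<open>S(b \<rhd>\<^bsub>M'\<^esub> y) \<rightarrow> \<^sup>\<or>\<^sup>\<or>b \<rhd>\<^bsub>M'\<^esub> S(y)\<close>, from
  \<open>ihom(z, S(b \<rhd>\<^bsub>M'\<^esub> y)) \<cong> ihom(b \<rhd>\<^bsub>M'\<^esub> y, z)\<^sup>\<or> \<cong> ihom(y, \<^sup>\<or>b \<rhd>\<^bsub>M'\<^esub> z)\<^sup>\<or> \<cong> ihom(\<^sup>\<or>b \<rhd>\<^bsub>M'\<^esub> z, S y)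
  \<cong> ihom(z, \<^sup>\<or>\<^sup>\<or>b \<rhd>\<^bsub>M'\<^esub> S y)\<close>. With \<open>E = rev_tensor D\<close> this is \<open>S(y \<lhd> d) \<rightarrow> S(y) \<lhd> d\<^sup>\<or>\<^sup>\<or>\<close>.\<close>

definition serre_twist_other ::
  "('oc, 'mc, 'k::field) tencat \<Rightarrow> ('oe, 'me, 'k) tencat \<Rightarrow> ('ol, 'ml, 'k) lincat
     \<Rightarrow> ('oc, 'mc, 'ol, 'ml) action \<Rightarrow> ('oe, 'me, 'ol, 'ml) action
     \<Rightarrow> ('oc \<Rightarrow> 'oe \<Rightarrow> 'ol \<Rightarrow> 'ml) \<Rightarrow> ('oc, 'mc, 'ol, 'ml) serre_data \<Rightarrow> 'oe \<Rightarrow> 'ol \<Rightarrow> 'ml" where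
  "serre_twist_other C E L M M' K S b y = (let b1 = ldual E b; b2 = ldual E b1 in
     THE m. m \<in> Hom L (sob S (b \<rhd>\<^bsub>M'\<^esub> y)) (b2 \<rhd>\<^bsub>M'\<^esub> sob S y) \<and>
       (\<forall>z \<in> Obj L. \<forall>a \<in> Hom C \<one>\<^bsub>C\<^esub> (rdual C (ihom S y (b1 \<rhd>\<^bsub>M'\<^esub> z))).
          ihom_post C L M S z (sob S (b \<rhd>\<^bsub>M'\<^esub> y)) (b2 \<rhd>\<^bsub>M'\<^esub> sob S y) m
            \<cdot>\<^bsub>C\<^esub> siso S (b \<rhd>\<^bsub>M'\<^esub> y) z
            \<cdot>\<^bsub>C\<^esub> rdualm C (ihom S (b \<rhd>\<^bsub>M'\<^esub> y) z) (ihom S y (b1 \<rhd>\<^bsub>M'\<^esub> z)) (ihom_shift C E L M M' K S b y z)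
            \<cdot>\<^bsub>C\<^esub> a =
          ihom_shift C E L M M' K S b1 z (sob S y) \<cdot>\<^bsub>C\<^esub> siso S y (b1 \<rhd>\<^bsub>M'\<^esub> z) \<cdot>\<^bsub>C\<^esub> a))"

section \<open>The Radford isomorphism of a bimodule category\<close>

text \<open>\<open>N\<^sub>L(y) \<cong> N\<^sub>L(1 \<rhd> y) \<rightarrow> \<D>\<^sup>-\<^sup>1 \<rhd> S(y)\<close>, from the adjunctions
  \<open>(- \<rhd> y) \<stileturn> ihom(y,-) \<stileturn> (- \<rhd> S y)\<close>. The second one is the composite
  \<open>Hom(ihom(y,z), c) \<cong> Hom(1, c \<otimes> ihom(y,z)\<^sup>\<or>) \<cong> Hom(1, c \<otimes> ihom(z, S y)) \<cong> Hom(z, c \<rhd> S y)\<close>; its unit is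
  \<open>serre_unit\<close>.\<close>

definition serre_unit ::
  "('oc, 'mc, 'k::field) tencat \<Rightarrow> ('ol, 'ml, 'k) lincat \<Rightarrow> ('oc, 'mc, 'ol, 'ml) action
     \<Rightarrow> ('oc, 'mc, 'ol, 'ml) serre_data \<Rightarrow> 'ol \<Rightarrow> 'ol \<Rightarrow> 'ml" where
  "serre_unit C L M S y z = (let x = ihom S y z in
     (ide C x \<unrhd>\<^bsub>M\<^esub> ihev S z (sob S y)) \<cdot>\<^bsub>L\<^esub> massoc M x (ihom S z (sob S y)) z
       \<cdot>\<^bsub>L\<^esub> (((ide C x \<boxtimes>\<^bsub>C\<^esub> siso S y z) \<cdot>\<^bsub>C\<^esub> coevr C x) \<unrhd>\<^bsub>M\<^esub> ide L z) \<cdot>\<^bsub>L\<^esub> minv L (munit M z))"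

definition nakayama_serre ::
  "('oc, 'mc, 'k::field) tencat \<Rightarrow> ('ol, 'ml, 'k) lincat \<Rightarrow> ('oc, 'mc, 'ol, 'ml) action
     \<Rightarrow> ('oc, 'mc, 'k) nakayama_data \<Rightarrow> ('ol, 'ml, 'k) nakayama_data
     \<Rightarrow> ('oc, 'mc, 'ol, 'ml) serre_data \<Rightarrow> 'ol \<Rightarrow> 'ml" where
  "nakayama_serre C L M NC NL S y =
     nakayama_comparison C L NC NL
       (\<lambda>c. c \<rhd>\<^bsub>M\<^esub> y) (\<lambda>f. f \<unrhd>\<^bsub>M\<^esub> ide L y)
       (ihom S y) (ihev S y)
       (\<lambda>c. c \<rhd>\<^bsub>M\<^esub> sob S y) (\<lambda>f. f \<unrhd>\<^bsub>M\<^esub> ide L (sob S y))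
       (serre_unit C L M S y) \<one>\<^bsub>C\<^esub>
     \<cdot>\<^bsub>L\<^esub> nmor L NL y (\<one>\<^bsub>C\<^esub> \<rhd>\<^bsub>M\<^esub> y) (minv L (munit M y))"

text \<open>The canonical isomorphism \<open>\<D>\<^sup>-\<^sup>1 \<rhd> S(y) \<cong> N\<^sub>L(y)\<close>\<close>

definition serre_nakayama ::
  "('oc, 'mc, 'k::field) tencat \<Rightarrow> ('ol, 'ml, 'k) lincat \<Rightarrow> ('oc, 'mc, 'ol, 'ml) action
     \<Rightarrow> ('oc, 'mc, 'k) nakayama_data \<Rightarrow> ('ol, 'ml, 'k) nakayama_data
     \<Rightarrow> ('oc, 'mc, 'ol, 'ml) serre_data \<Rightarrow> 'ol \<Rightarrow> 'ml" where
  "serre_nakayama C L M NC NL S y = minv L (nakayama_serre C L M NC NL S y)"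

text \<open>A bimodule category with the choices of Nakayama functors and relative Serre functors that
  the constructions below refer to. The functor \<open>\<S>\<^bsup>D\<^esup>\<close> is the relative Serre functor of the left
  \<open>rev_tensor D\<close>-module category.\<close>

record ('oc, 'mc, 'od, 'md, 'ol, 'ml, 'k) serre_bimod =
  "('oc, 'mc, 'od, 'md, 'ol, 'ml, 'k) bimod" +
  nakC :: "('oc, 'mc, 'k) nakayama_data"
  nakD :: "('od, 'md, 'k) nakayama_data"
  nakL :: "('ol, 'ml, 'k) nakayama_data"
  serC :: "('oc, 'mc, 'ol, 'ml) serre_data"
  serD :: "('od, 'md, 'ol, 'ml) serre_data"

definition bimodule_with_serre ::
  "('oc, 'mc, 'k::field) tencat \<Rightarrow> ('od, 'md, 'k) tencat
     \<Rightarrow> ('oc, 'mc, 'od, 'md, 'ol, 'ml, 'k) serre_bimod \<Rightarrow> bool" where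
  "bimodule_with_serre C D B \<longleftrightarrow>
     exact_bimodule_category C D (bimod.truncate B) \<and>
     nakayama C (nakC B) \<and> nakayama D (nakD B) \<and> nakayama (cat B) (nakL B) \<and>
     relative_serre C (cat B) (lact B) (serC B) \<and>
     relative_serre (rev_tensor D) (cat B) (ract B) (serD B)"

abbreviation left_serre_nakayama ::
  "('oc, 'mc, 'k::field) tencat \<Rightarrow> ('oc, 'mc, 'od, 'md, 'ol, 'ml, 'k) serre_bimod \<Rightarrow> 'ol \<Rightarrow> 'ml" where
  "left_serre_nakayama C B \<equiv> serre_nakayama C (cat B) (lact B) (nakC B) (nakL B) (serC B)"

abbreviation right_serre_nakayama ::
  "('od, 'md, 'k::field) tencat \<Rightarrow> ('oc, 'mc, 'od, 'md, 'ol, 'ml, 'k) serre_bimod \<Rightarrow> 'ol \<Rightarrow> 'ml" where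
  "right_serre_nakayama D B \<equiv>
     serre_nakayama (rev_tensor D) (cat B) (ract B) (nakD B) (nakL B) (serD B)"

definition radford ::
  "('oc, 'mc, 'k::field) tencat \<Rightarrow> ('od, 'md, 'k) tencat
     \<Rightarrow> ('oc, 'mc, 'od, 'md, 'ol, 'ml, 'k) serre_bimod \<Rightarrow> 'ol \<Rightarrow> 'ml" where
  "radford C D B y =
     minv (cat B) (right_serre_nakayama D B y) \<cdot>\<^bsub>cat B\<^esub> left_serre_nakayama C B y"

definition radford_untwisted ::
  "('oc, 'mc, 'k::field) tencat \<Rightarrow> ('od, 'md, 'k) tencat
     \<Rightarrow> ('oc, 'mc, 'od, 'md, 'ol, 'ml, 'k) serre_bimod \<Rightarrow> 'mc \<Rightarrow> 'md \<Rightarrow> 'ol \<Rightarrow> 'ml" where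
  "radford_untwisted C D B uC uD y =
     (let L = cat B; M = lact B; R = ract B; s = sob (serC B) y; t = sob (serD B) y in
        munit R t \<cdot>\<^bsub>L\<^esub> (minv D uD \<unrhd>\<^bsub>R\<^esub> ide L t) \<cdot>\<^bsub>L\<^esub> radford C D B y
          \<cdot>\<^bsub>L\<^esub> (uC \<unrhd>\<^bsub>M\<^esub> ide L s) \<cdot>\<^bsub>L\<^esub> minv L (munit M s))"

section \<open>Pivotal and spherical bimodule categories\<close>

text \<open>\<open>t\<close> is a bimodule natural isomorphism \<open>id \<Rightarrow> S\<close>, where the relative Serre functor \<open>S\<close> of the
  \<open>C\<close>-action \<open>M\<close> is a bimodule functor via \<open>pC : c \<rightarrow> c\<^sup>\<or>\<^sup>\<or>\<close> and \<open>pE : b \<rightarrow> \<^sup>\<or>\<^sup>\<or>b\<close>, i.e. via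
  \<open>S(c \<rhd> y) \<cong> c\<^sup>\<or>\<^sup>\<or> \<rhd> S(y) \<cong> c \<rhd> S(y)\<close> and likewise for \<open>E\<close>.\<close>

definition serre_trivialization ::
  "('oc, 'mc, 'k::field) tencat \<Rightarrow> ('oe, 'me, 'k) tencat \<Rightarrow> ('ol, 'ml, 'k) lincat
     \<Rightarrow> ('oc, 'mc, 'ol, 'ml) action \<Rightarrow> ('oe, 'me, 'ol, 'ml) action
     \<Rightarrow> ('oc \<Rightarrow> 'oe \<Rightarrow> 'ol \<Rightarrow> 'ml) \<Rightarrow> ('oc, 'mc, 'ol, 'ml) serre_data
     \<Rightarrow> ('oc \<Rightarrow> 'mc) \<Rightarrow> ('oe \<Rightarrow> 'me) \<Rightarrow> ('ol \<Rightarrow> 'ml) \<Rightarrow> bool" where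
  "serre_trivialization C E L M M' K S pC pE t \<longleftrightarrow>
     (\<forall>y \<in> Obj L. is_iso L y (sob S y) (t y)) \<and>
     (\<forall>y y'. \<forall>f \<in> Hom L y y'. t y' \<cdot>\<^bsub>L\<^esub> f = smor S f \<cdot>\<^bsub>L\<^esub> t y) \<and>
     (\<forall>c \<in> Obj C. \<forall>y \<in> Obj L.
        (minv C (pC c) \<unrhd>\<^bsub>M\<^esub> ide L (sob S y)) \<cdot>\<^bsub>L\<^esub> serre_twist C L M S c y \<cdot>\<^bsub>L\<^esub> t (c \<rhd>\<^bsub>M\<^esub> y) =
        ide C c \<unrhd>\<^bsub>M\<^esub> t y) \<and>
     (\<forall>b \<in> Obj E. \<forall>y \<in> Obj L.
        (minv E (pE b) \<unrhd>\<^bsub>M'\<^esub> ide L (sob S y)) \<cdot>\<^bsub>L\<^esub> serre_twist_other C E L M M' K S b y \<cdot>\<^bsub>L\<^esub> t (b \<rhd>\<^bsub>M'\<^esub> y) =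
        ide E b \<unrhd>\<^bsub>M'\<^esub> t y)"

text \<open>The double left dual of \<open>rev_tensor D\<close> is the double right dual of \<open>D\<close>, so \<open>pD\<close> is of the
  required form for \<open>pt\<close>. For \<open>qt\<close> the roles are exchanged: \<open>\<S>\<^bsup>D\<^esup>(c \<rhd> y \<lhd> d) \<cong> \<^sup>\<or>\<^sup>\<or>c \<rhd> \<S>\<^bsup>D\<^esup>(y) \<lhd> \<^sup>\<or>\<^sup>\<or>d\<close>.\<close>

definition pivotal_bimodule ::
  "('oc, 'mc, 'k::field) tencat \<Rightarrow> ('od, 'md, 'k) tencat \<Rightarrow> ('oc \<Rightarrow> 'mc) \<Rightarrow> ('od \<Rightarrow> 'md)
     \<Rightarrow> ('oc, 'mc, 'od, 'md, 'ol, 'ml, 'k) serre_bimod \<Rightarrow> ('ol \<Rightarrow> 'ml) \<Rightarrow> ('ol \<Rightarrow> 'ml) \<Rightarrow> bool" where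
  "pivotal_bimodule C D pC pD B pt qt \<longleftrightarrow> bimodule_with_serre C D B \<and>
     serre_trivialization C (rev_tensor D) (cat B) (lact B) (ract B)
       (\<lambda>c d y. minv (cat B) (bassoc B c y d)) (serC B) pC pD pt \<and>
     serre_trivialization (rev_tensor D) C (cat B) (ract B) (lact B)
       (\<lambda>d c y. bassoc B c y d) (serD B) (left_pivotal D pD) (left_pivotal C pC) qt"

definition spherical_bimodule ::
  "('oc, 'mc, 'k::field) tencat \<Rightarrow> ('od, 'md, 'k) tencat \<Rightarrow> ('oc \<Rightarrow> 'mc) \<Rightarrow> ('od \<Rightarrow> 'md)
     \<Rightarrow> ('oc, 'mc, 'od, 'md, 'ol, 'ml, 'k) serre_bimod \<Rightarrow> ('ol \<Rightarrow> 'ml) \<Rightarrow> ('ol \<Rightarrow> 'ml)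
     \<Rightarrow> 'mc \<Rightarrow> 'md \<Rightarrow> bool" where
  "spherical_bimodule C D pC pD B pt qt uC uD \<longleftrightarrow> pivotal_bimodule C D pC pD B pt qt \<and>
     (\<forall>y \<in> Obj (cat B). radford_untwisted C D B uC uD y \<cdot>\<^bsub>cat B\<^esub> pt y = qt y)"

definition left_trace ::
  "('oc, 'mc, 'k::field) tencat \<Rightarrow> ('oc, 'mc, 'od, 'md, 'ol, 'ml, 'k) serre_bimod
     \<Rightarrow> 'mc \<Rightarrow> ('ol \<Rightarrow> 'ml) \<Rightarrow> 'ol \<Rightarrow> 'ml \<Rightarrow> 'k" where
  "left_trace C B uC pt p f = (let L = cat B; M = lact B in
     twisted_trace L (nakL B) p
       (left_serre_nakayama C B p \<cdot>\<^bsub>L\<^esub> (uC \<unrhd>\<^bsub>M\<^esub> pt p) \<cdot>\<^bsub>L\<^esub> minv L (munit M p) \<cdot>\<^bsub>L\<^esub> f))"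

definition right_trace ::
  "('od, 'md, 'k::field) tencat \<Rightarrow> ('oc, 'mc, 'od, 'md, 'ol, 'ml, 'k) serre_bimod
     \<Rightarrow> 'md \<Rightarrow> ('ol \<Rightarrow> 'ml) \<Rightarrow> 'ol \<Rightarrow> 'ml \<Rightarrow> 'k" where
  "right_trace D B uD qt p f = (let L = cat B; R = ract B in
     twisted_trace L (nakL B) p
       (right_serre_nakayama D B p \<cdot>\<^bsub>L\<^esub> (uD \<unrhd>\<^bsub>R\<^esub> qt p) \<cdot>\<^bsub>L\<^esub> minv L (munit R p) \<cdot>\<^bsub>L\<^esub> f))"

definition trace_spherical_bimodule ::
  "('oc, 'mc, 'k::field) tencat \<Rightarrow> ('od, 'md, 'k) tencat \<Rightarrow> ('oc \<Rightarrow> 'mc) \<Rightarrow> ('od \<Rightarrow> 'md)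
     \<Rightarrow> ('oc, 'mc, 'od, 'md, 'ol, 'ml, 'k) serre_bimod \<Rightarrow> ('ol \<Rightarrow> 'ml) \<Rightarrow> ('ol \<Rightarrow> 'ml)
     \<Rightarrow> 'mc \<Rightarrow> 'md \<Rightarrow> bool" where
  "trace_spherical_bimodule C D pC pD B pt qt uC uD \<longleftrightarrow> pivotal_bimodule C D pC pD B pt qt \<and>
     (\<forall>p. projective (cat B) p \<longrightarrow> (\<forall>f \<in> Hom (cat B) p p.
        left_trace C B uC pt p f = right_trace D B uD qt p f))"

end

theory Submission
  imports Defs
begin

text \<open>By naturality of the unit constraints, the arguments of the twisted trace in the two traces differ
  by the Radford isomorphism, so that sphericality identifies them. This uses that the canonical
  morphism \<open>N\<^sub>L(y) \<rightarrow> \<D>\<^sup>-\<^sup>1 \<rhd> S(y)\<close> is invertible: the Radford isomorphism inverts it, and a morphism without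
  inverse would turn \<open>minv\<close> into a junk value. Invertibility comes from the adjunctions
  \<open>- \<rhd> y \<stileturn> ihom(y,-) \<stileturn> - \<rhd> S(y) \<stileturn> ihom(S(y),-)\<close>: the coend \<open>N\<^sub>L(1 \<rhd> y)\<close> of \<open>Hom(1, ihom(y,z))\<^sup>* \<otimes> z\<close> over \<open>z\<close>
  is the coend of \<open>Hom(1,c)\<^sup>* \<otimes> (c \<rhd> S(y))\<close> over \<open>c\<close>, and the left adjoint \<open>- \<rhd> S(y)\<close> preserves the coend
  \<open>N\<^sub>C(1)\<close>.\<close>

section \<open>Arrows and bifunctors\<close>

text \<open>The relative Serre functor is given by natural isomorphisms \<open>siso\<close> of
  internal Homs, not by an adjunction, so \<open>ihom(y,-) \<stileturn> - \<rhd> S(y)\<close> has to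
  be extracted from them. A morphism out of \<open>ihom(y,z)\<close> is traded for one from the unit
  object into \<open>c \<otimes> ihom(y,z)^v\<close>, moved across \<open>siso\<close>, and turned
  back with the dual of \<open>c\<close>. Naturality of the resulting unit is the delicate point:
  dual morphisms are defined through evaluations, while the unit is built from coevaluations. The
  passage between the two rests on the zigzag identities and, as all constraints are explicit, on
  the unit coherences that Kelly derived from pentagon and triangle. The right action is a left
  action of \<open>rev_tensor D\<close>. Everything about a single Serre functor is therefore proved
  from assumptions that can be verified for both \<open>C\<close> and \<open>rev_tensor D\<close>:
  linear structure, coherence, right duals. Nakayama functors on morphisms and comparison morphisms
  are definite descriptions, so each of them requires a wedge before anything is known about
  it.\<close>

definition arrow :: "('o, 'm, 'k::field, 'z) lincat_scheme \<Rightarrow> 'm \<Rightarrow> bool" where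
  "arrow C f \<longleftrightarrow> (\<exists>a b. f \<in> Hom C a b)"

definition src :: "('o, 'm, 'k::field, 'z) lincat_scheme \<Rightarrow> 'm \<Rightarrow> 'o" where
  "src C f = (THE a. \<exists>b. f \<in> Hom C a b)"

definition tgt :: "('o, 'm, 'k::field, 'z) lincat_scheme \<Rightarrow> 'm \<Rightarrow> 'o" where
  "tgt C f = (THE b. \<exists>a. f \<in> Hom C a b)"

definition invertible :: "('o, 'm, 'k::field, 'z) lincat_scheme \<Rightarrow> 'm \<Rightarrow> bool" where
  "invertible C f \<longleftrightarrow> (\<exists>a b. is_iso C a b f)"

section \<open>Typing, composition and inverses of morphisms\<close>

context linear_category
begin

lemma homD:
  assumes "f \<in> Hom C a b"
  shows "arrow C f" "src C f = a" "tgt C f = b"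
proof -
  show "arrow C f" using assms by (auto simp: arrow_def)
  show "src C f = a" unfolding src_def using assms hom_disjoint by blast
  show "tgt C f = b" unfolding tgt_def using assms hom_disjoint by blast
qed

text \<open>Distinct hom-sets are disjoint, so a morphism determines its source and target. Typing
  splits into \<open>arrow\<close> and two equations that simplification can solve, with no middle
  object of a composite left to guess.\<close>

lemma hom_iff: "f \<in> Hom C a b \<longleftrightarrow> arrow C f \<and> src C f = a \<and> tgt C f = b"
  using homD arrow_def by metis

lemma arrow_hom: "arrow C f \<Longrightarrow> f \<in> Hom C (src C f) (tgt C f)"
  by (simp add: hom_iff)

lemma src_obj [simp]: "arrow C f \<Longrightarrow> src C f \<in> Obj C"
  and tgt_obj [simp]: "arrow C f \<Longrightarrow> tgt C f \<in> Obj C"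
  using arrow_hom hom_obj by blast+

lemma arrow_ide [simp]: "a \<in> Obj C \<Longrightarrow> arrow C (ide C a)"
  and src_ide [simp]: "a \<in> Obj C \<Longrightarrow> src C (ide C a) = a"
  and tgt_ide [simp]: "a \<in> Obj C \<Longrightarrow> tgt C (ide C a) = a"
  using ide_hom homD by blast+

lemma
  assumes "arrow C f" "arrow C g" "tgt C f = src C g"
  shows arrow_comp [simp]: "arrow C (g \<cdot> f)"
    and src_comp [simp]: "src C (g \<cdot> f) = src C f"
    and tgt_comp [simp]: "tgt C (g \<cdot> f) = tgt C g"
proof -
  have "g \<cdot> f \<in> Hom C (src C f) (tgt C g)"
    using assms comp_hom arrow_hom by metis
  then show "arrow C (g \<cdot> f)" "src C (g \<cdot> f) = src C f" "tgt C (g \<cdot> f) = tgt C g"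
    by (auto dest: homD)
qed

lemma comp_assoc_arrow [simp]:
  assumes "arrow C f" "arrow C g" "arrow C h" "tgt C f = src C g" "tgt C g = src C h"
  shows "(h \<cdot> g) \<cdot> f = h \<cdot> (g \<cdot> f)"
  using comp_assoc assms arrow_hom by metis

lemma comp_ide_arrow [simp]: "arrow C f \<Longrightarrow> src C f = a \<Longrightarrow> f \<cdot> ide C a = f"
  using comp_ide arrow_hom by blast

lemma ide_comp_arrow [simp]: "arrow C f \<Longrightarrow> tgt C f = a \<Longrightarrow> ide C a \<cdot> f = f"
  using ide_comp arrow_hom by blast

text \<open>Composites are kept bracketed to the right, so a rewrite rule for \<open>g \<cdot> f\<close> needs this extension
  to apply in the middle of a composite.\<close>

lemma comp_extend:
  assumes "g \<cdot> f = r" "arrow C f" "arrow C g" "tgt C f = src C g" "arrow C h" "tgt C h = src C f"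
  shows "g \<cdot> (f \<cdot> h) = r \<cdot> h"
  using assms comp_assoc_arrow[of h f g] by auto

lemma is_iso_iff: "is_iso C a b f \<longleftrightarrow> invertible C f \<and> arrow C f \<and> src C f = a \<and> tgt C f = b"
  unfolding invertible_def is_iso_def using hom_disjoint hom_iff by metis

lemma is_isoI:
  assumes "f \<in> Hom C a b" "g \<in> Hom C b a" "g \<cdot> f = ide C a" "f \<cdot> g = ide C b"
  shows "is_iso C a b f"
  using assms by (auto simp: is_iso_def)

lemma invertible_arrow [simp]: "invertible C f \<Longrightarrow> arrow C f"
  by (auto simp: invertible_def is_iso_def arrow_def)

text \<open>Disjointness of hom-sets forces the objects quantified inside the description
  \<open>minv\<close> to be \<open>a\<close> and \<open>b\<close>; the usual uniqueness of two-sided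
  inverses does the rest.\<close>

lemma minv_unique:
  assumes "f \<in> Hom C a b" "g \<in> Hom C b a" "g \<cdot> f = ide C a" "f \<cdot> g = ide C b"
  shows "minv C f = g"
  unfolding minv_def
proof (rule the_equality)
  show "\<exists>a b. f \<in> Hom C a b \<and> g \<in> Hom C b a \<and> g \<cdot> f = ide C a \<and> f \<cdot> g = ide C b"
    using assms by blast
next
  fix h assume "\<exists>a b. f \<in> Hom C a b \<and> h \<in> Hom C b a \<and> h \<cdot> f = ide C a \<and> f \<cdot> h = ide C b"
  then have h: "h \<in> Hom C b a" "h \<cdot> f = ide C a"
    using assms(1) hom_disjoint by blast+
  have "h = h \<cdot> (f \<cdot> g)" using h assms by (simp add: hom_iff)
  also have "\<dots> = (h \<cdot> f) \<cdot> g" using h(1) assms(1,2) by (simp add: hom_iff)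
  also have "\<dots> = g" using h assms by (simp add: hom_iff)
  finally show "h = g" .
qed

lemma
  assumes "invertible C f"
  shows arrow_minv [simp]: "arrow C (minv C f)"
    and src_minv [simp]: "src C (minv C f) = tgt C f"
    and tgt_minv [simp]: "tgt C (minv C f) = src C f"
    and minv_comp: "minv C f \<cdot> f = ide C (src C f)"
    and comp_minv: "f \<cdot> minv C f = ide C (tgt C f)"
    and invertible_minv [simp]: "invertible C (minv C f)"
    and minv_minv [simp]: "minv C (minv C f) = f"
proof -
  obtain g where g: "g \<in> Hom C (tgt C f) (src C f)" "g \<cdot> f = ide C (src C f)" "f \<cdot> g = ide C (tgt C f)"
    using assms unfolding invertible_def is_iso_def using homD by metis
  have f: "f \<in> Hom C (src C f) (tgt C f)" using assms arrow_hom by simp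
  have [simp]: "minv C f = g" using g f minv_unique by blast
  show "arrow C (minv C f)" "src C (minv C f) = tgt C f" "tgt C (minv C f) = src C f"
    "minv C f \<cdot> f = ide C (src C f)" "f \<cdot> minv C f = ide C (tgt C f)"
    using g homD by auto
  show "invertible C (minv C f)" unfolding invertible_def using g f is_isoI[OF g(1) f] by auto
  show "minv C (minv C f) = f" using g f minv_unique by auto
qed

lemma minv_comp_src [simp]: "invertible C f \<Longrightarrow> minv C f \<cdot> f = ide C (src C f)"
  and comp_minv_tgt [simp]: "invertible C f \<Longrightarrow> f \<cdot> minv C f = ide C (tgt C f)"
  by (rule minv_comp comp_minv, assumption)+

lemma minv_comp_cancel [simp]:
  "invertible C f \<Longrightarrow> arrow C h \<Longrightarrow> tgt C h = src C f \<Longrightarrow> minv C f \<cdot> (f \<cdot> h) = h"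
  using comp_extend[of "minv C f" f _ h] by simp

lemma comp_minv_cancel [simp]:
  "invertible C f \<Longrightarrow> arrow C h \<Longrightarrow> tgt C h = tgt C f \<Longrightarrow> f \<cdot> (minv C f \<cdot> h) = h"
  using comp_extend[of f "minv C f" _ h] by simp

lemma invertible_comp [simp]:
  assumes "invertible C f" "invertible C g" "tgt C f = src C g"
  shows "invertible C (g \<cdot> f)"
proof -
  have "is_iso C (src C f) (tgt C g) (g \<cdot> f)"
    by (rule is_isoI[where g = "minv C f \<cdot> minv C g"]) (use assms in \<open>auto simp: hom_iff\<close>)
  then show ?thesis by (auto simp: invertible_def)
qed

lemma minv_mcomp:
  assumes "invertible C f" "invertible C g" "tgt C f = src C g"
  shows "minv C (g \<cdot> f) = minv C f \<cdot> minv C g"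
  by (rule minv_unique) (use assms in \<open>auto simp: hom_iff\<close>)

lemma invertible_ide [simp]: "a \<in> Obj C \<Longrightarrow> invertible C (ide C a)"
  unfolding invertible_def using is_isoI[of "ide C a" a a "ide C a"] by (auto simp: hom_iff)

lemma minv_ide [simp]: "a \<in> Obj C \<Longrightarrow> minv C (ide C a) = ide C a"
  by (rule minv_unique) (auto simp: hom_iff)

lemma invertible_cancel_left:
  assumes "invertible C f" "arrow C g" "arrow C h" "tgt C g = src C f" "tgt C h = src C f"
    and "f \<cdot> g = f \<cdot> h"
  shows "g = h"
  using assms minv_comp_cancel by metis

lemma invertible_cancel_right:
  assumes "invertible C f" "arrow C g" "arrow C h" "src C g = tgt C f" "src C h = tgt C f"
    and eq: "g \<cdot> f = h \<cdot> f"
  shows "g = h"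
proof -
  have "(g \<cdot> f) \<cdot> minv C f = (h \<cdot> f) \<cdot> minv C f" using eq by simp
  then show ?thesis using assms(1-5) by simp
qed

end

section \<open>Bilinear bifunctors, covering both tensor products and actions\<close>

locale linear_bifunctor =
  X: linear_category X + Y: linear_category Y + Z: linear_category Z
  for X :: "('o1, 'm1, 'k::field, 'x) lincat_scheme"
    and Y :: "('o2, 'm2, 'k, 'y) lincat_scheme"
    and Z :: "('o3, 'm3, 'k, 'z) lincat_scheme" +
  fixes bo :: "'o1 \<Rightarrow> 'o2 \<Rightarrow> 'o3" and bm :: "'m1 \<Rightarrow> 'm2 \<Rightarrow> 'm3"
  assumes bilinear: "bilinear_bifunctor X Y Z bo bm"
begin

lemma bifun_left: "b \<in> Obj Y \<Longrightarrow> linear_functor X Z (\<lambda>a. bo a b) (\<lambda>f. bm f (ide Y b))"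
  and bifun_right: "a \<in> Obj X \<Longrightarrow> linear_functor Y Z (bo a) (bm (ide X a))"
  using bilinear by (auto simp: bilinear_bifunctor_def)

lemma
  assumes "arrow X f" "arrow Y g"
  shows bifun_lr: "bm f g = bm f (ide Y (tgt Y g)) \<cdot>\<^bsub>Z\<^esub> bm (ide X (src X f)) g"
    and bifun_rl: "bm f g = bm (ide X (tgt X f)) g \<cdot>\<^bsub>Z\<^esub> bm f (ide Y (src Y g))"
proof -
  have "f \<in> Hom X (src X f) (tgt X f)" "g \<in> Hom Y (src Y g) (tgt Y g)"
    using assms X.arrow_hom Y.arrow_hom by auto
  then show "bm f g = bm f (ide Y (tgt Y g)) \<cdot>\<^bsub>Z\<^esub> bm (ide X (src X f)) g"
    "bm f g = bm (ide X (tgt X f)) g \<cdot>\<^bsub>Z\<^esub> bm f (ide Y (src Y g))"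
    using bilinear unfolding bilinear_bifunctor_def by blast+
qed

lemma bifun_obj [simp]: "a \<in> Obj X \<Longrightarrow> b \<in> Obj Y \<Longrightarrow> bo a b \<in> Obj Z"
  using bifun_right by (auto simp: linear_functor_def)

lemma bifun_ide [simp]: "a \<in> Obj X \<Longrightarrow> b \<in> Obj Y \<Longrightarrow> bm (ide X a) (ide Y b) = ide Z (bo a b)"
  using bifun_right by (auto simp: linear_functor_def)

lemma bifun_hom:
  assumes "arrow X f" "arrow Y g"
  shows "bm f g \<in> Hom Z (bo (src X f) (src Y g)) (bo (tgt X f) (tgt Y g))"
proof -
  have "bm f (ide Y (tgt Y g)) \<in> Hom Z (bo (src X f) (tgt Y g)) (bo (tgt X f) (tgt Y g))"
    using bifun_left[of "tgt Y g"] assms X.arrow_hom unfolding linear_functor_def by simp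
  moreover have "bm (ide X (src X f)) g \<in> Hom Z (bo (src X f) (src Y g)) (bo (src X f) (tgt Y g))"
    using bifun_right[of "src X f"] assms Y.arrow_hom unfolding linear_functor_def by simp
  ultimately show ?thesis using bifun_lr[OF assms] Z.comp_hom by metis
qed

lemma
  assumes "arrow X f" "arrow Y g"
  shows arrow_bifun [simp]: "arrow Z (bm f g)"
    and src_bifun [simp]: "src Z (bm f g) = bo (src X f) (src Y g)"
    and tgt_bifun [simp]: "tgt Z (bm f g) = bo (tgt X f) (tgt Y g)"
  using bifun_hom[OF assms] by (auto simp: Z.hom_iff)

lemma bifun_comp_left:
  "arrow X f \<Longrightarrow> arrow X g \<Longrightarrow> tgt X f = src X g \<Longrightarrow> b \<in> Obj Y
    \<Longrightarrow> bm (g \<cdot>\<^bsub>X\<^esub> f) (ide Y b) = bm g (ide Y b) \<cdot>\<^bsub>Z\<^esub> bm f (ide Y b)"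
  using bifun_left[of b] X.arrow_hom unfolding linear_functor_def by metis

lemma bifun_comp_right:
  "arrow Y f \<Longrightarrow> arrow Y g \<Longrightarrow> tgt Y f = src Y g \<Longrightarrow> a \<in> Obj X
    \<Longrightarrow> bm (ide X a) (g \<cdot>\<^bsub>Y\<^esub> f) = bm (ide X a) g \<cdot>\<^bsub>Z\<^esub> bm (ide X a) f"
  using bifun_right[of a] Y.arrow_hom unfolding linear_functor_def by metis

text \<open>Bilinearity supplies functoriality in each variable and two factorizations of
  \<open>bm f g\<close>. The mixed middle term is recognized as \<open>bm f g'\<close> and factored
  in the other order, which brings together the morphisms of each variable.\<close>

lemma interchange:
  assumes "arrow X f" "arrow X f'" "tgt X f = src X f'" "arrow Y g" "arrow Y g'" "tgt Y g = src Y g'"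
  shows "bm f' g' \<cdot>\<^bsub>Z\<^esub> bm f g = bm (f' \<cdot>\<^bsub>X\<^esub> f) (g' \<cdot>\<^bsub>Y\<^esub> g)"
proof -
  have "bm f' g' \<cdot>\<^bsub>Z\<^esub> bm f g = bm f' (ide Y (tgt Y g')) \<cdot>\<^bsub>Z\<^esub> bm (ide X (src X f')) g'
      \<cdot>\<^bsub>Z\<^esub> bm f (ide Y (tgt Y g)) \<cdot>\<^bsub>Z\<^esub> bm (ide X (src X f)) g"
    using assms bifun_lr[of f' g'] bifun_lr[of f g] by simp
  also have "bm (ide X (src X f')) g' \<cdot>\<^bsub>Z\<^esub> bm f (ide Y (tgt Y g)) \<cdot>\<^bsub>Z\<^esub> bm (ide X (src X f)) g
      = bm f g' \<cdot>\<^bsub>Z\<^esub> bm (ide X (src X f)) g"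
    using assms bifun_rl[of f g'] Z.comp_extend[OF bifun_rl[of f g', symmetric]] by simp
  also have "\<dots> = bm f (ide Y (tgt Y g')) \<cdot>\<^bsub>Z\<^esub> bm (ide X (src X f)) (g' \<cdot>\<^bsub>Y\<^esub> g)"
    using assms bifun_lr[of f g'] bifun_comp_right[of g g' "src X f"] by simp
  also have "bm f' (ide Y (tgt Y g')) \<cdot>\<^bsub>Z\<^esub> \<dots>
      = bm (f' \<cdot>\<^bsub>X\<^esub> f) (ide Y (tgt Y g')) \<cdot>\<^bsub>Z\<^esub> bm (ide X (src X f)) (g' \<cdot>\<^bsub>Y\<^esub> g)"
    using assms bifun_comp_left[of f f' "tgt Y g'"] by simp
  also have "\<dots> = bm (f' \<cdot>\<^bsub>X\<^esub> f) (g' \<cdot>\<^bsub>Y\<^esub> g)"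
    using assms bifun_lr[of "f' \<cdot>\<^bsub>X\<^esub> f" "g' \<cdot>\<^bsub>Y\<^esub> g"] by simp
  finally show ?thesis .
qed

lemma interchange_extend:
  assumes "arrow X f" "arrow X f'" "tgt X f = src X f'" "arrow Y g" "arrow Y g'" "tgt Y g = src Y g'"
    "arrow Z h" "tgt Z h = bo (src X f) (src Y g)"
  shows "bm f' g' \<cdot>\<^bsub>Z\<^esub> (bm f g \<cdot>\<^bsub>Z\<^esub> h) = bm (f' \<cdot>\<^bsub>X\<^esub> f) (g' \<cdot>\<^bsub>Y\<^esub> g) \<cdot>\<^bsub>Z\<^esub> h"
  by (rule Z.comp_extend[OF interchange]) (use assms in simp_all)

lemma
  assumes "invertible X f" "invertible Y g"
  shows invertible_bifun [simp]: "invertible Z (bm f g)"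
    and minv_bifun: "minv Z (bm f g) = bm (minv X f) (minv Y g)"
proof -
  have *: "bm f g \<in> Hom Z (bo (src X f) (src Y g)) (bo (tgt X f) (tgt Y g))"
    "bm (minv X f) (minv Y g) \<in> Hom Z (bo (tgt X f) (tgt Y g)) (bo (src X f) (src Y g))"
    using assms by (simp_all add: Z.hom_iff)
  have **: "bm (minv X f) (minv Y g) \<cdot>\<^bsub>Z\<^esub> bm f g = ide Z (bo (src X f) (src Y g))"
    "bm f g \<cdot>\<^bsub>Z\<^esub> bm (minv X f) (minv Y g) = ide Z (bo (tgt X f) (tgt Y g))"
    using assms by (simp_all add: interchange)
  show "invertible Z (bm f g)"
    using Z.is_isoI[OF * **] by (auto simp: invertible_def)
  show "minv Z (bm f g) = bm (minv X f) (minv Y g)"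
    using Z.minv_unique[OF * **] .
qed

end

section \<open>Nakayama functors and chains of adjunctions\<close>

locale linear_functor_between =
  X: linear_category X + Y: linear_category Y
  for X :: "('o1, 'm1, 'k::field, 'x) lincat_scheme"
    and Y :: "('o2, 'm2, 'k, 'y) lincat_scheme" +
  fixes Fo :: "'o1 \<Rightarrow> 'o2" and Fm :: "'m1 \<Rightarrow> 'm2"
  assumes is_functor: "linear_functor X Y Fo Fm"
begin

lemma functor_obj [simp]: "a \<in> Obj X \<Longrightarrow> Fo a \<in> Obj Y"
  and functor_ide [simp]: "a \<in> Obj X \<Longrightarrow> Fm (ide X a) = ide Y (Fo a)"
  using is_functor by (auto simp: linear_functor_def)

lemma functor_hom: "f \<in> Hom X a b \<Longrightarrow> Fm f \<in> Hom Y (Fo a) (Fo b)"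
  using is_functor by (auto simp: linear_functor_def)

lemma
  assumes "arrow X f"
  shows functor_arrow [simp]: "arrow Y (Fm f)"
    and functor_src [simp]: "src Y (Fm f) = Fo (src X f)"
    and functor_tgt [simp]: "tgt Y (Fm f) = Fo (tgt X f)"
  using functor_hom[OF X.arrow_hom[OF assms]] by (auto simp: Y.hom_iff)

lemma functor_comp [simp]:
  "arrow X f \<Longrightarrow> arrow X g \<Longrightarrow> tgt X f = src X g \<Longrightarrow> Fm (g \<cdot>\<^bsub>X\<^esub> f) = Fm g \<cdot>\<^bsub>Y\<^esub> Fm f"
  using is_functor X.arrow_hom unfolding linear_functor_def by metis

lemma functor_add: "f \<in> Hom X a b \<Longrightarrow> g \<in> Hom X a b \<Longrightarrow> Fm (f \<oplus>\<^bsub>X\<^esub> g) = Fm f \<oplus>\<^bsub>Y\<^esub> Fm g"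
  and functor_smul: "f \<in> Hom X a b \<Longrightarrow> Fm (msmul X s f) = msmul Y s (Fm f)"
  using is_functor unfolding linear_functor_def by blast+

end

section \<open>Functoriality of the Nakayama coend\<close>

locale nakayama_category = linear_category X
  for X :: "('o, 'm, 'k::field, 'z) lincat_scheme" (structure) +
  fixes N :: "('o, 'm, 'k) nakayama_data"
  assumes nakayama: "nakayama X N"
begin

lemma nob_obj [simp]: "y \<in> Obj X \<Longrightarrow> nob N y \<in> Obj X"
  and ninc_wedge: "y \<in> Obj X \<Longrightarrow> nakayama_wedge X y (nob N y) (ninc N y)"
  and nakayama_universal: "y \<in> Obj X \<Longrightarrow> z \<in> Obj X \<Longrightarrow> nakayama_wedge X y z j \<Longrightarrow>
    \<exists>!g. g \<in> Hom X (nob N y) z \<and> (\<forall>x \<in> Obj X. \<forall>\<phi> \<in> hom_dual X y x. g \<cdot> ninc N y x \<phi> = j x \<phi>)"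
  using nakayama unfolding nakayama_def by blast+

lemma ninc_hom: "y \<in> Obj X \<Longrightarrow> x \<in> Obj X \<Longrightarrow> \<phi> \<in> hom_dual X y x \<Longrightarrow> ninc N y x \<phi> \<in> Hom X x (nob N y)"
  using ninc_wedge unfolding nakayama_wedge_def by blast

lemma ninc_add: "y \<in> Obj X \<Longrightarrow> x \<in> Obj X \<Longrightarrow> \<phi> \<in> hom_dual X y x \<Longrightarrow> \<psi> \<in> hom_dual X y x \<Longrightarrow>
    ninc N y x (\<lambda>f\<in>Hom X y x. \<phi> f + \<psi> f) = ninc N y x \<phi> \<oplus> ninc N y x \<psi>"
  and ninc_smul: "y \<in> Obj X \<Longrightarrow> x \<in> Obj X \<Longrightarrow> \<phi> \<in> hom_dual X y x \<Longrightarrow>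
    ninc N y x (\<lambda>f\<in>Hom X y x. s * \<phi> f) = msmul X s (ninc N y x \<phi>)"
  using ninc_wedge unfolding nakayama_wedge_def by blast+

lemma ninc_nat: "y \<in> Obj X \<Longrightarrow> h \<in> Hom X x x' \<Longrightarrow> \<phi> \<in> hom_dual X y x' \<Longrightarrow>
    ninc N y x' \<phi> \<cdot> h = ninc N y x (\<lambda>f\<in>Hom X y x. \<phi> (h \<cdot> f))"
  using ninc_wedge unfolding nakayama_wedge_def by blast

lemma wedge_comp:
  assumes j: "nakayama_wedge X y z j" and g: "g \<in> Hom X z z'"
  shows "nakayama_wedge X y z' (\<lambda>x \<phi>. g \<cdot> j x \<phi>)"
  unfolding nakayama_wedge_def
proof (intro conjI ballI allI)
  have hom: "\<And>x \<phi>. x \<in> Obj X \<Longrightarrow> \<phi> \<in> hom_dual X y x \<Longrightarrow> j x \<phi> \<in> Hom X x z"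
    using j unfolding nakayama_wedge_def by blast
  show "g \<cdot> j x \<phi> \<in> Hom X x z'" if "x \<in> Obj X" "\<phi> \<in> hom_dual X y x" for x \<phi>
    using comp_hom[OF hom g] that by blast
  show "g \<cdot> j x (\<lambda>f\<in>Hom X y x. \<phi> f + \<psi> f) = (g \<cdot> j x \<phi>) \<oplus> (g \<cdot> j x \<psi>)"
    if "x \<in> Obj X" "\<phi> \<in> hom_dual X y x" "\<psi> \<in> hom_dual X y x" for x \<phi> \<psi>
    using comp_add_right[OF hom hom g] that j unfolding nakayama_wedge_def by simp
  show "g \<cdot> j x (\<lambda>f\<in>Hom X y x. s * \<phi> f) = msmul X s (g \<cdot> j x \<phi>)"
    if "x \<in> Obj X" "\<phi> \<in> hom_dual X y x" for x s \<phi>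
    using comp_smul_right[OF hom g] that j unfolding nakayama_wedge_def by simp
  show "(g \<cdot> j x' \<phi>) \<cdot> h = g \<cdot> j x (\<lambda>f\<in>Hom X y x. \<phi> (h \<cdot> f))"
    if h: "h \<in> Hom X x x'" and "\<phi> \<in> hom_dual X y x'" for x x' h \<phi>
  proof -
    have "x' \<in> Obj X" using hom_obj h by blast
    moreover have "j x' \<phi> \<cdot> h = j x (\<lambda>f\<in>Hom X y x. \<phi> (h \<cdot> f))"
      using j that unfolding nakayama_wedge_def by blast
    ultimately show ?thesis using comp_assoc[OF h hom g] that by simp
  qed
qed

text \<open>The family \<open>ninc N y\<close> is jointly epic: composing it with \<open>g\<close>
  is again a wedge, and \<open>g\<close> and \<open>g'\<close> both factor that wedge.\<close>

lemma nakayama_ext: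
  assumes "y \<in> Obj X" "g \<in> Hom X (nob N y) z" "g' \<in> Hom X (nob N y) z"
    and "\<And>x \<phi>. x \<in> Obj X \<Longrightarrow> \<phi> \<in> hom_dual X y x \<Longrightarrow> g \<cdot> ninc N y x \<phi> = g' \<cdot> ninc N y x \<phi>"
  shows "g = g'"
proof -
  have "z \<in> Obj X" using hom_obj assms by blast
  then show ?thesis
    using nakayama_universal[OF _ _ wedge_comp[OF ninc_wedge assms(2)]] assms by (metis (no_types))
qed

lemma hom_dual_precomp:
  assumes \<phi>: "\<phi> \<in> hom_dual X y x" and f: "f \<in> Hom X y y'"
  shows "(\<lambda>h\<in>Hom X y' x. \<phi> (h \<cdot> f)) \<in> hom_dual X y' x"
  using \<phi> comp_hom[OF f] comp_add_left[OF f] comp_smul_left[OF f] add_hom smul_hom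
  unfolding hom_dual_def by auto

text \<open>Being a definite description, \<open>nmor\<close> is controlled only once the family of
  precomposed functionals is known to be a wedge; the universal property then yields the described
  morphism.\<close>

lemma nmor_props:
  assumes f: "f \<in> Hom X y y'"
  shows nmor_hom: "nmor X N y y' f \<in> Hom X (nob N y) (nob N y')"
    and nmor_ninc: "x \<in> Obj X \<Longrightarrow> \<phi> \<in> hom_dual X y x \<Longrightarrow>
      nmor X N y y' f \<cdot> ninc N y x \<phi> = ninc N y' x (\<lambda>h\<in>Hom X y' x. \<phi> (h \<cdot> f))"
proof -
  have y: "y \<in> Obj X" "y' \<in> Obj X" using f hom_obj by auto
  have pre: "\<And>x \<phi>. \<phi> \<in> hom_dual X y x \<Longrightarrow> (\<lambda>h\<in>Hom X y' x. \<phi> (h \<cdot> f)) \<in> hom_dual X y' x"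
    using hom_dual_precomp f by blast
  have "nakayama_wedge X y (nob N y') (\<lambda>x \<phi>. ninc N y' x (\<lambda>h\<in>Hom X y' x. \<phi> (h \<cdot> f)))"
    unfolding nakayama_wedge_def
  proof (intro conjI ballI allI)
    show "ninc N y' x (\<lambda>h\<in>Hom X y' x. \<phi> (h \<cdot> f)) \<in> Hom X x (nob N y')"
      if "x \<in> Obj X" "\<phi> \<in> hom_dual X y x" for x \<phi>
      using that y pre ninc_hom by blast
    show "ninc N y' x (\<lambda>h\<in>Hom X y' x. (\<lambda>f\<in>Hom X y x. \<phi> f + \<psi> f) (h \<cdot> f)) =
        ninc N y' x (\<lambda>h\<in>Hom X y' x. \<phi> (h \<cdot> f)) \<oplus> ninc N y' x (\<lambda>h\<in>Hom X y' x. \<psi> (h \<cdot> f))"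
      if "x \<in> Obj X" "\<phi> \<in> hom_dual X y x" "\<psi> \<in> hom_dual X y x" for x \<phi> \<psi>
      unfolding ninc_add[OF y(2) that(1) pre[OF that(2)] pre[OF that(3)], symmetric]
      using comp_hom[OF f] by (intro arg_cong[where f = "ninc N y' x"]) auto
    show "ninc N y' x (\<lambda>h\<in>Hom X y' x. (\<lambda>f\<in>Hom X y x. s * \<phi> f) (h \<cdot> f)) =
        msmul X s (ninc N y' x (\<lambda>h\<in>Hom X y' x. \<phi> (h \<cdot> f)))"
      if "x \<in> Obj X" "\<phi> \<in> hom_dual X y x" for x s \<phi>
      unfolding ninc_smul[OF y(2) that(1) pre[OF that(2)], symmetric]
      using comp_hom[OF f] by (intro arg_cong[where f = "ninc N y' x"]) auto
    show "ninc N y' x' (\<lambda>h\<in>Hom X y' x'. \<phi> (h \<cdot> f)) \<cdot> g =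
        ninc N y' x (\<lambda>h\<in>Hom X y' x. (\<lambda>f\<in>Hom X y x. \<phi> (g \<cdot> f)) (h \<cdot> f))"
      if "g \<in> Hom X x x'" "\<phi> \<in> hom_dual X y x'" for x x' g \<phi>
      unfolding ninc_nat[OF y(2) that(1) pre[OF that(2)]]
      using comp_hom[OF f] comp_hom[OF _ that(1)] comp_assoc[OF f _ that(1)]
      by (intro arg_cong[where f = "ninc N y' x"]) (auto simp: fun_eq_iff)
  qed
  from theI'[OF nakayama_universal[OF y(1) nob_obj[OF y(2)] this]]
  show "nmor X N y y' f \<in> Hom X (nob N y) (nob N y')"
    and "x \<in> Obj X \<Longrightarrow> \<phi> \<in> hom_dual X y x \<Longrightarrow>
      nmor X N y y' f \<cdot> ninc N y x \<phi> = ninc N y' x (\<lambda>h\<in>Hom X y' x. \<phi> (h \<cdot> f))"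
    unfolding nmor_def by blast+
qed

lemma nmor_comp:
  assumes f: "f \<in> Hom X y y'" and g: "g \<in> Hom X y' y''"
  shows "nmor X N y' y'' g \<cdot> nmor X N y y' f = nmor X N y y'' (g \<cdot> f)"
proof (rule nakayama_ext)
  show y: "y \<in> Obj X" using f hom_obj by blast
  show "nmor X N y' y'' g \<cdot> nmor X N y y' f \<in> Hom X (nob N y) (nob N y'')"
    using comp_hom[OF nmor_hom[OF f] nmor_hom[OF g]] .
  show "nmor X N y y'' (g \<cdot> f) \<in> Hom X (nob N y) (nob N y'')"
    using nmor_hom[OF comp_hom[OF f g]] .
  fix x \<phi> assume x: "x \<in> Obj X" "\<phi> \<in> hom_dual X y x"
  show "(nmor X N y' y'' g \<cdot> nmor X N y y' f) \<cdot> ninc N y x \<phi> = nmor X N y y'' (g \<cdot> f) \<cdot> ninc N y x \<phi>"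
    unfolding comp_assoc[OF ninc_hom[OF y x] nmor_hom[OF f] nmor_hom[OF g]] nmor_ninc[OF f x]
      nmor_ninc[OF g x(1) hom_dual_precomp[OF x(2) f]] nmor_ninc[OF comp_hom[OF f g] x]
    using comp_hom[OF g] comp_assoc[OF f g]
    by (intro arg_cong[where f = "ninc N y'' x"]) (auto simp: fun_eq_iff)
qed

lemma nmor_ide:
  assumes y: "y \<in> Obj X"
  shows "nmor X N y y (ide X y) = ide X (nob N y)"
proof (rule nakayama_ext[OF y nmor_hom[OF ide_hom[OF y]] ide_hom[OF nob_obj[OF y]]])
  fix x \<phi> assume x: "x \<in> Obj X" "\<phi> \<in> hom_dual X y x"
  have "(\<lambda>h\<in>Hom X y x. \<phi> (h \<cdot> ide X y)) = \<phi>"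
    using x(2) comp_ide by (auto simp: hom_dual_def fun_eq_iff extensional_def)
  then show "nmor X N y y (ide X y) \<cdot> ninc N y x \<phi> = ide X (nob N y) \<cdot> ninc N y x \<phi>"
    using nmor_ninc[OF ide_hom[OF y] x] ide_comp[OF ninc_hom[OF y x]] by simp
qed

lemma nmor_iso:
  assumes f: "is_iso X y y' f"
  shows "is_iso X (nob N y) (nob N y') (nmor X N y y' f)"
proof -
  obtain g where g: "g \<in> Hom X y' y" "g \<cdot> f = ide X y" "f \<cdot> g = ide X y'" and f': "f \<in> Hom X y y'"
    using f by (auto simp: is_iso_def)
  show ?thesis
    using is_isoI[OF nmor_hom[OF f'] nmor_hom[OF g(1)]] nmor_comp[OF f' g(1)] nmor_comp[OF g(1) f']
      g nmor_ide hom_obj[OF f'] by simp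
qed

end

text \<open>Adjunctions \<open>F \<stileturn> G \<stileturn> H \<stileturn> K\<close>, given by the counit \<open>eps\<close> of the first, the unit \<open>eta\<close> of the
  second and the counit \<open>del\<close> of the third. The last assumption on \<open>eta\<close> says that both descriptions of
  \<open>G\<close> give the same action on morphisms.\<close>

locale adjoint_chain =
  F: linear_functor_between X Y Fo Fm + H: linear_functor_between X Y Ho Hm +
  NX: nakayama_category X NX + NY: nakayama_category Y NY
  for X :: "('o1, 'm1, 'k::field, 'x) lincat_scheme"
    and Y :: "('o2, 'm2, 'k, 'y) lincat_scheme" and Fo Fm Ho Hm NX NY +
  fixes Go eps eta Ko del
  assumes Go_obj [simp]: "z \<in> Obj Y \<Longrightarrow> Go z \<in> Obj X"
    and eps_hom: "z \<in> Obj Y \<Longrightarrow> eps z \<in> Hom Y (Fo (Go z)) z"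
    and eps_universal: "z \<in> Obj Y \<Longrightarrow> c \<in> Obj X \<Longrightarrow> f \<in> Hom Y (Fo c) z \<Longrightarrow>
      \<exists>!g. g \<in> Hom X c (Go z) \<and> eps z \<cdot>\<^bsub>Y\<^esub> Fm g = f"
    and eta_hom: "z \<in> Obj Y \<Longrightarrow> eta z \<in> Hom Y z (Ho (Go z))"
    and eta_universal: "z \<in> Obj Y \<Longrightarrow> c \<in> Obj X \<Longrightarrow> f \<in> Hom Y z (Ho c) \<Longrightarrow>
      \<exists>!g. g \<in> Hom X (Go z) c \<and> Hm g \<cdot>\<^bsub>Y\<^esub> eta z = f"
    and eta_nat: "h \<in> Hom Y z z' \<Longrightarrow> g \<in> Hom X (Go z) (Go z') \<Longrightarrow>
      eps z' \<cdot>\<^bsub>Y\<^esub> Fm g = h \<cdot>\<^bsub>Y\<^esub> eps z \<Longrightarrow> Hm g \<cdot>\<^bsub>Y\<^esub> eta z = eta z' \<cdot>\<^bsub>Y\<^esub> h"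
    and Ko_obj [simp]: "z \<in> Obj Y \<Longrightarrow> Ko z \<in> Obj X"
    and del_hom: "z \<in> Obj Y \<Longrightarrow> del z \<in> Hom Y (Ho (Ko z)) z"
    and del_universal: "z \<in> Obj Y \<Longrightarrow> c \<in> Obj X \<Longrightarrow> f \<in> Hom Y (Ho c) z \<Longrightarrow>
      \<exists>!g. g \<in> Hom X c (Ko z) \<and> del z \<cdot>\<^bsub>Y\<^esub> Hm g = f"
begin

text \<open>Transposition \<open>Hom(F c, z) \<rightarrow> Hom(c, G z)\<close>. The next two
  definitions do the same for \<open>G \<stileturn> H\<close> and
  \<open>H \<stileturn> K\<close>.\<close>

definition eps_tr where
  "eps_tr c z f = (THE g. g \<in> Hom X c (Go z) \<and> eps z \<cdot>\<^bsub>Y\<^esub> Fm g = f)"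

definition eta_tr where
  "eta_tr z c f = (THE g. g \<in> Hom X (Go z) c \<and> Hm g \<cdot>\<^bsub>Y\<^esub> eta z = f)"

definition del_tr where
  "del_tr c z f = (THE g. g \<in> Hom X c (Ko z) \<and> del z \<cdot>\<^bsub>Y\<^esub> Hm g = f)"

lemma
  assumes "c \<in> Obj X" "f \<in> Hom Y (Fo c) z"
  shows eps_tr_hom: "eps_tr c z f \<in> Hom X c (Go z)"
    and eps_tr: "eps z \<cdot>\<^bsub>Y\<^esub> Fm (eps_tr c z f) = f"
  using theI'[OF eps_universal[OF _ assms]] F.Y.hom_obj[OF assms(2)] unfolding eps_tr_def by auto

lemma
  assumes "c \<in> Obj X" "f \<in> Hom Y z (Ho c)"
  shows eta_tr_hom: "eta_tr z c f \<in> Hom X (Go z) c"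
    and eta_tr: "Hm (eta_tr z c f) \<cdot>\<^bsub>Y\<^esub> eta z = f"
  using theI'[OF eta_universal[OF _ assms]] F.Y.hom_obj[OF assms(2)] unfolding eta_tr_def by auto

lemma
  assumes "c \<in> Obj X" "f \<in> Hom Y (Ho c) z"
  shows del_tr_hom: "del_tr c z f \<in> Hom X c (Ko z)"
    and del_tr: "del z \<cdot>\<^bsub>Y\<^esub> Hm (del_tr c z f) = f"
  using theI'[OF del_universal[OF _ assms]] F.Y.hom_obj[OF assms(2)] unfolding del_tr_def by auto

lemma eps_tr_unique:
  assumes "z \<in> Obj Y" "g \<in> Hom X c (Go z)" "eps z \<cdot>\<^bsub>Y\<^esub> Fm g = f"
  shows "eps_tr c z f = g"
proof -
  have f: "f \<in> Hom Y (Fo c) z" using F.Y.comp_hom[OF F.functor_hom[OF assms(2)] eps_hom] assms by simp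
  show ?thesis
    using eps_universal[OF assms(1) _ f] f F.X.hom_obj[OF assms(2)] eps_tr_hom eps_tr assms by blast
qed

lemma eta_ext:
  assumes "z \<in> Obj Y" "g \<in> Hom X (Go z) c" "g' \<in> Hom X (Go z) c" "Hm g \<cdot>\<^bsub>Y\<^esub> eta z = Hm g' \<cdot>\<^bsub>Y\<^esub> eta z"
  shows "g = g'"
  using eta_universal[OF assms(1) _ F.Y.comp_hom[OF eta_hom H.functor_hom[OF assms(2)]]]
    F.X.hom_obj[OF assms(2)] assms by metis

lemma del_ext:
  assumes "z \<in> Obj Y" "g \<in> Hom X c (Ko z)" "g' \<in> Hom X c (Ko z)" "del z \<cdot>\<^bsub>Y\<^esub> Hm g = del z \<cdot>\<^bsub>Y\<^esub> Hm g'"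
  shows "g = g'"
  using del_universal[OF assms(1) _ F.Y.comp_hom[OF H.functor_hom[OF assms(2)] del_hom]]
    F.X.hom_obj[OF assms(2)] assms by metis

section \<open>Linearity and naturality of the transpositions\<close>

lemma eps_tr_add:
  assumes c: "c \<in> Obj X" and f: "f \<in> Hom Y (Fo c) z" and f': "f' \<in> Hom Y (Fo c) z"
  shows "eps_tr c z (f \<oplus>\<^bsub>Y\<^esub> f') = eps_tr c z f \<oplus>\<^bsub>X\<^esub> eps_tr c z f'"
proof (rule eps_tr_unique)
  show z: "z \<in> Obj Y" using F.Y.hom_obj[OF f] by simp
  note g = eps_tr_hom[OF c f] eps_tr_hom[OF c f']
  show "eps_tr c z f \<oplus>\<^bsub>X\<^esub> eps_tr c z f' \<in> Hom X c (Go z)" using F.X.add_hom[OF g] .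
  show "eps z \<cdot>\<^bsub>Y\<^esub> Fm (eps_tr c z f \<oplus>\<^bsub>X\<^esub> eps_tr c z f') = f \<oplus>\<^bsub>Y\<^esub> f'"
    using F.functor_add[OF g] F.Y.comp_add_right[OF g[THEN F.functor_hom] eps_hom[OF z]]
      eps_tr[OF c] f f' by simp
qed

lemma eps_tr_smul:
  assumes c: "c \<in> Obj X" and f: "f \<in> Hom Y (Fo c) z"
  shows "eps_tr c z (msmul Y s f) = msmul X s (eps_tr c z f)"
proof (rule eps_tr_unique)
  show z: "z \<in> Obj Y" using F.Y.hom_obj[OF f] by simp
  note g = eps_tr_hom[OF c f]
  show "msmul X s (eps_tr c z f) \<in> Hom X c (Go z)" using F.X.smul_hom[OF g] .
  show "eps z \<cdot>\<^bsub>Y\<^esub> Fm (msmul X s (eps_tr c z f)) = msmul Y s f"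
    using F.functor_smul[OF g] F.Y.comp_smul_right[OF g[THEN F.functor_hom] eps_hom[OF z]]
      eps_tr[OF c] f by simp
qed

text \<open>Linearity here makes a family transported along \<open>H \<stileturn> K\<close> linear
  again, as a wedge must be; linearity of \<open>eps_tr\<close> serves the functionals
  \<open>push\<close>.\<close>

lemma del_tr_add:
  assumes c: "c \<in> Obj X" and f: "f \<in> Hom Y (Ho c) z" and f': "f' \<in> Hom Y (Ho c) z"
  shows "del_tr c z (f \<oplus>\<^bsub>Y\<^esub> f') = del_tr c z f \<oplus>\<^bsub>X\<^esub> del_tr c z f'"
proof (rule del_ext)
  show z: "z \<in> Obj Y" using F.Y.hom_obj[OF f] by simp
  note g = del_tr_hom[OF c f] del_tr_hom[OF c f']
  show "del_tr c z f \<oplus>\<^bsub>X\<^esub> del_tr c z f' \<in> Hom X c (Ko z)" using F.X.add_hom[OF g] .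
  show "del_tr c z (f \<oplus>\<^bsub>Y\<^esub> f') \<in> Hom X c (Ko z)" using del_tr_hom[OF c F.Y.add_hom[OF f f']] .
  show "del z \<cdot>\<^bsub>Y\<^esub> Hm (del_tr c z (f \<oplus>\<^bsub>Y\<^esub> f')) = del z \<cdot>\<^bsub>Y\<^esub> Hm (del_tr c z f \<oplus>\<^bsub>X\<^esub> del_tr c z f')"
    using H.functor_add[OF g] F.Y.comp_add_right[OF g[THEN H.functor_hom] del_hom[OF z]]
      del_tr[OF c] f f' del_tr[OF c F.Y.add_hom[OF f f']] by simp
qed

lemma del_tr_smul:
  assumes c: "c \<in> Obj X" and f: "f \<in> Hom Y (Ho c) z"
  shows "del_tr c z (msmul Y s f) = msmul X s (del_tr c z f)"
proof (rule del_ext)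
  show z: "z \<in> Obj Y" using F.Y.hom_obj[OF f] by simp
  note g = del_tr_hom[OF c f]
  show "msmul X s (del_tr c z f) \<in> Hom X c (Ko z)" using F.X.smul_hom[OF g] .
  show "del_tr c z (msmul Y s f) \<in> Hom X c (Ko z)" using del_tr_hom[OF c F.Y.smul_hom[OF f]] .
  show "del z \<cdot>\<^bsub>Y\<^esub> Hm (del_tr c z (msmul Y s f)) = del z \<cdot>\<^bsub>Y\<^esub> Hm (msmul X s (del_tr c z f))"
    using H.functor_smul[OF g] F.Y.comp_smul_right[OF g[THEN H.functor_hom] del_hom[OF z]]
      del_tr[OF c] f del_tr[OF c F.Y.smul_hom[OF f]] by simp
qed

text \<open>The counit of \<open>G \<stileturn> H\<close>, as the transpose of an identity;
  \<open>theta_eta\<close> is one of its triangle identities.\<close>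

definition theta where
  "theta c = eta_tr (Ho c) c (ide Y (Ho c))"

lemma
  assumes c: "c \<in> Obj X"
  shows theta_hom: "theta c \<in> Hom X (Go (Ho c)) c"
    and theta_eta: "Hm (theta c) \<cdot>\<^bsub>Y\<^esub> eta (Ho c) = ide Y (Ho c)"
  using eta_tr_hom[OF c F.Y.ide_hom] eta_tr[OF c F.Y.ide_hom] c unfolding theta_def by simp_all

text \<open>The locale gives \<open>G\<close> on objects only. Its value on morphisms is read off
  from \<open>F \<stileturn> G\<close>, and \<open>eta_nat\<close> makes \<open>eta\<close> natural
  for this same choice.\<close>

definition Gm where
  "Gm z z' h = eps_tr (Go z) z' (h \<cdot>\<^bsub>Y\<^esub> eps z)"

lemma
  assumes h: "h \<in> Hom Y z z'"
  shows Gm_hom: "Gm z z' h \<in> Hom X (Go z) (Go z')"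
    and eps_Gm: "eps z' \<cdot>\<^bsub>Y\<^esub> Fm (Gm z z' h) = h \<cdot>\<^bsub>Y\<^esub> eps z"
    and Gm_eta: "Hm (Gm z z' h) \<cdot>\<^bsub>Y\<^esub> eta z = eta z' \<cdot>\<^bsub>Y\<^esub> h"
proof -
  have z: "z \<in> Obj Y" using h F.Y.hom_obj by blast
  note * = Go_obj[OF z] F.Y.comp_hom[OF eps_hom[OF z] h]
  show "Gm z z' h \<in> Hom X (Go z) (Go z')" "eps z' \<cdot>\<^bsub>Y\<^esub> Fm (Gm z z' h) = h \<cdot>\<^bsub>Y\<^esub> eps z"
    unfolding Gm_def by (rule eps_tr_hom[OF *], rule eps_tr[OF *])
  then show "Hm (Gm z z' h) \<cdot>\<^bsub>Y\<^esub> eta z = eta z' \<cdot>\<^bsub>Y\<^esub> h" by (rule eta_nat[OF h])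
qed

lemma eps_tr_comp:
  assumes h: "h \<in> Hom Y z z'" and c: "c \<in> Obj X" and f: "f \<in> Hom Y (Fo c) z"
  shows "eps_tr c z' (h \<cdot>\<^bsub>Y\<^esub> f) = Gm z z' h \<cdot>\<^bsub>X\<^esub> eps_tr c z f"
proof (rule eps_tr_unique)
  note [simp] = F.X.hom_iff F.Y.hom_iff
  have z: "z \<in> Obj Y" "z' \<in> Obj Y" using h F.Y.hom_obj by blast+
  then show "z' \<in> Obj Y" by simp
  note * = eps_tr_hom[OF c f] Gm_hom[OF h] eps_hom[OF z(1)] eps_hom[OF z(2)]
  show "Gm z z' h \<cdot>\<^bsub>X\<^esub> eps_tr c z f \<in> Hom X c (Go z')" using * by simp
  show "eps z' \<cdot>\<^bsub>Y\<^esub> Fm (Gm z z' h \<cdot>\<^bsub>X\<^esub> eps_tr c z f) = h \<cdot>\<^bsub>Y\<^esub> f"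
    using * h f eps_tr[OF c f] F.Y.comp_extend[OF eps_Gm[OF h], of "Fm (eps_tr c z f)"] by simp
qed

text \<open>A morphism out of \<open>Go z\<close> is determined by its image under \<open>Hm\<close>
  composed with \<open>eta z\<close>, so naturality of the counit follows from that of the unit and
  \<open>theta_eta\<close>.\<close>

lemma theta_nat:
  assumes t: "t \<in> Hom X c c'"
  shows "theta c' \<cdot>\<^bsub>X\<^esub> Gm (Ho c) (Ho c') (Hm t) = t \<cdot>\<^bsub>X\<^esub> theta c"
proof (rule eta_ext)
  note [simp] = F.X.hom_iff F.Y.hom_iff
  have c: "c \<in> Obj X" "c' \<in> Obj X" using t F.X.hom_obj by blast+
  then show z: "Ho c \<in> Obj Y" by simp
  have z': "Ho c' \<in> Obj Y" using c by simp
  note * = theta_hom[OF c(1)] theta_hom[OF c(2)] Gm_hom[OF H.functor_hom[OF t]]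
    eta_hom[OF z] eta_hom[OF z']
  show "theta c' \<cdot>\<^bsub>X\<^esub> Gm (Ho c) (Ho c') (Hm t) \<in> Hom X (Go (Ho c)) c'"
    "t \<cdot>\<^bsub>X\<^esub> theta c \<in> Hom X (Go (Ho c)) c'"
    using * t by simp_all
  show "Hm (theta c' \<cdot>\<^bsub>X\<^esub> Gm (Ho c) (Ho c') (Hm t)) \<cdot>\<^bsub>Y\<^esub> eta (Ho c) =
      Hm (t \<cdot>\<^bsub>X\<^esub> theta c) \<cdot>\<^bsub>Y\<^esub> eta (Ho c)"
    using * t Gm_eta[OF H.functor_hom[OF t]] F.Y.comp_extend[OF theta_eta[OF c(2)], of "Hm t"]
      theta_eta[OF c(1)] by simp
qed

text \<open>The second triangle identity of \<open>G \<stileturn> H\<close>, obtained from the first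
  by the same cancellation of \<open>eta\<close>.\<close>

lemma theta_Gm_eta:
  assumes z: "z \<in> Obj Y"
  shows "theta (Go z) \<cdot>\<^bsub>X\<^esub> Gm z (Ho (Go z)) (eta z) = ide X (Go z)"
proof (rule eta_ext[OF z])
  note [simp] = F.X.hom_iff F.Y.hom_iff
  have z': "Ho (Go z) \<in> Obj Y" using z by simp
  note * = theta_hom[OF Go_obj[OF z]] Gm_hom[OF eta_hom[OF z]] eta_hom[OF z] eta_hom[OF z']
  show "theta (Go z) \<cdot>\<^bsub>X\<^esub> Gm z (Ho (Go z)) (eta z) \<in> Hom X (Go z) (Go z)"
    "ide X (Go z) \<in> Hom X (Go z) (Go z)"
    using * z by simp_all
  show "Hm (theta (Go z) \<cdot>\<^bsub>X\<^esub> Gm z (Ho (Go z)) (eta z)) \<cdot>\<^bsub>Y\<^esub> eta z = Hm (ide X (Go z)) \<cdot>\<^bsub>Y\<^esub> eta z"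
    using * z Gm_eta[OF eta_hom[OF z]] F.Y.comp_extend[OF theta_eta[OF Go_obj[OF z]], of "eta z"]
    by simp
qed

text \<open>Dual of the adjunction bijection
  \<open>Hom(x, G z) \<rightarrow> Hom(F x, z)\<close>.\<close>

definition pull where
  "pull x z \<phi> = (\<lambda>h\<in>Hom X x (Go z). \<phi> (eps z \<cdot>\<^bsub>Y\<^esub> Fm h))"

text \<open>Dual of \<open>Hom(F x, H c) \<cong> Hom(x, G (H c)) \<rightarrow> Hom(x, c)\<close>,
  whose last map composes with the counit \<open>theta c\<close>. It carries the inverse of the
  comparison, as \<open>pull\<close> carries the comparison.\<close>

definition push where
  "push x c \<phi> = (\<lambda>h\<in>Hom Y (Fo x) (Ho c). \<phi> (theta c \<cdot>\<^bsub>X\<^esub> eps_tr x (Ho c) h))"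

definition comparison_wedge where
  "comparison_wedge x z \<phi> = Hm (ninc NX x (Go z) (pull x z \<phi>)) \<cdot>\<^bsub>Y\<^esub> eta z"

section \<open>Invertibility of the comparison of coends\<close>

context
  fixes x assumes x: "x \<in> Obj X"
begin

lemma pull_arg: "z \<in> Obj Y \<Longrightarrow> h \<in> Hom X x (Go z) \<Longrightarrow> eps z \<cdot>\<^bsub>Y\<^esub> Fm h \<in> Hom Y (Fo x) z"
  using F.Y.comp_hom[OF F.functor_hom eps_hom] .

lemma push_arg:
  "c \<in> Obj X \<Longrightarrow> h \<in> Hom Y (Fo x) (Ho c) \<Longrightarrow> theta c \<cdot>\<^bsub>X\<^esub> eps_tr x (Ho c) h \<in> Hom X x c"
  using F.X.comp_hom[OF eps_tr_hom[OF x] theta_hom] .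

lemma pull_dual:
  assumes z: "z \<in> Obj Y" and \<phi>: "\<phi> \<in> hom_dual Y (Fo x) z"
  shows "pull x z \<phi> \<in> hom_dual X x (Go z)"
  using \<phi> pull_arg[OF z] F.functor_add F.functor_smul F.X.add_hom F.X.smul_hom
    F.Y.comp_add_right[OF F.functor_hom F.functor_hom eps_hom[OF z]]
    F.Y.comp_smul_right[OF F.functor_hom eps_hom[OF z]]
  unfolding hom_dual_def pull_def by simp

lemma push_dual:
  assumes c: "c \<in> Obj X" and \<phi>: "\<phi> \<in> hom_dual X x c"
  shows "push x c \<phi> \<in> hom_dual Y (Fo x) (Ho c)"
  using \<phi> push_arg[OF c] eps_tr_add[OF x] eps_tr_smul[OF x] F.Y.add_hom F.Y.smul_hom
    F.X.comp_add_right[OF eps_tr_hom[OF x] eps_tr_hom[OF x] theta_hom[OF c]]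
    F.X.comp_smul_right[OF eps_tr_hom[OF x] theta_hom[OF c]]
  unfolding hom_dual_def push_def by simp

text \<open>This is the wedge whose factorization \<open>nakayama_comparison\<close> describes. It
  is dinatural because pulling back the functional \<open>\<phi> (h \<cdot> -)\<close> amounts to
  precomposing with \<open>Gm z z' h\<close>, which \<open>Gm_eta\<close> moves past the
  unit.\<close>

lemma comparison_wedge: "nakayama_wedge Y (Fo x) (Ho (nob NX x)) (comparison_wedge x)"
  unfolding nakayama_wedge_def comparison_wedge_def
proof (intro conjI ballI allI)
  have n_hom: "\<And>z \<phi>. z \<in> Obj Y \<Longrightarrow> \<phi> \<in> hom_dual Y (Fo x) z \<Longrightarrow>
      ninc NX x (Go z) (pull x z \<phi>) \<in> Hom X (Go z) (nob NX x)"
    using NX.ninc_hom[OF x Go_obj pull_dual] by blast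
  show "Hm (ninc NX x (Go z) (pull x z \<phi>)) \<cdot>\<^bsub>Y\<^esub> eta z \<in> Hom Y z (Ho (nob NX x))"
    if "z \<in> Obj Y" "\<phi> \<in> hom_dual Y (Fo x) z" for z \<phi>
    using F.Y.comp_hom[OF eta_hom H.functor_hom[OF n_hom]] that by blast
  show "Hm (ninc NX x (Go z) (pull x z (\<lambda>f\<in>Hom Y (Fo x) z. \<phi> f + \<psi> f))) \<cdot>\<^bsub>Y\<^esub> eta z =
      (Hm (ninc NX x (Go z) (pull x z \<phi>)) \<cdot>\<^bsub>Y\<^esub> eta z) \<oplus>\<^bsub>Y\<^esub> (Hm (ninc NX x (Go z) (pull x z \<psi>)) \<cdot>\<^bsub>Y\<^esub> eta z)"
    if z: "z \<in> Obj Y" and \<phi>: "\<phi> \<in> hom_dual Y (Fo x) z" and \<psi>: "\<psi> \<in> hom_dual Y (Fo x) z" for z \<phi> \<psi>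
  proof -
    have "pull x z (\<lambda>f\<in>Hom Y (Fo x) z. \<phi> f + \<psi> f) = (\<lambda>f\<in>Hom X x (Go z). pull x z \<phi> f + pull x z \<psi> f)"
      using pull_arg[OF z] by (auto simp: pull_def)
    then show ?thesis
      using NX.ninc_add[OF x Go_obj[OF z] pull_dual[OF z \<phi>] pull_dual[OF z \<psi>]]
        H.functor_add[OF n_hom[OF z \<phi>] n_hom[OF z \<psi>]]
        F.Y.comp_add_left[OF eta_hom[OF z] H.functor_hom[OF n_hom[OF z \<phi>]] H.functor_hom[OF n_hom[OF z \<psi>]]]
      by simp
  qed
  show "Hm (ninc NX x (Go z) (pull x z (\<lambda>f\<in>Hom Y (Fo x) z. s * \<phi> f))) \<cdot>\<^bsub>Y\<^esub> eta z =
      msmul Y s (Hm (ninc NX x (Go z) (pull x z \<phi>)) \<cdot>\<^bsub>Y\<^esub> eta z)"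
    if z: "z \<in> Obj Y" and \<phi>: "\<phi> \<in> hom_dual Y (Fo x) z" for z s \<phi>
  proof -
    have "pull x z (\<lambda>f\<in>Hom Y (Fo x) z. s * \<phi> f) = (\<lambda>f\<in>Hom X x (Go z). s * pull x z \<phi> f)"
      using pull_arg[OF z] by (auto simp: pull_def)
    then show ?thesis
      using NX.ninc_smul[OF x Go_obj[OF z] pull_dual[OF z \<phi>]] H.functor_smul[OF n_hom[OF z \<phi>]]
        F.Y.comp_smul_left[OF eta_hom[OF z] H.functor_hom[OF n_hom[OF z \<phi>]]]
      by simp
  qed
  show "(Hm (ninc NX x (Go z') (pull x z' \<phi>)) \<cdot>\<^bsub>Y\<^esub> eta z') \<cdot>\<^bsub>Y\<^esub> h =
      Hm (ninc NX x (Go z) (pull x z (\<lambda>f\<in>Hom Y (Fo x) z. \<phi> (h \<cdot>\<^bsub>Y\<^esub> f)))) \<cdot>\<^bsub>Y\<^esub> eta z"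
    if h: "h \<in> Hom Y z z'" and \<phi>: "\<phi> \<in> hom_dual Y (Fo x) z'" for z z' h \<phi>
  proof -
    have z: "z \<in> Obj Y" "z' \<in> Obj Y" using h F.Y.hom_obj by blast+
    let ?n = "ninc NX x (Go z') (pull x z' \<phi>)"
    have "eps z' \<cdot>\<^bsub>Y\<^esub> Fm (Gm z z' h \<cdot>\<^bsub>X\<^esub> f) = h \<cdot>\<^bsub>Y\<^esub> (eps z \<cdot>\<^bsub>Y\<^esub> Fm f)" if f: "f \<in> Hom X x (Go z)" for f
      using eps_hom[OF z(1)] eps_hom[OF z(2)] Gm_hom[OF h] f h
        F.Y.comp_extend[OF eps_Gm[OF h], of "Fm f"] by (simp add: F.Y.hom_iff F.X.hom_iff)
    then have "(\<lambda>f\<in>Hom X x (Go z). pull x z' \<phi> (Gm z z' h \<cdot>\<^bsub>X\<^esub> f)) =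
        pull x z (\<lambda>f\<in>Hom Y (Fo x) z. \<phi> (h \<cdot>\<^bsub>Y\<^esub> f))"
      using F.X.comp_hom[OF _ Gm_hom[OF h]] pull_arg[OF z(1)] by (auto simp: pull_def)
    then have "ninc NX x (Go z) (pull x z (\<lambda>f\<in>Hom Y (Fo x) z. \<phi> (h \<cdot>\<^bsub>Y\<^esub> f))) = ?n \<cdot>\<^bsub>X\<^esub> Gm z z' h"
      using NX.ninc_nat[OF x Gm_hom[OF h] pull_dual[OF z(2) \<phi>]] by simp
    moreover have "(Hm ?n \<cdot>\<^bsub>Y\<^esub> eta z') \<cdot>\<^bsub>Y\<^esub> h = Hm (?n \<cdot>\<^bsub>X\<^esub> Gm z z' h) \<cdot>\<^bsub>Y\<^esub> eta z"
      using n_hom[OF z(2) \<phi>] Gm_hom[OF h] Gm_eta[OF h] eta_hom[OF z(1)] eta_hom[OF z(2)] h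
      by (simp add: F.Y.hom_iff F.X.hom_iff)
    ultimately show ?thesis by simp
  qed
qed

lemma
  shows comparison_hom: "nakayama_comparison X Y NX NY Fo Fm Go eps Ho Hm eta x
      \<in> Hom Y (nob NY (Fo x)) (Ho (nob NX x))"
    and comparison_ninc: "z \<in> Obj Y \<Longrightarrow> \<phi> \<in> hom_dual Y (Fo x) z \<Longrightarrow>
      nakayama_comparison X Y NX NY Fo Fm Go eps Ho Hm eta x \<cdot>\<^bsub>Y\<^esub> ninc NY (Fo x) z \<phi>
        = comparison_wedge x z \<phi>"
proof -
  have "Fo x \<in> Obj Y" "Ho (nob NX x) \<in> Obj Y" using x by simp_all
  from theI'[OF NY.nakayama_universal[OF this comparison_wedge]]
  show "nakayama_comparison X Y NX NY Fo Fm Go eps Ho Hm eta x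
      \<in> Hom Y (nob NY (Fo x)) (Ho (nob NX x))"
    and "z \<in> Obj Y \<Longrightarrow> \<phi> \<in> hom_dual Y (Fo x) z \<Longrightarrow>
      nakayama_comparison X Y NX NY Fo Fm Go eps Ho Hm eta x \<cdot>\<^bsub>Y\<^esub> ninc NY (Fo x) z \<phi>
        = comparison_wedge x z \<phi>"
    unfolding nakayama_comparison_def comparison_wedge_def pull_def by blast+
qed

text \<open>As a left adjoint, \<open>H\<close> preserves the coend \<open>N\<^sub>X(x)\<close>.\<close>

lemma H_coend_ext:
  assumes "r \<in> Hom Y (Ho (nob NX x)) z" "r' \<in> Hom Y (Ho (nob NX x)) z"
    and eq: "\<And>c \<phi>. c \<in> Obj X \<Longrightarrow> \<phi> \<in> hom_dual X x c \<Longrightarrow>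
      r \<cdot>\<^bsub>Y\<^esub> Hm (ninc NX x c \<phi>) = r' \<cdot>\<^bsub>Y\<^esub> Hm (ninc NX x c \<phi>)"
  shows "r = r'"
proof -
  note [simp] = F.X.hom_iff F.Y.hom_iff
  have z: "z \<in> Obj Y" using assms(1) F.Y.hom_obj by blast
  have n: "nob NX x \<in> Obj X" using x by simp
  \<comment> \<open>The coend property of \<open>nob NX x\<close> concerns morphisms in
    \<open>X\<close>, so \<open>r\<close> and \<open>r'\<close> are compared after transposition
    along \<open>H \<stileturn> K\<close>.\<close>
  let ?t = "del_tr (nob NX x) z"
  have "?t r = ?t r'"
  proof (rule NX.nakayama_ext[OF x del_tr_hom[OF n assms(1)] del_tr_hom[OF n assms(2)]])
    fix c \<phi> assume c: "c \<in> Obj X" "\<phi> \<in> hom_dual X x c"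
    note * = NX.ninc_hom[OF x c] del_hom[OF z] del_tr_hom[OF n assms(1)] del_tr_hom[OF n assms(2)]
    have "del z \<cdot>\<^bsub>Y\<^esub> Hm (?t r \<cdot>\<^bsub>X\<^esub> ninc NX x c \<phi>) = r \<cdot>\<^bsub>Y\<^esub> Hm (ninc NX x c \<phi>)"
      "del z \<cdot>\<^bsub>Y\<^esub> Hm (?t r' \<cdot>\<^bsub>X\<^esub> ninc NX x c \<phi>) = r' \<cdot>\<^bsub>Y\<^esub> Hm (ninc NX x c \<phi>)"
      using * F.Y.comp_extend[OF del_tr[OF n assms(1)], of "Hm (ninc NX x c \<phi>)"]
        F.Y.comp_extend[OF del_tr[OF n assms(2)], of "Hm (ninc NX x c \<phi>)"] by simp_all
    then show "?t r \<cdot>\<^bsub>X\<^esub> ninc NX x c \<phi> = ?t r' \<cdot>\<^bsub>X\<^esub> ninc NX x c \<phi>"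
      using * eq[OF c] by (intro del_ext[OF z]) simp_all
  qed
  then show ?thesis using del_tr[OF n assms(1)] del_tr[OF n assms(2)] by metis
qed

text \<open>The inverse of the comparison morphism is induced by the family \<open>ninc (F x) (H c)\<close> along
  \<open>Hom(x,c)\<^sup>* \<rightarrow> Hom(F x, H c)\<^sup>*\<close>.\<close>

lemma ex_comparison_inverse:
  obtains \<chi> where "\<chi> \<in> Hom Y (Ho (nob NX x)) (nob NY (Fo x))"
    and "\<And>c \<phi>. c \<in> Obj X \<Longrightarrow> \<phi> \<in> hom_dual X x c \<Longrightarrow>
      \<chi> \<cdot>\<^bsub>Y\<^esub> Hm (ninc NX x c \<phi>) = ninc NY (Fo x) (Ho c) (push x c \<phi>)"
proof -
  define z where "z = nob NY (Fo x)"
  define k where "k c \<phi> = ninc NY (Fo x) (Ho c) (push x c \<phi>)" for c \<phi>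
  have Fx: "Fo x \<in> Obj Y" using x by simp
  have z: "z \<in> Obj Y" using x z_def by simp
  have k_hom: "k c \<phi> \<in> Hom Y (Ho c) z" if "c \<in> Obj X" "\<phi> \<in> hom_dual X x c" for c \<phi>
    using NY.ninc_hom[OF Fx _ push_dual] that by (simp add: k_def z_def)
  \<comment> \<open>The universal property is available for \<open>nob NX x\<close>, not for its
    image under \<open>Ho\<close>; the family \<open>k\<close> is therefore transposed into a wedge
    in \<open>X\<close> ending at \<open>Ko z\<close>.\<close>
  have wedge: "nakayama_wedge X x (Ko z) (\<lambda>c \<phi>. del_tr c z (k c \<phi>))"
    unfolding nakayama_wedge_def
  proof (intro conjI ballI allI)
    show "del_tr c z (k c \<phi>) \<in> Hom X c (Ko z)" if "c \<in> Obj X" "\<phi> \<in> hom_dual X x c" for c \<phi>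
      using del_tr_hom k_hom that by blast
    show "del_tr c z (k c (\<lambda>f\<in>Hom X x c. \<phi> f + \<psi> f)) = del_tr c z (k c \<phi>) \<oplus>\<^bsub>X\<^esub> del_tr c z (k c \<psi>)"
      if c: "c \<in> Obj X" and \<phi>: "\<phi> \<in> hom_dual X x c" and \<psi>: "\<psi> \<in> hom_dual X x c" for c \<phi> \<psi>
    proof -
      have "push x c (\<lambda>f\<in>Hom X x c. \<phi> f + \<psi> f) = (\<lambda>f\<in>Hom Y (Fo x) (Ho c). push x c \<phi> f + push x c \<psi> f)"
        using push_arg[OF c] by (auto simp: push_def)
      then show ?thesis
        using NY.ninc_add[OF Fx _ push_dual[OF c \<phi>] push_dual[OF c \<psi>]] c
          del_tr_add[OF c k_hom[OF c \<phi>] k_hom[OF c \<psi>]] by (simp add: k_def)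
    qed
    show "del_tr c z (k c (\<lambda>f\<in>Hom X x c. s * \<phi> f)) = msmul X s (del_tr c z (k c \<phi>))"
      if c: "c \<in> Obj X" and \<phi>: "\<phi> \<in> hom_dual X x c" for c s \<phi>
    proof -
      have "push x c (\<lambda>f\<in>Hom X x c. s * \<phi> f) = (\<lambda>f\<in>Hom Y (Fo x) (Ho c). s * push x c \<phi> f)"
        using push_arg[OF c] by (auto simp: push_def)
      then show ?thesis
        using NY.ninc_smul[OF Fx _ push_dual[OF c \<phi>]] c
          del_tr_smul[OF c k_hom[OF c \<phi>]] by (simp add: k_def)
    qed
    show "del_tr c' z (k c' \<phi>) \<cdot>\<^bsub>X\<^esub> t = del_tr c z (k c (\<lambda>f\<in>Hom X x c. \<phi> (t \<cdot>\<^bsub>X\<^esub> f)))"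
      if t: "t \<in> Hom X c c'" and \<phi>: "\<phi> \<in> hom_dual X x c'" for c c' t \<phi>
    proof (rule del_ext[OF z])
      have c: "c \<in> Obj X" "c' \<in> Obj X" using t F.X.hom_obj by blast+
      let ?\<phi> = "\<lambda>f\<in>Hom X x c. \<phi> (t \<cdot>\<^bsub>X\<^esub> f)"
      have \<phi>': "?\<phi> \<in> hom_dual X x c"
        using \<phi> F.X.comp_hom[OF _ t] F.X.add_hom F.X.smul_hom F.X.comp_add_right[OF _ _ t]
          F.X.comp_smul_right[OF _ t] unfolding hom_dual_def by simp
      note * = k_hom[OF c(2) \<phi>] k_hom[OF c(1) \<phi>']
      note ** = del_tr_hom[OF c(2) *(1)] del_tr_hom[OF c(1) *(2)]
      show "del_tr c' z (k c' \<phi>) \<cdot>\<^bsub>X\<^esub> t \<in> Hom X c (Ko z)" using F.X.comp_hom[OF t **(1)] .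
      show "del_tr c z (k c ?\<phi>) \<in> Hom X c (Ko z)" using **(2) .
      \<comment> \<open>Through \<open>push\<close>, dinaturality of \<open>k\<close> comes down to
        naturality of \<open>eps_tr\<close> in its target and of the counit
        \<open>theta\<close>.\<close>
      have "theta c' \<cdot>\<^bsub>X\<^esub> eps_tr x (Ho c') (Hm t \<cdot>\<^bsub>Y\<^esub> h) = t \<cdot>\<^bsub>X\<^esub> (theta c \<cdot>\<^bsub>X\<^esub> eps_tr x (Ho c) h)"
        if h: "h \<in> Hom Y (Fo x) (Ho c)" for h
        unfolding eps_tr_comp[OF H.functor_hom[OF t] x h]
        using F.X.comp_extend[OF theta_nat[OF t], of "eps_tr x (Ho c) h"]
          eps_tr_hom[OF x h] t theta_hom[OF c(1)] theta_hom[OF c(2)] Gm_hom[OF H.functor_hom[OF t]]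
        by (simp add: F.X.hom_iff)
      then have "(\<lambda>h\<in>Hom Y (Fo x) (Ho c). push x c' \<phi> (Hm t \<cdot>\<^bsub>Y\<^esub> h)) = push x c ?\<phi>"
        using F.Y.comp_hom[OF _ H.functor_hom[OF t]] push_arg[OF c(1)] by (auto simp: push_def)
      then have "k c' \<phi> \<cdot>\<^bsub>Y\<^esub> Hm t = k c ?\<phi>"
        unfolding k_def using NY.ninc_nat[OF Fx H.functor_hom[OF t] push_dual[OF c(2) \<phi>]] by simp
      then show "del z \<cdot>\<^bsub>Y\<^esub> Hm (del_tr c' z (k c' \<phi>) \<cdot>\<^bsub>X\<^esub> t) = del z \<cdot>\<^bsub>Y\<^esub> Hm (del_tr c z (k c ?\<phi>))"
        using F.Y.comp_extend[OF del_tr[OF c(2) *(1)], of "Hm t"] ** del_hom[OF z] t del_tr[OF c(1) *(2)]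
        by (simp add: F.X.hom_iff F.Y.hom_iff)
    qed
  qed
  obtain g where g: "g \<in> Hom X (nob NX x) (Ko z)"
    and g_ninc: "\<And>c \<phi>. c \<in> Obj X \<Longrightarrow> \<phi> \<in> hom_dual X x c \<Longrightarrow> g \<cdot>\<^bsub>X\<^esub> ninc NX x c \<phi> = del_tr c z (k c \<phi>)"
    using NX.nakayama_universal[OF x Ko_obj[OF z] wedge] by blast
  \<comment> \<open>Transposing \<open>g\<close> back along \<open>H \<stileturn> K\<close> gives
    the wanted morphism.\<close>
  show thesis
  proof (rule that[unfolded z_def[symmetric] k_def[symmetric]])
    show "del z \<cdot>\<^bsub>Y\<^esub> Hm g \<in> Hom Y (Ho (nob NX x)) z"
      using F.Y.comp_hom[OF H.functor_hom[OF g] del_hom[OF z]] .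
    fix c \<phi> assume c: "c \<in> Obj X" "\<phi> \<in> hom_dual X x c"
    show "(del z \<cdot>\<^bsub>Y\<^esub> Hm g) \<cdot>\<^bsub>Y\<^esub> Hm (ninc NX x c \<phi>) = k c \<phi>"
      using del_tr[OF c(1) k_hom[OF c]] g_ninc[OF c, symmetric] g NX.ninc_hom[OF x c] del_hom[OF z]
      by (simp add: F.X.hom_iff F.Y.hom_iff)
  qed
qed

text \<open>Both composites are tested on the families generating the two coends. There they become
  composites of \<open>pull\<close> and \<open>push\<close> with \<open>eta\<close>, in the two
  possible orders, and each collapses by one triangle identity of
  \<open>G \<stileturn> H\<close>.\<close>

theorem comparison_iso:
  "is_iso Y (nob NY (Fo x)) (Ho (nob NX x)) (nakayama_comparison X Y NX NY Fo Fm Go eps Ho Hm eta x)"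
proof -
  note [simp] = F.X.hom_iff F.Y.hom_iff
  define \<psi> where "\<psi> = nakayama_comparison X Y NX NY Fo Fm Go eps Ho Hm eta x"
  have Fx: "Fo x \<in> Obj Y" using x by simp
  have \<psi>: "\<psi> \<in> Hom Y (nob NY (Fo x)) (Ho (nob NX x))"
    and \<psi>_ninc: "\<And>z \<phi>. z \<in> Obj Y \<Longrightarrow> \<phi> \<in> hom_dual Y (Fo x) z \<Longrightarrow>
      \<psi> \<cdot>\<^bsub>Y\<^esub> ninc NY (Fo x) z \<phi> = Hm (ninc NX x (Go z) (pull x z \<phi>)) \<cdot>\<^bsub>Y\<^esub> eta z"
    unfolding \<psi>_def using comparison_hom comparison_ninc comparison_wedge_def by auto
  obtain \<chi> where \<chi>: "\<chi> \<in> Hom Y (Ho (nob NX x)) (nob NY (Fo x))"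
    and \<chi>_ninc: "\<And>c \<phi>. c \<in> Obj X \<Longrightarrow> \<phi> \<in> hom_dual X x c \<Longrightarrow>
      \<chi> \<cdot>\<^bsub>Y\<^esub> Hm (ninc NX x c \<phi>) = ninc NY (Fo x) (Ho c) (push x c \<phi>)"
    using ex_comparison_inverse by blast
  have "\<chi> \<cdot>\<^bsub>Y\<^esub> \<psi> = ide Y (nob NY (Fo x))"
  proof (rule NY.nakayama_ext[OF Fx])
    show "\<chi> \<cdot>\<^bsub>Y\<^esub> \<psi> \<in> Hom Y (nob NY (Fo x)) (nob NY (Fo x))" using \<chi> \<psi> by simp
    show "ide Y (nob NY (Fo x)) \<in> Hom Y (nob NY (Fo x)) (nob NY (Fo x))" using x by simp
    fix z \<phi> assume z: "z \<in> Obj Y" and \<phi>: "\<phi> \<in> hom_dual Y (Fo x) z"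
    let ?n = "ninc NX x (Go z) (pull x z \<phi>)"
    have n: "?n \<in> Hom X (Go z) (nob NX x)" using NX.ninc_hom[OF x Go_obj[OF z] pull_dual[OF z \<phi>]] .
    note m = NY.ninc_hom[OF Fx z \<phi>]
    have "(\<chi> \<cdot>\<^bsub>Y\<^esub> \<psi>) \<cdot>\<^bsub>Y\<^esub> ninc NY (Fo x) z \<phi> = \<chi> \<cdot>\<^bsub>Y\<^esub> (Hm ?n \<cdot>\<^bsub>Y\<^esub> eta z)"
      using \<chi> \<psi> m \<psi>_ninc[OF z \<phi>] by simp
    also have "\<dots> = ninc NY (Fo x) (Ho (Go z)) (push x (Go z) (pull x z \<phi>)) \<cdot>\<^bsub>Y\<^esub> eta z"
      using F.Y.comp_extend[OF \<chi>_ninc[OF Go_obj[OF z] pull_dual[OF z \<phi>]], of "eta z"] \<chi> n eta_hom[OF z]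
      by simp
    also have "\<dots> = ninc NY (Fo x) z
        (\<lambda>h\<in>Hom Y (Fo x) z. push x (Go z) (pull x z \<phi>) (eta z \<cdot>\<^bsub>Y\<^esub> h))"
      by (rule NY.ninc_nat[OF Fx eta_hom[OF z] push_dual[OF Go_obj[OF z] pull_dual[OF z \<phi>]]])
    also have "(\<lambda>h\<in>Hom Y (Fo x) z. push x (Go z) (pull x z \<phi>) (eta z \<cdot>\<^bsub>Y\<^esub> h)) = \<phi>"
    proof -
      have "push x (Go z) (pull x z \<phi>) (eta z \<cdot>\<^bsub>Y\<^esub> h) = \<phi> h" if h: "h \<in> Hom Y (Fo x) z" for h
      proof -
        \<comment> \<open>The triangle identity removes \<open>theta\<close> and \<open>eta\<close>
          and leaves the transpose of \<open>h\<close>, which \<open>pull\<close> turns back into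
          \<open>h\<close>.\<close>
        have "theta (Go z) \<cdot>\<^bsub>X\<^esub> eps_tr x (Ho (Go z)) (eta z \<cdot>\<^bsub>Y\<^esub> h) = eps_tr x z h"
          unfolding eps_tr_comp[OF eta_hom[OF z] x h]
          using F.X.comp_extend[OF theta_Gm_eta[OF z], of "eps_tr x z h"] eps_tr_hom[OF x h]
            theta_hom[OF Go_obj[OF z]] Gm_hom[OF eta_hom[OF z]] by simp
        then show ?thesis
          using h eta_hom[OF z] eps_tr_hom[OF x h] eps_tr[OF x h] z by (simp add: push_def pull_def)
      qed
      then show ?thesis using \<phi> by (auto simp: hom_dual_def extensional_def fun_eq_iff restrict_def
            simp del: F.Y.hom_iff)
    qed
    finally show "(\<chi> \<cdot>\<^bsub>Y\<^esub> \<psi>) \<cdot>\<^bsub>Y\<^esub> ninc NY (Fo x) z \<phi> = ide Y (nob NY (Fo x)) \<cdot>\<^bsub>Y\<^esub> ninc NY (Fo x) z \<phi>"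
      using m by simp
  qed
  moreover have "\<psi> \<cdot>\<^bsub>Y\<^esub> \<chi> = ide Y (Ho (nob NX x))"
  proof (rule H_coend_ext)
    show "\<psi> \<cdot>\<^bsub>Y\<^esub> \<chi> \<in> Hom Y (Ho (nob NX x)) (Ho (nob NX x))" using \<chi> \<psi> by simp
    show "ide Y (Ho (nob NX x)) \<in> Hom Y (Ho (nob NX x)) (Ho (nob NX x))" using x by simp
    fix c \<phi> assume c: "c \<in> Obj X" and \<phi>: "\<phi> \<in> hom_dual X x c"
    note n = NX.ninc_hom[OF x c \<phi>]
    have Hc: "Ho c \<in> Obj Y" using c by simp
    have "(\<psi> \<cdot>\<^bsub>Y\<^esub> \<chi>) \<cdot>\<^bsub>Y\<^esub> Hm (ninc NX x c \<phi>) = \<psi> \<cdot>\<^bsub>Y\<^esub> ninc NY (Fo x) (Ho c) (push x c \<phi>)"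
      using \<chi> \<psi> n \<chi>_ninc[OF c \<phi>] by simp
    also have "\<dots> = Hm (ninc NX x (Go (Ho c)) (pull x (Ho c) (push x c \<phi>))) \<cdot>\<^bsub>Y\<^esub> eta (Ho c)"
      by (rule \<psi>_ninc[OF Hc push_dual[OF c \<phi>]])
    \<comment> \<open>Transposing back and forth cancels, so only composition with
      \<open>theta c\<close> remains; dinaturality moves it out of the functional, where it meets
      \<open>eta (Ho c)\<close>.\<close>
    also have "pull x (Ho c) (push x c \<phi>) = (\<lambda>h\<in>Hom X x (Go (Ho c)). \<phi> (theta c \<cdot>\<^bsub>X\<^esub> h))"
    proof -
      have "push x c \<phi> (eps (Ho c) \<cdot>\<^bsub>Y\<^esub> Fm h) = \<phi> (theta c \<cdot>\<^bsub>X\<^esub> h)" if h: "h \<in> Hom X x (Go (Ho c))" for h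
        using pull_arg[OF Hc h] eps_tr_unique[OF Hc h refl] by (simp add: push_def)
      then show ?thesis by (auto simp: pull_def fun_eq_iff restrict_def simp del: F.X.hom_iff)
    qed
    also have "ninc NX x (Go (Ho c)) \<dots> = ninc NX x c \<phi> \<cdot>\<^bsub>X\<^esub> theta c"
      by (rule NX.ninc_nat[OF x theta_hom[OF c] \<phi>, symmetric])
    also have "Hm \<dots> \<cdot>\<^bsub>Y\<^esub> eta (Ho c) = ide Y (Ho (nob NX x)) \<cdot>\<^bsub>Y\<^esub> Hm (ninc NX x c \<phi>)"
      using n theta_hom[OF c] eta_hom[OF Hc] theta_eta[OF c] x by simp
    finally show "(\<psi> \<cdot>\<^bsub>Y\<^esub> \<chi>) \<cdot>\<^bsub>Y\<^esub> Hm (ninc NX x c \<phi>) = ide Y (Ho (nob NX x)) \<cdot>\<^bsub>Y\<^esub> Hm (ninc NX x c \<phi>)" .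
  qed
  ultimately show ?thesis
    unfolding \<psi>_def[symmetric] by (rule F.Y.is_isoI[OF \<psi> \<chi>])
qed

end

end

section \<open>Monoidal categories and their modules\<close>

text \<open>The axioms are chosen so that \<open>rev_tensor C\<close> is again an instance: linear
  structure and coherence, with duality supplied separately as \<open>dual_pair\<close> where it
  enters.\<close>

locale linear_monoidal_category = linear_category C
  for C :: "('o, 'm, 'k::field) tencat" (structure) +
  assumes tensor: "bilinear_bifunctor C C C (ten C) (tenm C)"
    and assoc_iso: "a \<in> Obj C \<Longrightarrow> b \<in> Obj C \<Longrightarrow> c \<in> Obj C
          \<Longrightarrow> is_iso C ((a \<otimes> b) \<otimes> c) (a \<otimes> (b \<otimes> c)) (assoc C a b c)"
    and assoc_nat: "f \<in> Hom C a a' \<Longrightarrow> g \<in> Hom C b b' \<Longrightarrow> h \<in> Hom C c c'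
          \<Longrightarrow> assoc C a' b' c' \<cdot> ((f \<boxtimes> g) \<boxtimes> h) = (f \<boxtimes> (g \<boxtimes> h)) \<cdot> assoc C a b c"
    and lunit_iso: "a \<in> Obj C \<Longrightarrow> is_iso C (\<one> \<otimes> a) a (lunit C a)"
    and lunit_nat: "f \<in> Hom C a b \<Longrightarrow> lunit C b \<cdot> (ide C \<one> \<boxtimes> f) = f \<cdot> lunit C a"
    and runit_iso: "a \<in> Obj C \<Longrightarrow> is_iso C (a \<otimes> \<one>) a (runit C a)"
    and runit_nat: "f \<in> Hom C a b \<Longrightarrow> runit C b \<cdot> (f \<boxtimes> ide C \<one>) = f \<cdot> runit C a"
    and pentagon: "a \<in> Obj C \<Longrightarrow> b \<in> Obj C \<Longrightarrow> c \<in> Obj C \<Longrightarrow> d \<in> Obj C \<Longrightarrow>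
          assoc C a b (c \<otimes> d) \<cdot> assoc C (a \<otimes> b) c d =
          (ide C a \<boxtimes> assoc C b c d) \<cdot> assoc C a (b \<otimes> c) d \<cdot> (assoc C a b c \<boxtimes> ide C d)"
    and triangle: "a \<in> Obj C \<Longrightarrow> b \<in> Obj C \<Longrightarrow>
          (ide C a \<boxtimes> lunit C b) \<cdot> assoc C a \<one> b = runit C a \<boxtimes> ide C b"
    and one_obj [simp]: "\<one> \<in> Obj C"
begin

sublocale ten: linear_bifunctor C C C "ten C" "tenm C"
  by unfold_locales (rule tensor)

lemma
  assumes "a \<in> Obj C" "b \<in> Obj C" "c \<in> Obj C"
  shows invertible_assoc [simp]: "invertible C (assoc C a b c)"
    and src_assoc [simp]: "src C (assoc C a b c) = (a \<otimes> b) \<otimes> c"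
    and tgt_assoc [simp]: "tgt C (assoc C a b c) = a \<otimes> (b \<otimes> c)"
  using assoc_iso[OF assms] by (auto simp: is_iso_iff)

lemma
  assumes "a \<in> Obj C"
  shows invertible_lunit [simp]: "invertible C (lunit C a)"
    and src_lunit [simp]: "src C (lunit C a) = \<one> \<otimes> a"
    and tgt_lunit [simp]: "tgt C (lunit C a) = a"
    and invertible_runit [simp]: "invertible C (runit C a)"
    and src_runit [simp]: "src C (runit C a) = a \<otimes> \<one>"
    and tgt_runit [simp]: "tgt C (runit C a) = a"
  using lunit_iso[OF assms] runit_iso[OF assms] by (auto simp: is_iso_iff)

end

lemma (in finite_tensor_category) linear_monoidal: "linear_monoidal_category C"
  by unfold_locales (use tensor assoc_iso assoc_nat lunit_iso lunit_nat runit_iso runit_nat pentagon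
      triangle unit_simple in \<open>simp_all add: simple_def\<close>)

text \<open>\<open>L\<close> may carry further record fields, so a monoidal category can be taken as
  a module over itself; lemmas on actions then yield statements on tensor products.\<close>

locale linear_module_category =
  C: linear_monoidal_category C + L: linear_category L
  for C :: "('oc, 'mc, 'k::field) tencat" and L :: "('ol, 'ml, 'k, 'z) lincat_scheme" +
  fixes M :: "('oc, 'mc, 'ol, 'ml) action" (structure)
  assumes action: "bilinear_bifunctor C L L (act M) (actm M)"
    and massoc_iso: "a \<in> Obj C \<Longrightarrow> b \<in> Obj C \<Longrightarrow> y \<in> Obj L
          \<Longrightarrow> is_iso L ((a \<otimes>\<^bsub>C\<^esub> b) \<rhd> y) (a \<rhd> (b \<rhd> y)) (massoc M a b y)"
    and massoc_nat: "f \<in> Hom C a a' \<Longrightarrow> g \<in> Hom C b b' \<Longrightarrow> h \<in> Hom L y y'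
          \<Longrightarrow> massoc M a' b' y' \<cdot>\<^bsub>L\<^esub> ((f \<boxtimes>\<^bsub>C\<^esub> g) \<unrhd> h) = (f \<unrhd> (g \<unrhd> h)) \<cdot>\<^bsub>L\<^esub> massoc M a b y"
    and munit_iso: "y \<in> Obj L \<Longrightarrow> is_iso L (\<one>\<^bsub>C\<^esub> \<rhd> y) y (munit M y)"
    and munit_nat: "h \<in> Hom L y y' \<Longrightarrow> munit M y' \<cdot>\<^bsub>L\<^esub> (ide C \<one>\<^bsub>C\<^esub> \<unrhd> h) = h \<cdot>\<^bsub>L\<^esub> munit M y"
    and mpentagon: "a \<in> Obj C \<Longrightarrow> b \<in> Obj C \<Longrightarrow> c \<in> Obj C \<Longrightarrow> y \<in> Obj L \<Longrightarrow>
          massoc M a b (c \<rhd> y) \<cdot>\<^bsub>L\<^esub> massoc M (a \<otimes>\<^bsub>C\<^esub> b) c y =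
          (ide C a \<unrhd> massoc M b c y) \<cdot>\<^bsub>L\<^esub> massoc M a (b \<otimes>\<^bsub>C\<^esub> c) y \<cdot>\<^bsub>L\<^esub> (assoc C a b c \<unrhd> ide L y)"
    and mtriangle: "a \<in> Obj C \<Longrightarrow> y \<in> Obj L \<Longrightarrow>
          (ide C a \<unrhd> munit M y) \<cdot>\<^bsub>L\<^esub> massoc M a \<one>\<^bsub>C\<^esub> y = runit C a \<unrhd> ide L y"
begin

sublocale act: linear_bifunctor C L L "act M" "actm M"
  by unfold_locales (rule action)

lemma
  assumes "a \<in> Obj C" "b \<in> Obj C" "y \<in> Obj L"
  shows invertible_massoc [simp]: "invertible L (massoc M a b y)"
    and src_massoc [simp]: "src L (massoc M a b y) = (a \<otimes>\<^bsub>C\<^esub> b) \<rhd> y"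
    and tgt_massoc [simp]: "tgt L (massoc M a b y) = a \<rhd> (b \<rhd> y)"
  using massoc_iso[OF assms] by (auto simp: L.is_iso_iff)

lemma
  assumes "y \<in> Obj L"
  shows invertible_munit [simp]: "invertible L (munit M y)"
    and src_munit [simp]: "src L (munit M y) = \<one>\<^bsub>C\<^esub> \<rhd> y"
    and tgt_munit [simp]: "tgt L (munit M y) = y"
  using munit_iso[OF assms] by (auto simp: L.is_iso_iff)

section \<open>Naturality and unit coherence of actions\<close>

lemma massoc_natural:
  assumes "arrow C f" "arrow C g" "arrow L h"
  shows "massoc M (tgt C f) (tgt C g) (tgt L h) \<cdot>\<^bsub>L\<^esub> ((f \<boxtimes>\<^bsub>C\<^esub> g) \<unrhd> h)
    = (f \<unrhd> (g \<unrhd> h)) \<cdot>\<^bsub>L\<^esub> massoc M (src C f) (src C g) (src L h)"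
  using massoc_nat assms C.arrow_hom L.arrow_hom by blast

lemma munit_natural:
  "arrow L h \<Longrightarrow> munit M (tgt L h) \<cdot>\<^bsub>L\<^esub> (ide C \<one>\<^bsub>C\<^esub> \<unrhd> h) = h \<cdot>\<^bsub>L\<^esub> munit M (src L h)"
  using munit_nat L.arrow_hom by blast

lemma minv_munit_natural:
  assumes h: "arrow L h"
  shows "minv L (munit M (tgt L h)) \<cdot>\<^bsub>L\<^esub> h = (ide C \<one>\<^bsub>C\<^esub> \<unrhd> h) \<cdot>\<^bsub>L\<^esub> minv L (munit M (src L h))"
proof (rule L.invertible_cancel_right[where f = "munit M (src L h)"])
  show "(minv L (munit M (tgt L h)) \<cdot>\<^bsub>L\<^esub> h) \<cdot>\<^bsub>L\<^esub> munit M (src L h) =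
    ((ide C \<one>\<^bsub>C\<^esub> \<unrhd> h) \<cdot>\<^bsub>L\<^esub> minv L (munit M (src L h))) \<cdot>\<^bsub>L\<^esub> munit M (src L h)"
    using h munit_natural[OF h, symmetric] by simp
qed (use h in simp_all)

text \<open>The traces insert \<open>u\<close> together with a trivialization \<open>h\<close>, the
  Radford composite inserts \<open>u\<close> alone at the target of \<open>h\<close>. Naturality of
  the unit constraint reconciles the two forms.\<close>

lemma act_minv_munit:
  assumes "arrow C u" "src C u = \<one>\<^bsub>C\<^esub>" "arrow L h"
  shows "(u \<unrhd> h) \<cdot>\<^bsub>L\<^esub> minv L (munit M (src L h)) = (u \<unrhd> ide L (tgt L h)) \<cdot>\<^bsub>L\<^esub> minv L (munit M (tgt L h)) \<cdot>\<^bsub>L\<^esub> h"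
  using assms by (simp add: minv_munit_natural act.interchange_extend)

text \<open>The functor \<open>1 \<rhd> -\<close> is isomorphic to the identity through
  \<open>munit\<close>, hence faithful.\<close>

lemma ide_one_act_cancel:
  assumes f: "arrow L f" and g: "arrow L g" and "src L f = src L g" "tgt L f = tgt L g"
    and "ide C \<one>\<^bsub>C\<^esub> \<unrhd> f = ide C \<one>\<^bsub>C\<^esub> \<unrhd> g"
  shows "f = g"
proof (rule L.invertible_cancel_right[where f = "munit M (src L f)"])
  show "f \<cdot>\<^bsub>L\<^esub> munit M (src L f) = g \<cdot>\<^bsub>L\<^esub> munit M (src L f)"
    using munit_natural[OF f] munit_natural[OF g] assms(3-5) by metis
qed (use assms in simp_all)

text \<open>Kelly's argument: as \<open>1 \<rhd> -\<close> is faithful, the equation may be checked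
  after acting with the unit object, where the pentagon and the triangles of the action and of
  \<open>C\<close> apply.\<close>

lemma munit_massoc:
  assumes c: "c \<in> Obj C" and z: "z \<in> Obj L"
  shows "munit M (c \<rhd> z) \<cdot>\<^bsub>L\<^esub> massoc M \<one>\<^bsub>C\<^esub> c z = lunit C c \<unrhd> ide L z"
proof (rule ide_one_act_cancel)
  \<comment> \<open>Precomposition with this isomorphism exposes one side of the pentagon for
    \<open>1\<close>, \<open>1\<close>, \<open>c\<close>.\<close>
  let ?q = "massoc M \<one>\<^bsub>C\<^esub> (\<one>\<^bsub>C\<^esub> \<otimes>\<^bsub>C\<^esub> c) z \<cdot>\<^bsub>L\<^esub> (assoc C \<one>\<^bsub>C\<^esub> \<one>\<^bsub>C\<^esub> c \<unrhd> ide L z)"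
  show "ide C \<one>\<^bsub>C\<^esub> \<unrhd> (munit M (c \<rhd> z) \<cdot>\<^bsub>L\<^esub> massoc M \<one>\<^bsub>C\<^esub> c z) = ide C \<one>\<^bsub>C\<^esub> \<unrhd> (lunit C c \<unrhd> ide L z)"
  proof (rule L.invertible_cancel_right[where f = ?q])
    have "(ide C \<one>\<^bsub>C\<^esub> \<unrhd> (munit M (c \<rhd> z) \<cdot>\<^bsub>L\<^esub> massoc M \<one>\<^bsub>C\<^esub> c z)) \<cdot>\<^bsub>L\<^esub> ?q
        = (ide C \<one>\<^bsub>C\<^esub> \<unrhd> munit M (c \<rhd> z)) \<cdot>\<^bsub>L\<^esub> massoc M \<one>\<^bsub>C\<^esub> \<one>\<^bsub>C\<^esub> (c \<rhd> z) \<cdot>\<^bsub>L\<^esub> massoc M (\<one>\<^bsub>C\<^esub> \<otimes>\<^bsub>C\<^esub> \<one>\<^bsub>C\<^esub>) c z"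
      using c z by (simp add: mpentagon act.bifun_comp_right)
    also have "\<dots> = (runit C \<one>\<^bsub>C\<^esub> \<unrhd> (ide C c \<unrhd> ide L z)) \<cdot>\<^bsub>L\<^esub> massoc M (\<one>\<^bsub>C\<^esub> \<otimes>\<^bsub>C\<^esub> \<one>\<^bsub>C\<^esub>) c z"
      using c z L.comp_extend[OF mtriangle[of "\<one>\<^bsub>C\<^esub>" "c \<rhd> z"]] by simp
    also have "\<dots> = massoc M \<one>\<^bsub>C\<^esub> c z \<cdot>\<^bsub>L\<^esub> ((runit C \<one>\<^bsub>C\<^esub> \<boxtimes>\<^bsub>C\<^esub> ide C c) \<unrhd> ide L z)"
      using c z massoc_natural[of "runit C \<one>\<^bsub>C\<^esub>" "ide C c" "ide L z"] by simp
    also have "\<dots> = massoc M \<one>\<^bsub>C\<^esub> c z \<cdot>\<^bsub>L\<^esub> ((ide C \<one>\<^bsub>C\<^esub> \<boxtimes>\<^bsub>C\<^esub> lunit C c) \<unrhd> ide L z)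
        \<cdot>\<^bsub>L\<^esub> (assoc C \<one>\<^bsub>C\<^esub> \<one>\<^bsub>C\<^esub> c \<unrhd> ide L z)"
      using c z by (simp add: C.triangle[symmetric] act.bifun_comp_left)
    also have "\<dots> = (ide C \<one>\<^bsub>C\<^esub> \<unrhd> (lunit C c \<unrhd> ide L z)) \<cdot>\<^bsub>L\<^esub> ?q"
      using c z L.comp_extend[OF massoc_natural[of "ide C \<one>\<^bsub>C\<^esub>" "lunit C c" "ide L z"]] by simp
    finally show "(ide C \<one>\<^bsub>C\<^esub> \<unrhd> (munit M (c \<rhd> z) \<cdot>\<^bsub>L\<^esub> massoc M \<one>\<^bsub>C\<^esub> c z)) \<cdot>\<^bsub>L\<^esub> ?q
        = (ide C \<one>\<^bsub>C\<^esub> \<unrhd> (lunit C c \<unrhd> ide L z)) \<cdot>\<^bsub>L\<^esub> ?q" .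
  qed (use c z in simp_all)
qed (use c z in simp_all)

lemma mpentagon_minv:
  assumes "a \<in> Obj C" "b \<in> Obj C" "c \<in> Obj C" "y \<in> Obj L"
  shows "(ide C a \<unrhd> massoc M b c y) \<cdot>\<^bsub>L\<^esub> massoc M a (b \<otimes>\<^bsub>C\<^esub> c) y =
    massoc M a b (c \<rhd> y) \<cdot>\<^bsub>L\<^esub> massoc M (a \<otimes>\<^bsub>C\<^esub> b) c y \<cdot>\<^bsub>L\<^esub> (minv C (assoc C a b c) \<unrhd> ide L y)"
proof (rule L.invertible_cancel_right[where f = "assoc C a b c \<unrhd> ide L y"])
  show "((ide C a \<unrhd> massoc M b c y) \<cdot>\<^bsub>L\<^esub> massoc M a (b \<otimes>\<^bsub>C\<^esub> c) y) \<cdot>\<^bsub>L\<^esub> (assoc C a b c \<unrhd> ide L y) =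
    (massoc M a b (c \<rhd> y) \<cdot>\<^bsub>L\<^esub> massoc M (a \<otimes>\<^bsub>C\<^esub> b) c y \<cdot>\<^bsub>L\<^esub> (minv C (assoc C a b c) \<unrhd> ide L y))
      \<cdot>\<^bsub>L\<^esub> (assoc C a b c \<unrhd> ide L y)"
    using assms by (simp add: mpentagon act.interchange)
qed (use assms in simp_all)

section \<open>The adjunction between the actions of dual objects\<close>

context
  fixes d a ev coev
  assumes a [simp]: "a \<in> Obj C" and dual: "dual_pair C d a ev coev"
begin

lemma [simp]: "d \<in> Obj C" "arrow C ev" "src C ev = d \<otimes>\<^bsub>C\<^esub> a" "tgt C ev = \<one>\<^bsub>C\<^esub>"
  "arrow C coev" "src C coev = \<one>\<^bsub>C\<^esub>" "tgt C coev = a \<otimes>\<^bsub>C\<^esub> d"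
  using dual by (auto simp: dual_pair_def C.hom_iff)

lemma zigzag:
  shows "runit C a \<cdot>\<^bsub>C\<^esub> (ide C a \<boxtimes>\<^bsub>C\<^esub> ev) \<cdot>\<^bsub>C\<^esub> assoc C a d a \<cdot>\<^bsub>C\<^esub> (coev \<boxtimes>\<^bsub>C\<^esub> ide C a) = lunit C a"
    and "lunit C d \<cdot>\<^bsub>C\<^esub> (ev \<boxtimes>\<^bsub>C\<^esub> ide C d) \<cdot>\<^bsub>C\<^esub> minv C (assoc C d a d) \<cdot>\<^bsub>C\<^esub> (ide C d \<boxtimes>\<^bsub>C\<^esub> coev) = runit C d"
  using dual by (auto simp: dual_pair_def)

text \<open>With \<open>act_transpose\<close> as inverse this is the bijection
  \<open>Hom(d \<rhd> z, w) \<cong> Hom(z, a \<rhd> w)\<close>: the action of a right dual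
  \<open>d\<close> of \<open>a\<close> is left adjoint to that of \<open>a\<close>.\<close>

definition act_cotranspose where
  "act_cotranspose z h = (ide C a \<unrhd> h) \<cdot>\<^bsub>L\<^esub> massoc M a d z \<cdot>\<^bsub>L\<^esub> (coev \<unrhd> ide L z) \<cdot>\<^bsub>L\<^esub> minv L (munit M z)"

definition act_transpose where
  "act_transpose w f = munit M w \<cdot>\<^bsub>L\<^esub> (ev \<unrhd> ide L w) \<cdot>\<^bsub>L\<^esub> minv L (massoc M d a w) \<cdot>\<^bsub>L\<^esub> (ide C d \<unrhd> f)"

text \<open>A triangle identity of this adjunction. Composing with an associativity constraint
  gathers \<open>a\<close>, \<open>d\<close>, \<open>a\<close> into one tensor product acting on
  \<open>w\<close>, where the zigzag for \<open>a\<close> applies; \<open>munit_massoc\<close>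
  compares the unit constraints left over.\<close>

lemma module_zigzag_left:
  assumes w: "w \<in> Obj L"
  shows "(ide C a \<unrhd> munit M w) \<cdot>\<^bsub>L\<^esub> (ide C a \<unrhd> (ev \<unrhd> ide L w)) \<cdot>\<^bsub>L\<^esub> (ide C a \<unrhd> minv L (massoc M d a w))
    \<cdot>\<^bsub>L\<^esub> massoc M a d (a \<rhd> w) \<cdot>\<^bsub>L\<^esub> (coev \<unrhd> ide L (a \<rhd> w)) = munit M (a \<rhd> w)" (is "?lhs = _")
proof (rule L.invertible_cancel_right[where f = "massoc M \<one>\<^bsub>C\<^esub> a w"])
  let ?U = "ide C a \<unrhd> munit M w" and ?E = "ide C a \<unrhd> (ev \<unrhd> ide L w)"
    and ?K = "ide C a \<unrhd> minv L (massoc M d a w)"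
  have "massoc M a d (a \<rhd> w) \<cdot>\<^bsub>L\<^esub> (coev \<unrhd> ide L (a \<rhd> w)) \<cdot>\<^bsub>L\<^esub> massoc M \<one>\<^bsub>C\<^esub> a w
      = massoc M a d (a \<rhd> w) \<cdot>\<^bsub>L\<^esub> massoc M (a \<otimes>\<^bsub>C\<^esub> d) a w \<cdot>\<^bsub>L\<^esub> ((coev \<boxtimes>\<^bsub>C\<^esub> ide C a) \<unrhd> ide L w)"
    using w massoc_natural[of coev "ide C a" "ide L w"] by simp
  also have "\<dots> = (ide C a \<unrhd> massoc M d a w) \<cdot>\<^bsub>L\<^esub> massoc M a (d \<otimes>\<^bsub>C\<^esub> a) w
      \<cdot>\<^bsub>L\<^esub> ((assoc C a d a \<cdot>\<^bsub>C\<^esub> (coev \<boxtimes>\<^bsub>C\<^esub> ide C a)) \<unrhd> ide L w)"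
    using w L.comp_extend[OF mpentagon[of a d a w]] by (simp add: act.bifun_comp_left)
  finally have 1: "massoc M a d (a \<rhd> w) \<cdot>\<^bsub>L\<^esub> (coev \<unrhd> ide L (a \<rhd> w)) \<cdot>\<^bsub>L\<^esub> massoc M \<one>\<^bsub>C\<^esub> a w
      = (ide C a \<unrhd> massoc M d a w) \<cdot>\<^bsub>L\<^esub> massoc M a (d \<otimes>\<^bsub>C\<^esub> a) w
      \<cdot>\<^bsub>L\<^esub> ((assoc C a d a \<cdot>\<^bsub>C\<^esub> (coev \<boxtimes>\<^bsub>C\<^esub> ide C a)) \<unrhd> ide L w)" .
  have "?lhs \<cdot>\<^bsub>L\<^esub> massoc M \<one>\<^bsub>C\<^esub> a w = ?U \<cdot>\<^bsub>L\<^esub> ?E \<cdot>\<^bsub>L\<^esub> massoc M a (d \<otimes>\<^bsub>C\<^esub> a) w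
      \<cdot>\<^bsub>L\<^esub> ((assoc C a d a \<cdot>\<^bsub>C\<^esub> (coev \<boxtimes>\<^bsub>C\<^esub> ide C a)) \<unrhd> ide L w)"
    using w by (simp add: 1 act.interchange_extend)
  also have "\<dots> = ?U \<cdot>\<^bsub>L\<^esub> massoc M a \<one>\<^bsub>C\<^esub> w \<cdot>\<^bsub>L\<^esub> ((ide C a \<boxtimes>\<^bsub>C\<^esub> ev) \<unrhd> ide L w)
      \<cdot>\<^bsub>L\<^esub> ((assoc C a d a \<cdot>\<^bsub>C\<^esub> (coev \<boxtimes>\<^bsub>C\<^esub> ide C a)) \<unrhd> ide L w)"
    using w L.comp_extend[OF massoc_natural[of "ide C a" ev "ide L w", symmetric]] by simp
  also have "\<dots> = (runit C a \<unrhd> ide L w) \<cdot>\<^bsub>L\<^esub> ((ide C a \<boxtimes>\<^bsub>C\<^esub> ev) \<unrhd> ide L w)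
      \<cdot>\<^bsub>L\<^esub> ((assoc C a d a \<cdot>\<^bsub>C\<^esub> (coev \<boxtimes>\<^bsub>C\<^esub> ide C a)) \<unrhd> ide L w)"
    using w L.comp_extend[OF mtriangle[of a w]] by simp
  also have "\<dots> = lunit C a \<unrhd> ide L w"
    using w by (simp add: act.interchange zigzag)
  also have "\<dots> = munit M (a \<rhd> w) \<cdot>\<^bsub>L\<^esub> massoc M \<one>\<^bsub>C\<^esub> a w"
    using w by (simp add: munit_massoc)
  finally show "?lhs \<cdot>\<^bsub>L\<^esub> massoc M \<one>\<^bsub>C\<^esub> a w = munit M (a \<rhd> w) \<cdot>\<^bsub>L\<^esub> massoc M \<one>\<^bsub>C\<^esub> a w" .
qed (use w in simp_all)

text \<open>The other triangle identity. The zigzag for \<open>d\<close> contains an inverse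
  associator, hence the pentagon in the form \<open>mpentagon_minv\<close>.\<close>

lemma module_zigzag_right:
  assumes z: "z \<in> Obj L"
  shows "munit M (d \<rhd> z) \<cdot>\<^bsub>L\<^esub> (ev \<unrhd> ide L (d \<rhd> z)) \<cdot>\<^bsub>L\<^esub> minv L (massoc M d a (d \<rhd> z))
    \<cdot>\<^bsub>L\<^esub> (ide C d \<unrhd> massoc M a d z) \<cdot>\<^bsub>L\<^esub> (ide C d \<unrhd> (coev \<unrhd> ide L z)) = ide C d \<unrhd> munit M z" (is "?lhs = _")
proof (rule L.invertible_cancel_right[where f = "massoc M d \<one>\<^bsub>C\<^esub> z"])
  let ?t = "(minv C (assoc C d a d) \<cdot>\<^bsub>C\<^esub> (ide C d \<boxtimes>\<^bsub>C\<^esub> coev)) \<unrhd> ide L z"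
  have "(ide C d \<unrhd> massoc M a d z) \<cdot>\<^bsub>L\<^esub> (ide C d \<unrhd> (coev \<unrhd> ide L z)) \<cdot>\<^bsub>L\<^esub> massoc M d \<one>\<^bsub>C\<^esub> z
      = (ide C d \<unrhd> massoc M a d z) \<cdot>\<^bsub>L\<^esub> massoc M d (a \<otimes>\<^bsub>C\<^esub> d) z \<cdot>\<^bsub>L\<^esub> ((ide C d \<boxtimes>\<^bsub>C\<^esub> coev) \<unrhd> ide L z)"
    using z massoc_natural[of "ide C d" coev "ide L z"] by simp
  also have "\<dots> = massoc M d a (d \<rhd> z) \<cdot>\<^bsub>L\<^esub> massoc M (d \<otimes>\<^bsub>C\<^esub> a) d z \<cdot>\<^bsub>L\<^esub> ?t"
    using z L.comp_extend[OF mpentagon_minv[of d a d z]] by (simp add: act.bifun_comp_left)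
  finally have 1: "(ide C d \<unrhd> massoc M a d z) \<cdot>\<^bsub>L\<^esub> (ide C d \<unrhd> (coev \<unrhd> ide L z)) \<cdot>\<^bsub>L\<^esub> massoc M d \<one>\<^bsub>C\<^esub> z
      = massoc M d a (d \<rhd> z) \<cdot>\<^bsub>L\<^esub> massoc M (d \<otimes>\<^bsub>C\<^esub> a) d z \<cdot>\<^bsub>L\<^esub> ?t" .
  have "?lhs \<cdot>\<^bsub>L\<^esub> massoc M d \<one>\<^bsub>C\<^esub> z = munit M (d \<rhd> z) \<cdot>\<^bsub>L\<^esub> (ev \<unrhd> ide L (d \<rhd> z)) \<cdot>\<^bsub>L\<^esub> massoc M (d \<otimes>\<^bsub>C\<^esub> a) d z \<cdot>\<^bsub>L\<^esub> ?t"
    using z by (simp add: 1)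
  also have "\<dots> = munit M (d \<rhd> z) \<cdot>\<^bsub>L\<^esub> massoc M \<one>\<^bsub>C\<^esub> d z \<cdot>\<^bsub>L\<^esub> ((ev \<boxtimes>\<^bsub>C\<^esub> ide C d) \<unrhd> ide L z) \<cdot>\<^bsub>L\<^esub> ?t"
    using z L.comp_extend[OF massoc_natural[of ev "ide C d" "ide L z", symmetric]] by simp
  also have "\<dots> = (lunit C d \<unrhd> ide L z) \<cdot>\<^bsub>L\<^esub> ((ev \<boxtimes>\<^bsub>C\<^esub> ide C d) \<unrhd> ide L z) \<cdot>\<^bsub>L\<^esub> ?t"
    using z L.comp_extend[OF munit_massoc[of d z]] by simp
  also have "\<dots> = runit C d \<unrhd> ide L z"
    using z by (simp add: act.interchange zigzag)
  also have "\<dots> = (ide C d \<unrhd> munit M z) \<cdot>\<^bsub>L\<^esub> massoc M d \<one>\<^bsub>C\<^esub> z"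
    using z by (simp add: mtriangle)
  finally show "?lhs \<cdot>\<^bsub>L\<^esub> massoc M d \<one>\<^bsub>C\<^esub> z = (ide C d \<unrhd> munit M z) \<cdot>\<^bsub>L\<^esub> massoc M d \<one>\<^bsub>C\<^esub> z" .
qed (use z in simp_all)

lemma act_cotranspose_transpose:
  assumes f: "f \<in> Hom L z (a \<rhd> w)" and w: "w \<in> Obj L"
  shows "act_cotranspose z (act_transpose w f) = f"
proof -
  have [simp]: "arrow L f" "src L f = z" "tgt L f = a \<rhd> w" and z [simp]: "z \<in> Obj L"
    using f L.hom_obj by (auto simp: L.hom_iff)
  have "act_cotranspose z (act_transpose w f) = (ide C a \<unrhd> munit M w) \<cdot>\<^bsub>L\<^esub> (ide C a \<unrhd> (ev \<unrhd> ide L w))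
      \<cdot>\<^bsub>L\<^esub> (ide C a \<unrhd> minv L (massoc M d a w)) \<cdot>\<^bsub>L\<^esub> (ide C a \<unrhd> (ide C d \<unrhd> f)) \<cdot>\<^bsub>L\<^esub> massoc M a d z
      \<cdot>\<^bsub>L\<^esub> (coev \<unrhd> ide L z) \<cdot>\<^bsub>L\<^esub> minv L (munit M z)"
    using w unfolding act_cotranspose_def act_transpose_def by (simp add: act.bifun_comp_right)
  also have "(ide C a \<unrhd> (ide C d \<unrhd> f)) \<cdot>\<^bsub>L\<^esub> massoc M a d z \<cdot>\<^bsub>L\<^esub> (coev \<unrhd> ide L z) \<cdot>\<^bsub>L\<^esub> minv L (munit M z)
      = massoc M a d (a \<rhd> w) \<cdot>\<^bsub>L\<^esub> (coev \<unrhd> ide L (a \<rhd> w)) \<cdot>\<^bsub>L\<^esub> (ide C \<one>\<^bsub>C\<^esub> \<unrhd> f) \<cdot>\<^bsub>L\<^esub> minv L (munit M z)"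
    using w L.comp_extend[OF massoc_natural[of "ide C a" "ide C d" f, symmetric]]
    by (simp add: act.interchange_extend)
  also have "(ide C \<one>\<^bsub>C\<^esub> \<unrhd> f) \<cdot>\<^bsub>L\<^esub> minv L (munit M z) = minv L (munit M (a \<rhd> w)) \<cdot>\<^bsub>L\<^esub> f"
    using minv_munit_natural[of f] by simp
  also have "(ide C a \<unrhd> munit M w) \<cdot>\<^bsub>L\<^esub> (ide C a \<unrhd> (ev \<unrhd> ide L w)) \<cdot>\<^bsub>L\<^esub> (ide C a \<unrhd> minv L (massoc M d a w))
      \<cdot>\<^bsub>L\<^esub> massoc M a d (a \<rhd> w) \<cdot>\<^bsub>L\<^esub> (coev \<unrhd> ide L (a \<rhd> w)) \<cdot>\<^bsub>L\<^esub> minv L (munit M (a \<rhd> w)) \<cdot>\<^bsub>L\<^esub> f = f"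
    using w arg_cong[OF module_zigzag_left[OF w], of "\<lambda>t. t \<cdot>\<^bsub>L\<^esub> minv L (munit M (a \<rhd> w)) \<cdot>\<^bsub>L\<^esub> f"] by simp
  finally show ?thesis .
qed

lemma act_transpose_cotranspose:
  assumes h: "h \<in> Hom L (d \<rhd> z) w" and z [simp]: "z \<in> Obj L"
  shows "act_transpose w (act_cotranspose z h) = h"
proof -
  have [simp]: "arrow L h" "src L h = d \<rhd> z" "tgt L h = w" and w [simp]: "w \<in> Obj L"
    using h L.hom_obj by (auto simp: L.hom_iff)
  let ?t = "(ide C d \<unrhd> massoc M a d z) \<cdot>\<^bsub>L\<^esub> (ide C d \<unrhd> (coev \<unrhd> ide L z)) \<cdot>\<^bsub>L\<^esub> (ide C d \<unrhd> minv L (munit M z))"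
  have inv: "minv L (massoc M d a w) \<cdot>\<^bsub>L\<^esub> (ide C d \<unrhd> (ide C a \<unrhd> h)) = (ide C (d \<otimes>\<^bsub>C\<^esub> a) \<unrhd> h) \<cdot>\<^bsub>L\<^esub> minv L (massoc M d a (d \<rhd> z))"
    by (rule L.invertible_cancel_right[where f = "massoc M d a (d \<rhd> z)"])
      (use massoc_natural[of "ide C d" "ide C a" h, symmetric] in simp_all)
  have "act_transpose w (act_cotranspose z h) = munit M w \<cdot>\<^bsub>L\<^esub> (ev \<unrhd> ide L w) \<cdot>\<^bsub>L\<^esub> minv L (massoc M d a w)
      \<cdot>\<^bsub>L\<^esub> (ide C d \<unrhd> (ide C a \<unrhd> h)) \<cdot>\<^bsub>L\<^esub> ?t"
    unfolding act_cotranspose_def act_transpose_def by (simp add: act.bifun_comp_right)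
  also have "\<dots> = munit M w \<cdot>\<^bsub>L\<^esub> (ev \<unrhd> ide L w) \<cdot>\<^bsub>L\<^esub> (ide C (d \<otimes>\<^bsub>C\<^esub> a) \<unrhd> h) \<cdot>\<^bsub>L\<^esub> minv L (massoc M d a (d \<rhd> z)) \<cdot>\<^bsub>L\<^esub> ?t"
    using L.comp_extend[OF inv] by simp
  also have "\<dots> = munit M w \<cdot>\<^bsub>L\<^esub> (ide C \<one>\<^bsub>C\<^esub> \<unrhd> h) \<cdot>\<^bsub>L\<^esub> (ev \<unrhd> ide L (d \<rhd> z)) \<cdot>\<^bsub>L\<^esub> minv L (massoc M d a (d \<rhd> z)) \<cdot>\<^bsub>L\<^esub> ?t"
    by (simp add: act.interchange_extend)
  also have "\<dots> = h \<cdot>\<^bsub>L\<^esub> munit M (d \<rhd> z) \<cdot>\<^bsub>L\<^esub> (ev \<unrhd> ide L (d \<rhd> z)) \<cdot>\<^bsub>L\<^esub> minv L (massoc M d a (d \<rhd> z)) \<cdot>\<^bsub>L\<^esub> ?t"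
    using L.comp_extend[OF munit_natural[of h]] by simp
  also have "\<dots> = h"
    using arg_cong[OF module_zigzag_right[OF z], of "\<lambda>t. h \<cdot>\<^bsub>L\<^esub> t \<cdot>\<^bsub>L\<^esub> (ide C d \<unrhd> minv L (munit M z))"]
    by (simp add: act.interchange)
  finally show ?thesis .
qed

lemma act_transpose_hom: "f \<in> Hom L z (a \<rhd> w) \<Longrightarrow> w \<in> Obj L \<Longrightarrow> act_transpose w f \<in> Hom L (d \<rhd> z) w"
  unfolding act_transpose_def by (simp add: L.hom_iff)

lemma act_cotranspose_universal:
  assumes "f \<in> Hom L z (a \<rhd> w)" "w \<in> Obj L"
  shows "\<exists>!h. h \<in> Hom L (d \<rhd> z) w \<and> act_cotranspose z h = f"
  using act_transpose_hom[OF assms] act_cotranspose_transpose[OF assms] act_transpose_cotranspose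
    L.hom_obj[OF assms(1)] by metis

end

end

section \<open>Reversed tensor products and duals\<close>

lemma rev_tensor_simps [simp]:
  "Obj (rev_tensor C) = Obj C" "Hom (rev_tensor C) = Hom C" "ide (rev_tensor C) = ide C"
  "mcomp (rev_tensor C) = mcomp C" "madd (rev_tensor C) = madd C" "mzero (rev_tensor C) = mzero C"
  "msmul (rev_tensor C) = msmul C" "ten (rev_tensor C) = (\<lambda>a b. b \<otimes>\<^bsub>C\<^esub> a)"
  "tenm (rev_tensor C) = (\<lambda>f g. g \<boxtimes>\<^bsub>C\<^esub> f)" "one (rev_tensor C) = one C"
  "assoc (rev_tensor C) = (\<lambda>a b c. minv C (assoc C c b a))"
  "lunit (rev_tensor C) = runit C" "runit (rev_tensor C) = lunit C"
  "rdual (rev_tensor C) = ldual C" "evr (rev_tensor C) = evl C" "coevr (rev_tensor C) = coevl C"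
  by (simp_all add: rev_tensor_def)

text \<open>These notions see only the underlying category, which reversal leaves alone; in
  particular Nakayama data of \<open>D\<close> serves for \<open>rev_tensor D\<close>.\<close>

lemma rev_tensor_category [simp]:
  "is_iso (rev_tensor C) = is_iso C" "minv (rev_tensor C) = minv C"
  "hom_dual (rev_tensor C) = hom_dual C" "nakayama_wedge (rev_tensor C) = nakayama_wedge C"
  "nakayama (rev_tensor C) = nakayama C" "linear_functor C' (rev_tensor C) = linear_functor C' C"
  "linear_functor (rev_tensor C) C' = linear_functor C C'"
  by (auto simp: fun_eq_iff is_iso_def minv_def hom_dual_def nakayama_wedge_def nakayama_def
      linear_functor_def)

lemma linear_category_rev_tensor: "linear_category C \<Longrightarrow> linear_category (rev_tensor C)"
  by (simp add: linear_category_def)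

section \<open>Reversal of the tensor product\<close>

context linear_monoidal_category
begin

lemma assoc_natural:
  assumes "arrow C f" "arrow C g" "arrow C h"
  shows "assoc C (tgt C f) (tgt C g) (tgt C h) \<cdot> ((f \<boxtimes> g) \<boxtimes> h)
    = (f \<boxtimes> (g \<boxtimes> h)) \<cdot> assoc C (src C f) (src C g) (src C h)"
  using assoc_nat assms arrow_hom by blast

lemma runit_natural: "arrow C f \<Longrightarrow> runit C (tgt C f) \<cdot> (f \<boxtimes> ide C \<one>) = f \<cdot> runit C (src C f)"
  using runit_nat arrow_hom by blast

lemma lunit_natural: "arrow C f \<Longrightarrow> lunit C (tgt C f) \<cdot> (ide C \<one> \<boxtimes> f) = f \<cdot> lunit C (src C f)"
  using lunit_nat arrow_hom by blast

lemma minv_assoc_natural: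
  assumes "arrow C f" "arrow C g" "arrow C h"
  shows "minv C (assoc C (tgt C f) (tgt C g) (tgt C h)) \<cdot> (f \<boxtimes> (g \<boxtimes> h))
    = ((f \<boxtimes> g) \<boxtimes> h) \<cdot> minv C (assoc C (src C f) (src C g) (src C h))"
  by (rule invertible_cancel_right[where f = "assoc C (src C f) (src C g) (src C h)"])
    (use assms assoc_natural[OF assms, symmetric] in simp_all)

text \<open>Reversal inverts associators and exchanges the unit constraints: the pentagon is
  inverted as a whole, and the triangle is solved for its other side.\<close>

lemma linear_monoidal_rev_tensor: "linear_monoidal_category (rev_tensor C)"
proof (intro linear_monoidal_category.intro linear_monoidal_category_axioms.intro, unfold rev_tensor_simps rev_tensor_category)
  show "linear_category (rev_tensor C)" using linear_category_axioms linear_category_rev_tensor by blast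
  show "bilinear_bifunctor (rev_tensor C) (rev_tensor C) (rev_tensor C) (\<lambda>a b. b \<otimes> a) (\<lambda>f g. g \<boxtimes> f)"
    using tensor unfolding bilinear_bifunctor_def by (simp, metis)
  fix a b c assume abc: "a \<in> Obj C" "b \<in> Obj C" "c \<in> Obj C"
  then show "is_iso C (c \<otimes> b \<otimes> a) ((c \<otimes> b) \<otimes> a) (minv C (assoc C c b a))"
    by (simp add: is_iso_iff)
next
  fix f a a' g b b' h c c' assume "f \<in> Hom C a a'" "g \<in> Hom C b b'" "h \<in> Hom C c c'"
  then show "minv C (assoc C c' b' a') \<cdot> (h \<boxtimes> g \<boxtimes> f) = ((h \<boxtimes> g) \<boxtimes> f) \<cdot> minv C (assoc C c b a)"
    using minv_assoc_natural[of h g f] by (simp add: hom_iff)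
next
  fix a b c d assume *: "a \<in> Obj C" "b \<in> Obj C" "c \<in> Obj C" "d \<in> Obj C"
  then show "minv C (assoc C (d \<otimes> c) b a) \<cdot> minv C (assoc C d c (b \<otimes> a)) =
      (minv C (assoc C d c b) \<boxtimes> ide C a) \<cdot> minv C (assoc C d (c \<otimes> b) a) \<cdot> (ide C d \<boxtimes> minv C (assoc C c b a))"
    using arg_cong[OF pentagon[of d c b a], of "minv C"] by (simp add: minv_mcomp ten.minv_bifun)
next
  fix a b assume *: "a \<in> Obj C" "b \<in> Obj C"
  then show "(runit C b \<boxtimes> ide C a) \<cdot> minv C (assoc C b \<one> a) = ide C b \<boxtimes> lunit C a"
    by (simp add: triangle[symmetric])
qed (simp_all add: lunit_iso runit_iso lunit_nat runit_nat)

lemma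
  assumes "dual_pair C d a ev coev"
  shows dual_pair_obj: "d \<in> Obj C"
    and dual_pair_ev: "arrow C ev" "src C ev = d \<otimes> a" "tgt C ev = \<one>"
    and dual_pair_coev: "arrow C coev" "src C coev = \<one>" "tgt C coev = a \<otimes> d"
  using assms unfolding dual_pair_def hom_iff by blast+

text \<open>Reversal exchanges the two zigzag identities, so the same evaluation and coevaluation
  make \<open>a\<close> a right dual of \<open>d\<close>.\<close>

lemma dual_pair_rev_tensor:
  assumes a: "a \<in> Obj C" and dual: "dual_pair C d a ev coev"
  shows "dual_pair (rev_tensor C) a d ev coev"
  using assms by (simp add: dual_pair_def)

section \<open>Unit coherence, coevaluations and dual morphisms\<close>

lemma regular_module: "linear_module_category C C (regular_action C)"
  by unfold_locales (simp_all add: regular_action_def tensor assoc_iso assoc_nat lunit_iso lunit_nat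
      pentagon triangle)

text \<open>The unit coherence of actions, applied to \<open>C\<close> acting on itself.\<close>

lemma lunit_tensor: "a \<in> Obj C \<Longrightarrow> b \<in> Obj C \<Longrightarrow> lunit C (a \<otimes> b) \<cdot> assoc C \<one> a b = lunit C a \<boxtimes> ide C b"
  using linear_module_category.munit_massoc[OF regular_module] by (simp add: regular_action_def)

lemma runit_tensor:
  assumes "a \<in> Obj C" "b \<in> Obj C"
  shows "(ide C a \<boxtimes> runit C b) \<cdot> assoc C a b \<one> = runit C (a \<otimes> b)"
proof -
  have "ide C a \<boxtimes> runit C b = runit C (a \<otimes> b) \<cdot> minv C (assoc C a b \<one>)"
    using linear_monoidal_category.lunit_tensor[OF linear_monoidal_rev_tensor, of b a] assms by simp
  then show ?thesis using assms by simp
qed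

text \<open>By naturality at itself, \<open>lunit\<close> at \<open>1 \<otimes> 1\<close> is
  \<open>1 \<otimes> lunit\<close>. Coherence and the triangle then make \<open>lunit\<close> and
  \<open>runit\<close> of the unit object agree after tensoring with it, and naturality of
  \<open>runit\<close> cancels that factor.\<close>

lemma lunit_one: "lunit C \<one> = runit C \<one>"
proof (rule invertible_cancel_right[where f = "runit C (\<one> \<otimes> \<one>)"])
  have "lunit C (\<one> \<otimes> \<one>) = ide C \<one> \<boxtimes> lunit C \<one>"
    by (rule invertible_cancel_left[where f = "lunit C \<one>"])
      (use lunit_natural[of "lunit C \<one>"] in simp_all)
  then have "lunit C \<one> \<boxtimes> ide C \<one> = runit C \<one> \<boxtimes> ide C \<one>"
    using lunit_tensor[of \<one> \<one>] triangle[of \<one> \<one>] by simp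
  then show "lunit C \<one> \<cdot> runit C (\<one> \<otimes> \<one>) = runit C \<one> \<cdot> runit C (\<one> \<otimes> \<one>)"
    using runit_natural[of "lunit C \<one>"] runit_natural[of "runit C \<one>"] by simp
qed simp_all

text \<open>The bijection \<open>Hom(d, i) \<cong> Hom(1, a \<otimes> i)\<close>: the adjunction
  \<open>d \<otimes> - \<stileturn> a \<otimes> -\<close> evaluated at the unit object, with
  \<open>d \<otimes> 1\<close> replaced by \<open>d\<close>.\<close>

lemma coev_universal:
  assumes a [simp]: "a \<in> Obj C" and dual: "dual_pair C d a ev coev"
    and f: "f \<in> Hom C \<one> (a \<otimes> i)" and i [simp]: "i \<in> Obj C"
  shows "\<exists>!k. k \<in> Hom C d i \<and> (ide C a \<boxtimes> k) \<cdot> coev = f"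
proof -
  interpret R: linear_module_category C C "regular_action C" by (rule regular_module)
  note [simp] = hom_iff
  note [simp] = dual_pair_obj[OF dual] dual_pair_ev[OF dual] dual_pair_coev[OF dual]
  have tr: "R.act_cotranspose d a coev \<one> (k \<cdot> runit C d) = (ide C a \<boxtimes> k) \<cdot> coev" if k: "k \<in> Hom C d i" for k
  proof -
    have "R.act_cotranspose d a coev \<one> (k \<cdot> runit C d)
        = (ide C a \<boxtimes> k) \<cdot> (ide C a \<boxtimes> runit C d) \<cdot> assoc C a d \<one> \<cdot> (coev \<boxtimes> ide C \<one>) \<cdot> minv C (lunit C \<one>)"
      using k dual unfolding R.act_cotranspose_def[OF a dual] by (simp add: regular_action_def ten.bifun_comp_right)
    also have "\<dots> = (ide C a \<boxtimes> k) \<cdot> runit C (a \<otimes> d) \<cdot> (coev \<boxtimes> ide C \<one>) \<cdot> minv C (lunit C \<one>)"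
      using comp_extend[OF runit_tensor[of a d]] by simp
    also have "\<dots> = (ide C a \<boxtimes> k) \<cdot> coev"
      using k comp_extend[OF runit_natural[of coev]] by (simp add: lunit_one)
    finally show ?thesis .
  qed
  have *: "\<exists>!h. h \<in> Hom C (d \<otimes> \<one>) i \<and> R.act_cotranspose d a coev \<one> h = f"
    using R.act_cotranspose_universal[OF a dual, of f \<one> i] f by (simp add: regular_action_def)
  then obtain h where h: "h \<in> Hom C (d \<otimes> \<one>) i" "R.act_cotranspose d a coev \<one> h = f" by blast
  show ?thesis
  proof (rule ex1I)
    have "h = (h \<cdot> minv C (runit C d)) \<cdot> runit C d" using h by simp
    then show "h \<cdot> minv C (runit C d) \<in> Hom C d i \<and> (ide C a \<boxtimes> (h \<cdot> minv C (runit C d))) \<cdot> coev = f"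
      using h tr[of "h \<cdot> minv C (runit C d)"] by simp
    fix k assume k: "k \<in> Hom C d i \<and> (ide C a \<boxtimes> k) \<cdot> coev = f"
    then have "k \<cdot> runit C d \<in> Hom C (d \<otimes> \<one>) i" "R.act_cotranspose d a coev \<one> (k \<cdot> runit C d) = f"
      using tr[of k] by auto
    then have "k \<cdot> runit C d = h" using * h by blast
    then show "k = h \<cdot> minv C (runit C d)" using k by auto
  qed
qed

text \<open>Reversing the tensor product exchanges \<open>a\<close> and \<open>d\<close>, which
  gives \<open>Hom(a, i) \<cong> Hom(1, i \<otimes> d)\<close>.\<close>

lemma coev_universal':
  assumes a: "a \<in> Obj C" and dual: "dual_pair C d a ev coev"
    and f: "f \<in> Hom C \<one> (i \<otimes> d)" and i: "i \<in> Obj C"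
  shows "\<exists>!k. k \<in> Hom C a i \<and> (k \<boxtimes> ide C d) \<cdot> coev = f"
proof -
  have "d \<in> Obj C" using dual by (simp add: dual_pair_def)
  then show ?thesis
    using linear_monoidal_category.coev_universal[OF linear_monoidal_rev_tensor _ dual_pair_rev_tensor[OF a dual],
      of f i] f i by simp
qed

text \<open>A zigzag identity recovers \<open>k\<close> from its evaluation mate: on the right of
  the formula \<open>*\<close>, \<open>k\<close> occurs only inside that mate.\<close>

lemma ev_cancel:
  assumes a [simp]: "a \<in> Obj C" and dual: "dual_pair C d a ev coev"
    and k: "k \<in> Hom C x d" and k': "k' \<in> Hom C x d"
    and eq: "ev \<cdot> (k \<boxtimes> ide C a) = ev \<cdot> (k' \<boxtimes> ide C a)"
  shows "k = k'"
proof -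
  note [simp] = hom_iff
  note [simp] = dual_pair_obj[OF dual] dual_pair_ev[OF dual] dual_pair_coev[OF dual]
  have x [simp]: "x \<in> Obj C" using k hom_obj by blast
  have *: "k \<cdot> runit C x = lunit C d \<cdot> ((ev \<cdot> (k \<boxtimes> ide C a)) \<boxtimes> ide C d) \<cdot> minv C (assoc C x a d) \<cdot> (ide C x \<boxtimes> coev)"
    if k: "k \<in> Hom C x d" for k
  proof -
    have "k \<cdot> runit C x = runit C d \<cdot> (k \<boxtimes> ide C \<one>)" using k runit_natural[of k] by simp
    also have "runit C d = lunit C d \<cdot> (ev \<boxtimes> ide C d) \<cdot> minv C (assoc C d a d) \<cdot> (ide C d \<boxtimes> coev)"
      using dual by (simp add: dual_pair_def)
    also have "\<dots> \<cdot> (k \<boxtimes> ide C \<one>) = lunit C d \<cdot> (ev \<boxtimes> ide C d) \<cdot> minv C (assoc C d a d) \<cdot> (k \<boxtimes> (ide C a \<boxtimes> ide C d)) \<cdot> (ide C x \<boxtimes> coev)"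
      using k by (simp add: ten.interchange del: ten.bifun_ide) (simp add: ten.interchange)
    also have "\<dots> = lunit C d \<cdot> (ev \<boxtimes> ide C d) \<cdot> ((k \<boxtimes> ide C a) \<boxtimes> ide C d) \<cdot> minv C (assoc C x a d) \<cdot> (ide C x \<boxtimes> coev)"
      using k comp_extend[OF minv_assoc_natural[of k "ide C a" "ide C d"], of "ide C x \<boxtimes> coev"] by simp
    also have "\<dots> = lunit C d \<cdot> ((ev \<cdot> (k \<boxtimes> ide C a)) \<boxtimes> ide C d) \<cdot> minv C (assoc C x a d) \<cdot> (ide C x \<boxtimes> coev)"
      using k by (simp add: ten.interchange_extend)
    finally show ?thesis .
  qed
  show ?thesis
    by (rule invertible_cancel_right[where f = "runit C x"])
      (use k k' *[OF k] *[OF k'] eq in simp_all)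
qed

text \<open>The dual of \<open>f\<close> is characterized by either of its two mates.\<close>

lemma coev_mate:
  assumes a [simp]: "a \<in> Obj C" and dual: "dual_pair C d a ev coev"
    and b [simp]: "b \<in> Obj C" and dual': "dual_pair C d' b ev' coev'"
    and f: "f \<in> Hom C a b" and k: "k \<in> Hom C d' d"
    and mate: "(ide C b \<boxtimes> k) \<cdot> coev' = (f \<boxtimes> ide C d) \<cdot> coev"
  shows "ev \<cdot> (k \<boxtimes> ide C a) = ev' \<cdot> (ide C d' \<boxtimes> f)"
proof -
  interpret R: linear_module_category C C "regular_action C" by (rule regular_module)
  note [simp] = hom_iff
  note [simp] = dual_pair_obj[OF dual] dual_pair_ev[OF dual] dual_pair_coev[OF dual]
  note [simp] = dual_pair_obj[OF dual'] dual_pair_ev[OF dual'] dual_pair_coev[OF dual']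
  have [simp]: "arrow C f" "src C f = a" "tgt C f = b" "arrow C k" "src C k = d'" "tgt C k = d"
    using f k by auto
  have zig: "(ide C a \<boxtimes> ev) \<cdot> assoc C a d a \<cdot> (coev \<boxtimes> ide C a) = minv C (runit C a) \<cdot> lunit C a"
    by (rule invertible_cancel_left[where f = "runit C a"]) (use dual in \<open>simp_all add: dual_pair_def\<close>)
  have zig': "(ide C b \<boxtimes> ev') \<cdot> assoc C b d' b \<cdot> (coev' \<boxtimes> ide C b) = minv C (runit C b) \<cdot> lunit C b"
    by (rule invertible_cancel_left[where f = "runit C b"]) (use dual' in \<open>simp_all add: dual_pair_def\<close>)
  have nat: "minv C (runit C b) \<cdot> f = (f \<boxtimes> ide C \<one>) \<cdot> minv C (runit C a)"
    by (rule invertible_cancel_left[where f = "runit C b"], simp_all)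
      (use comp_extend[OF runit_natural[of f], of "minv C (runit C a)"] in simp)
  \<comment> \<open>Transposition along \<open>d' \<otimes> - \<stileturn> b \<otimes> -\<close> is
    injective, so it suffices that both sides have the same image; each turns out to be
    \<open>f\<close> up to a unit constraint.\<close>
  let ?T = "\<lambda>h. (ide C b \<boxtimes> h) \<cdot> assoc C b d' a \<cdot> (coev' \<boxtimes> ide C a) \<cdot> minv C (lunit C a)"
  have T: "R.act_cotranspose d' b coev' a h = ?T h" for h
    unfolding R.act_cotranspose_def[OF b dual'] by (simp add: regular_action_def)
  have "?T (ev \<cdot> (k \<boxtimes> ide C a)) = (ide C b \<boxtimes> ev) \<cdot> (ide C b \<boxtimes> (k \<boxtimes> ide C a)) \<cdot> assoc C b d' a \<cdot> (coev' \<boxtimes> ide C a) \<cdot> minv C (lunit C a)"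
    by (simp add: ten.bifun_comp_right)
  also have "\<dots> = (ide C b \<boxtimes> ev) \<cdot> assoc C b d a \<cdot> ((ide C b \<boxtimes> k) \<boxtimes> ide C a) \<cdot> (coev' \<boxtimes> ide C a) \<cdot> minv C (lunit C a)"
    using comp_extend[OF assoc_natural[of "ide C b" k "ide C a", symmetric]] by simp
  \<comment> \<open>The hypothesis \<open>mate\<close> replaces the coevaluation of \<open>b\<close>
    by that of \<open>a\<close>, so that the zigzag for \<open>a\<close> can finish.\<close>
  also have "\<dots> = (ide C b \<boxtimes> ev) \<cdot> assoc C b d a \<cdot> ((f \<boxtimes> ide C d) \<boxtimes> ide C a) \<cdot> (coev \<boxtimes> ide C a) \<cdot> minv C (lunit C a)"
    by (simp add: ten.interchange_extend mate)
  also have "\<dots> = (ide C b \<boxtimes> ev) \<cdot> (f \<boxtimes> (ide C d \<boxtimes> ide C a)) \<cdot> assoc C a d a \<cdot> (coev \<boxtimes> ide C a) \<cdot> minv C (lunit C a)"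
    using comp_extend[OF assoc_natural[of f "ide C d" "ide C a"]] by simp
  also have "\<dots> = (f \<boxtimes> ide C \<one>) \<cdot> (ide C a \<boxtimes> ev) \<cdot> assoc C a d a \<cdot> (coev \<boxtimes> ide C a) \<cdot> minv C (lunit C a)"
    by (simp add: ten.interchange_extend)
  also have "\<dots> = (f \<boxtimes> ide C \<one>) \<cdot> minv C (runit C a)"
    using arg_cong[OF zig, of "\<lambda>t. (f \<boxtimes> ide C \<one>) \<cdot> t \<cdot> minv C (lunit C a)"] by simp
  finally have 1: "?T (ev \<cdot> (k \<boxtimes> ide C a)) = (f \<boxtimes> ide C \<one>) \<cdot> minv C (runit C a)" .
  have "?T (ev' \<cdot> (ide C d' \<boxtimes> f)) = (ide C b \<boxtimes> ev') \<cdot> (ide C b \<boxtimes> (ide C d' \<boxtimes> f)) \<cdot> assoc C b d' a \<cdot> (coev' \<boxtimes> ide C a) \<cdot> minv C (lunit C a)"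
    by (simp add: ten.bifun_comp_right)
  also have "\<dots> = (ide C b \<boxtimes> ev') \<cdot> assoc C b d' b \<cdot> ((ide C b \<boxtimes> ide C d') \<boxtimes> f) \<cdot> (coev' \<boxtimes> ide C a) \<cdot> minv C (lunit C a)"
    using comp_extend[OF assoc_natural[of "ide C b" "ide C d'" f, symmetric]] by simp
  also have "\<dots> = (ide C b \<boxtimes> ev') \<cdot> assoc C b d' b \<cdot> (coev' \<boxtimes> ide C b) \<cdot> (ide C \<one> \<boxtimes> f) \<cdot> minv C (lunit C a)"
    by (simp add: ten.interchange_extend)
  also have "\<dots> = minv C (runit C b) \<cdot> lunit C b \<cdot> (ide C \<one> \<boxtimes> f) \<cdot> minv C (lunit C a)"
    using arg_cong[OF zig', of "\<lambda>t. t \<cdot> (ide C \<one> \<boxtimes> f) \<cdot> minv C (lunit C a)"] by simp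
  also have "\<dots> = minv C (runit C b) \<cdot> f"
    using comp_extend[OF lunit_natural[of f]] by simp
  finally have 2: "?T (ev' \<cdot> (ide C d' \<boxtimes> f)) = (f \<boxtimes> ide C \<one>) \<cdot> minv C (runit C a)" by (simp add: nat)
  have "R.act_transpose d' b ev' \<one> (R.act_cotranspose d' b coev' a (ev \<cdot> (k \<boxtimes> ide C a)))
      = R.act_transpose d' b ev' \<one> (R.act_cotranspose d' b coev' a (ev' \<cdot> (ide C d' \<boxtimes> f)))"
    unfolding T 1 2 ..
  moreover have "act (regular_action C) = ten C" by (simp add: regular_action_def)
  ultimately show ?thesis
    by (simp add: R.act_transpose_cotranspose[OF b dual'])
qed

text \<open>\<open>rdualm\<close> is described by its evaluation mate, while its coevaluation mate
  is what the Serre unit requires. A solution of the coevaluation equation exists by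
  \<open>coev_universal\<close>, solves the evaluation equation by \<open>coev_mate\<close>, and is
  the described morphism by \<open>ev_cancel\<close>.\<close>

lemma rdualm_mate:
  assumes dual: "\<And>a. a \<in> Obj C \<Longrightarrow> dual_pair C (rdual C a) a (evr C a) (coevr C a)" and f: "f \<in> Hom C a b"
  shows rdualm_hom: "rdualm C a b f \<in> Hom C (rdual C b) (rdual C a)"
    and rdualm_coev: "(ide C b \<boxtimes> rdualm C a b f) \<cdot> coevr C b = (f \<boxtimes> ide C (rdual C a)) \<cdot> coevr C a"
proof -
  have a: "a \<in> Obj C" and b: "b \<in> Obj C" using f hom_obj by blast+
  have d: "rdual C a \<in> Obj C" "coevr C a \<in> Hom C \<one> (a \<otimes> rdual C a)"
    using dual[OF a] by (auto simp: dual_pair_def)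
  have *: "(f \<boxtimes> ide C (rdual C a)) \<cdot> coevr C a \<in> Hom C \<one> (b \<otimes> rdual C a)"
    using d f by (simp add: hom_iff)
  have "\<exists>k. k \<in> Hom C (rdual C b) (rdual C a) \<and> (ide C b \<boxtimes> k) \<cdot> coevr C b = (f \<boxtimes> ide C (rdual C a)) \<cdot> coevr C a"
    by (rule ex1_implies_ex[OF coev_universal[OF b dual[OF b] * d(1)]])
  then obtain k where k: "k \<in> Hom C (rdual C b) (rdual C a)"
    and mate: "(ide C b \<boxtimes> k) \<cdot> coevr C b = (f \<boxtimes> ide C (rdual C a)) \<cdot> coevr C a"
    by (elim exE conjE)
  have ev: "evr C a \<cdot> (k \<boxtimes> ide C a) = evr C b \<cdot> (ide C (rdual C b) \<boxtimes> f)"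
    by (rule coev_mate[OF a dual[OF a] b dual[OF b] f k mate])
  have "rdualm C a b f = k"
    unfolding rdualm_def rmate_def
  proof (rule the_equality)
    show "k \<in> Hom C (rdual C b) (rdual C a) \<and> evr C a \<cdot> (k \<boxtimes> ide C a) = evr C b \<cdot> (ide C (rdual C b) \<boxtimes> f)"
      using k ev by (rule conjI)
    fix g assume "g \<in> Hom C (rdual C b) (rdual C a) \<and> evr C a \<cdot> (g \<boxtimes> ide C a) = evr C b \<cdot> (ide C (rdual C b) \<boxtimes> f)"
    then show "g = k" using ev_cancel[OF a dual[OF a] _ k] ev by metis
  qed
  then show "rdualm C a b f \<in> Hom C (rdual C b) (rdual C a)"
    "(ide C b \<boxtimes> rdualm C a b f) \<cdot> coevr C b = (f \<boxtimes> ide C (rdual C a)) \<cdot> coevr C a"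
    using k mate by auto
qed

end

section \<open>Relative Serre functors and the twisted traces\<close>

lemma linear_module_categoryI:
  assumes "linear_monoidal_category C" and "module_category C L M"
  shows "linear_module_category C L M"
proof -
  interpret module_category C L M by fact
  interpret finite_abelian_category L by (rule base)
  show ?thesis
    by (intro linear_module_category.intro linear_module_category_axioms.intro assms(1))
      (simp_all add: linear_category_axioms action massoc_iso massoc_nat munit_iso munit_nat mpentagon mtriangle)
qed

text \<open>Instantiated for \<open>C\<close> and for \<open>rev_tensor D\<close>, whose right duals
  are the left duals of \<open>D\<close>.\<close>

locale relative_serre_module = linear_module_category C L M
  for C :: "('oc, 'mc, 'k::field) tencat" and L :: "('ol, 'ml, 'k) lincat"
    and M :: "('oc, 'mc, 'ol, 'ml) action" (structure) +
  fixes S :: "('oc, 'mc, 'ol, 'ml) serre_data"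
  assumes right_dual: "a \<in> Obj C \<Longrightarrow> dual_pair C (rdual C a) a (evr C a) (coevr C a)"
    and serre: "relative_serre C L M S"
begin

lemma sob_obj [simp]: "y \<in> Obj L \<Longrightarrow> sob S y \<in> Obj L"
  using serre by (auto simp: relative_serre_def linear_functor_def)

lemma
  assumes "y \<in> Obj L" "z \<in> Obj L"
  shows ihom_obj [simp]: "ihom S y z \<in> Obj C"
    and arrow_ihev [simp]: "arrow L (ihev S y z)"
    and src_ihev [simp]: "src L (ihev S y z) = ihom S y z \<rhd> y"
    and tgt_ihev [simp]: "tgt L (ihev S y z) = z"
  using serre assms by (auto simp: relative_serre_def internal_hom_def L.hom_iff)

lemma ihev_universal:
  "y \<in> Obj L \<Longrightarrow> z \<in> Obj L \<Longrightarrow> c \<in> Obj C \<Longrightarrow> f \<in> Hom L (c \<rhd> y) z \<Longrightarrow>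
    \<exists>!g. g \<in> Hom C c (ihom S y z) \<and> ihev S y z \<cdot>\<^bsub>L\<^esub> (g \<unrhd> ide L y) = f"
  using serre unfolding relative_serre_def internal_hom_def by blast

lemma imate:
  assumes "y \<in> Obj L" "z \<in> Obj L" "c \<in> Obj C" "f \<in> Hom L (c \<rhd> y) z"
  shows "imate C L M S c y z f \<in> Hom C c (ihom S y z)"
    and "ihev S y z \<cdot>\<^bsub>L\<^esub> (imate C L M S c y z f \<unrhd> ide L y) = f"
  using theI'[OF ihev_universal[OF assms]] unfolding imate_def by auto

lemma
  assumes "y \<in> Obj L" "z \<in> Obj L"
  shows invertible_siso [simp]: "invertible C (siso S y z)"
    and src_siso [simp]: "src C (siso S y z) = rdual C (ihom S y z)"
    and tgt_siso [simp]: "tgt C (siso S y z) = ihom S z (sob S y)"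
  using serre assms unfolding relative_serre_def C.is_iso_iff by blast+

lemma siso_nat:
  "y \<in> Obj L \<Longrightarrow> h \<in> Hom L z z' \<Longrightarrow>
    siso S y z \<cdot>\<^bsub>C\<^esub> rdualm C (ihom S y z) (ihom S y z') (ihom_post C L M S y z z' h) =
    ihom_pre C L M S z z' (sob S y) h \<cdot>\<^bsub>C\<^esub> siso S y z'"
  using serre unfolding relative_serre_def by blast

lemma
  assumes "a \<in> Obj C"
  shows rdual_obj [simp]: "rdual C a \<in> Obj C"
    and arrow_coevr [simp]: "arrow C (coevr C a)"
    and src_coevr [simp]: "src C (coevr C a) = \<one>\<^bsub>C\<^esub>"
    and tgt_coevr [simp]: "tgt C (coevr C a) = a \<otimes>\<^bsub>C\<^esub> rdual C a"
  using C.dual_pair_obj[OF right_dual[OF assms]] C.dual_pair_coev[OF right_dual[OF assms]] by auto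

text \<open>The image of \<open>b : 1 \<rightarrow> c \<otimes> ihom(z, w)\<close> under the canonical isomorphism
  \<open>Hom(1, c \<otimes> ihom(z, w)) \<cong> Hom(z, c \<rhd> w)\<close>.\<close>

definition ihom_eval where
  "ihom_eval c z w b = (ide C c \<unrhd> ihev S z w) \<cdot>\<^bsub>L\<^esub> massoc M c (ihom S z w) z \<cdot>\<^bsub>L\<^esub> (b \<unrhd> ide L z) \<cdot>\<^bsub>L\<^esub> minv L (munit M z)"

section \<open>The adjunction between \<open>ihom(y,-)\<close> and the action on
  \<open>S(y)\<close>\<close>

lemma serre_unit_eq:
  "serre_unit C L M S y z = ihom_eval (ihom S y z) z (sob S y)
    ((ide C (ihom S y z) \<boxtimes>\<^bsub>C\<^esub> siso S y z) \<cdot>\<^bsub>C\<^esub> coevr C (ihom S y z))"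
  by (simp add: serre_unit_def ihom_eval_def Let_def)

lemma act_ihom_eval:
  assumes [simp]: "z \<in> Obj L" "w \<in> Obj L" and g: "g \<in> Hom C c c'"
    and b: "b \<in> Hom C \<one>\<^bsub>C\<^esub> (c \<otimes>\<^bsub>C\<^esub> ihom S z w)"
  shows "(g \<unrhd> ide L w) \<cdot>\<^bsub>L\<^esub> ihom_eval c z w b = ihom_eval c' z w ((g \<boxtimes>\<^bsub>C\<^esub> ide C (ihom S z w)) \<cdot>\<^bsub>C\<^esub> b)"
proof -
  have [simp]: "arrow C g" "src C g = c" "tgt C g = c'" "arrow C b" "src C b = \<one>\<^bsub>C\<^esub>" "tgt C b = c \<otimes>\<^bsub>C\<^esub> ihom S z w"
    "c \<in> Obj C" "c' \<in> Obj C"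
    using g b C.hom_obj[OF g] by (auto simp: C.hom_iff)
  have "(g \<unrhd> ide L w) \<cdot>\<^bsub>L\<^esub> ihom_eval c z w b = (ide C c' \<unrhd> ihev S z w)
      \<cdot>\<^bsub>L\<^esub> (g \<unrhd> (ide C (ihom S z w) \<unrhd> ide L z)) \<cdot>\<^bsub>L\<^esub> massoc M c (ihom S z w) z \<cdot>\<^bsub>L\<^esub> (b \<unrhd> ide L z) \<cdot>\<^bsub>L\<^esub> minv L (munit M z)"
    unfolding ihom_eval_def by (simp add: act.interchange_extend)
  also have "\<dots> = (ide C c' \<unrhd> ihev S z w) \<cdot>\<^bsub>L\<^esub> massoc M c' (ihom S z w) z
      \<cdot>\<^bsub>L\<^esub> ((g \<boxtimes>\<^bsub>C\<^esub> ide C (ihom S z w)) \<unrhd> ide L z) \<cdot>\<^bsub>L\<^esub> (b \<unrhd> ide L z) \<cdot>\<^bsub>L\<^esub> minv L (munit M z)"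
    using L.comp_extend[OF massoc_natural[of g "ide C (ihom S z w)" "ide L z", symmetric]] by simp
  finally show ?thesis
    unfolding ihom_eval_def by (simp add: act.interchange_extend)
qed

text \<open>Compares two routes from \<open>Hom(c^v, ihom(z,w))\<close> to
  \<open>Hom(z, c \<rhd> w)\<close>: through morphisms out of the unit object, or by evaluating
  first and then transposing along the adjunction of \<open>c\<close> and its dual. The second is a
  composite of known bijections.\<close>

lemma ihom_eval_coevr:
  assumes [simp]: "z \<in> Obj L" "w \<in> Obj L" and c [simp]: "c \<in> Obj C" and k: "k \<in> Hom C (rdual C c) (ihom S z w)"
  shows "ihom_eval c z w ((ide C c \<boxtimes>\<^bsub>C\<^esub> k) \<cdot>\<^bsub>C\<^esub> coevr C c)
    = act_cotranspose (rdual C c) c (coevr C c) z (ihev S z w \<cdot>\<^bsub>L\<^esub> (k \<unrhd> ide L z))"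
proof -
  have [simp]: "arrow C k" "src C k = rdual C c" "tgt C k = ihom S z w"
    using k by (auto simp: C.hom_iff)
  have "ihom_eval c z w ((ide C c \<boxtimes>\<^bsub>C\<^esub> k) \<cdot>\<^bsub>C\<^esub> coevr C c) = (ide C c \<unrhd> ihev S z w) \<cdot>\<^bsub>L\<^esub> massoc M c (ihom S z w) z
     \<cdot>\<^bsub>L\<^esub> ((ide C c \<boxtimes>\<^bsub>C\<^esub> k) \<unrhd> ide L z) \<cdot>\<^bsub>L\<^esub> (coevr C c \<unrhd> ide L z) \<cdot>\<^bsub>L\<^esub> minv L (munit M z)"
    unfolding ihom_eval_def by (simp add: act.bifun_comp_left)
  also have "\<dots> = (ide C c \<unrhd> ihev S z w) \<cdot>\<^bsub>L\<^esub> (ide C c \<unrhd> (k \<unrhd> ide L z)) \<cdot>\<^bsub>L\<^esub> massoc M c (rdual C c) z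
      \<cdot>\<^bsub>L\<^esub> (coevr C c \<unrhd> ide L z) \<cdot>\<^bsub>L\<^esub> minv L (munit M z)"
    using L.comp_extend[OF massoc_natural[of "ide C c" k "ide L z"]] by simp
  finally show ?thesis
    unfolding act_cotranspose_def[OF c right_dual[OF c]] by (simp add: act.bifun_comp_right)
qed

text \<open>Interchange brings \<open>g\<close> next to the coevaluation, where
  \<open>coev_universal'\<close> and the dual morphism of \<open>g\<close> can act.\<close>

lemma act_serre_unit:
  assumes [simp]: "y \<in> Obj L" "z \<in> Obj L" and g: "g \<in> Hom C (ihom S y z) c"
  shows "(g \<unrhd> ide L (sob S y)) \<cdot>\<^bsub>L\<^esub> serre_unit C L M S y z = ihom_eval c z (sob S y)
    ((ide C c \<boxtimes>\<^bsub>C\<^esub> siso S y z) \<cdot>\<^bsub>C\<^esub> (g \<boxtimes>\<^bsub>C\<^esub> ide C (rdual C (ihom S y z))) \<cdot>\<^bsub>C\<^esub> coevr C (ihom S y z))"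
proof -
  have [simp]: "arrow C g" "src C g = ihom S y z" "tgt C g = c" "c \<in> Obj C"
    using g C.hom_obj[OF g] by (auto simp: C.hom_iff)
  have "(g \<unrhd> ide L (sob S y)) \<cdot>\<^bsub>L\<^esub> serre_unit C L M S y z = ihom_eval c z (sob S y)
    ((g \<boxtimes>\<^bsub>C\<^esub> ide C (ihom S z (sob S y))) \<cdot>\<^bsub>C\<^esub> (ide C (ihom S y z) \<boxtimes>\<^bsub>C\<^esub> siso S y z) \<cdot>\<^bsub>C\<^esub> coevr C (ihom S y z))"
    unfolding serre_unit_eq by (rule act_ihom_eval[OF _ _ g]) (simp_all add: C.hom_iff)
  then show ?thesis by (simp add: C.ten.interchange_extend)
qed

text \<open>Composition with the unit is the composite of the bijections \<open>Hom(ihom(y,z), c)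
  \<cong> Hom(1, c \<otimes> ihom(y,z)^v) \<cong> Hom(1, c \<otimes> ihom(z, S y)) \<cong> Hom(c^v,
  ihom(z, S y)) \<cong> Hom(c^v \<rhd> z, S y) \<cong> Hom(z, c \<rhd> S y)\<close>.\<close>

lemma serre_unit_universal:
  assumes y [simp]: "y \<in> Obj L" and z [simp]: "z \<in> Obj L" and c [simp]: "c \<in> Obj C"
    and f: "f \<in> Hom L z (c \<rhd> sob S y)"
  shows "\<exists>!g. g \<in> Hom C (ihom S y z) c \<and> (g \<unrhd> ide L (sob S y)) \<cdot>\<^bsub>L\<^esub> serre_unit C L M S y z = f"
proof -
  define x where "x = ihom S y z"
  define i where "i = ihom S z (sob S y)"
  define s where "s = siso S y z"
  have [simp]: "x \<in> Obj C" "i \<in> Obj C" "invertible C s" "src C s = rdual C x" "tgt C s = i"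
    by (simp_all add: x_def i_def s_def)
  let ?m = "\<lambda>g. (ide C c \<boxtimes>\<^bsub>C\<^esub> s) \<cdot>\<^bsub>C\<^esub> (g \<boxtimes>\<^bsub>C\<^esub> ide C (rdual C x)) \<cdot>\<^bsub>C\<^esub> coevr C x"
  have unit: "(g \<unrhd> ide L (sob S y)) \<cdot>\<^bsub>L\<^esub> serre_unit C L M S y z = ihom_eval c z (sob S y) (?m g)"
    if "g \<in> Hom C x c" for g
    using act_serre_unit[OF y z] that by (simp add: x_def s_def)
  have eval: "ihom_eval c z (sob S y) ((ide C c \<boxtimes>\<^bsub>C\<^esub> k) \<cdot>\<^bsub>C\<^esub> coevr C c)
      = act_cotranspose (rdual C c) c (coevr C c) z (ihev S z (sob S y) \<cdot>\<^bsub>L\<^esub> (k \<unrhd> ide L z))"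
    if "k \<in> Hom C (rdual C c) i" for k
    using ihom_eval_coevr[of z "sob S y" c k] that by (simp add: i_def)
  have Sy: "sob S y \<in> Obj L" by simp
  note cotr = act_cotranspose_universal[OF c right_dual[OF c] f Sy]
  \<comment> \<open>From here \<open>f\<close> is traced back through the chain: to \<open>h\<close>
    on \<open>rdual C c \<rhd> z\<close>, to \<open>k\<close> with values in the internal Hom, and
    to \<open>?b\<close> after undoing \<open>siso\<close>.\<close>
  obtain h where h: "h \<in> Hom L (rdual C c \<rhd> z) (sob S y)"
    "act_cotranspose (rdual C c) c (coevr C c) z h = f"
    using cotr by blast
  note ev = ihev_universal[OF z Sy rdual_obj[OF c] h(1), folded i_def]
  obtain k where k: "k \<in> Hom C (rdual C c) i" "ihev S z (sob S y) \<cdot>\<^bsub>L\<^esub> (k \<unrhd> ide L z) = h"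
    using ev by blast
  let ?b = "(ide C c \<boxtimes>\<^bsub>C\<^esub> minv C s) \<cdot>\<^bsub>C\<^esub> (ide C c \<boxtimes>\<^bsub>C\<^esub> k) \<cdot>\<^bsub>C\<^esub> coevr C c"
  have b: "?b \<in> Hom C \<one>\<^bsub>C\<^esub> (c \<otimes>\<^bsub>C\<^esub> rdual C x)"
    using k(1) by (simp add: C.hom_iff)
  have coev: "\<exists>!g. g \<in> Hom C x c \<and> (g \<boxtimes>\<^bsub>C\<^esub> ide C (rdual C x)) \<cdot>\<^bsub>C\<^esub> coevr C x = ?b"
    using C.coev_universal'[OF _ right_dual b] by simp
  have mate: "?m g = (ide C c \<boxtimes>\<^bsub>C\<^esub> k) \<cdot>\<^bsub>C\<^esub> coevr C c \<longleftrightarrow> (g \<boxtimes>\<^bsub>C\<^esub> ide C (rdual C x)) \<cdot>\<^bsub>C\<^esub> coevr C x = ?b"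
    if g: "g \<in> Hom C x c" for g
  proof
    assume "?m g = (ide C c \<boxtimes>\<^bsub>C\<^esub> k) \<cdot>\<^bsub>C\<^esub> coevr C c"
    then have "?b = (ide C c \<boxtimes>\<^bsub>C\<^esub> minv C s) \<cdot>\<^bsub>C\<^esub> ?m g" by simp
    then show "(g \<boxtimes>\<^bsub>C\<^esub> ide C (rdual C x)) \<cdot>\<^bsub>C\<^esub> coevr C x = ?b"
      using g by (simp add: C.hom_iff C.ten.interchange_extend)
  next
    assume "(g \<boxtimes>\<^bsub>C\<^esub> ide C (rdual C x)) \<cdot>\<^bsub>C\<^esub> coevr C x = ?b"
    then have "?m g = (ide C c \<boxtimes>\<^bsub>C\<^esub> s) \<cdot>\<^bsub>C\<^esub> ?b" by simp
    also have "\<dots> = (ide C c \<boxtimes>\<^bsub>C\<^esub> k) \<cdot>\<^bsub>C\<^esub> coevr C c"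
      using k(1) C.ten.interchange_extend[of "ide C c" "ide C c" "minv C s" s "(ide C c \<boxtimes>\<^bsub>C\<^esub> k) \<cdot>\<^bsub>C\<^esub> coevr C c"]
      by (simp add: C.hom_iff)
    finally show "?m g = (ide C c \<boxtimes>\<^bsub>C\<^esub> k) \<cdot>\<^bsub>C\<^esub> coevr C c" .
  qed
  have "(g \<unrhd> ide L (sob S y)) \<cdot>\<^bsub>L\<^esub> serre_unit C L M S y z = f \<longleftrightarrow>
      (g \<boxtimes>\<^bsub>C\<^esub> ide C (rdual C x)) \<cdot>\<^bsub>C\<^esub> coevr C x = ?b" if g: "g \<in> Hom C x c" for g
  proof
    assume gf: "(g \<unrhd> ide L (sob S y)) \<cdot>\<^bsub>L\<^esub> serre_unit C L M S y z = f"
    have mg: "?m g \<in> Hom C \<one>\<^bsub>C\<^esub> (c \<otimes>\<^bsub>C\<^esub> i)" using g by (simp add: C.hom_iff)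
    \<comment> \<open>The image of \<open>g\<close> is itself written with some \<open>k'\<close>;
      uniqueness at the two adjunction stages then forces \<open>k' = k\<close>.\<close>
    have "\<exists>k'. k' \<in> Hom C (rdual C c) i \<and> (ide C c \<boxtimes>\<^bsub>C\<^esub> k') \<cdot>\<^bsub>C\<^esub> coevr C c = ?m g"
      by (rule ex1_implies_ex[OF C.coev_universal[OF c right_dual[OF c] mg]]) simp
    then obtain k' where k': "k' \<in> Hom C (rdual C c) i" "(ide C c \<boxtimes>\<^bsub>C\<^esub> k') \<cdot>\<^bsub>C\<^esub> coevr C c = ?m g"
      by (elim exE conjE)
    let ?h = "ihev S z (sob S y) \<cdot>\<^bsub>L\<^esub> (k' \<unrhd> ide L z)"
    have "?h \<in> Hom L (rdual C c \<rhd> z) (sob S y)"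
      using k'(1) by (simp add: L.hom_iff C.hom_iff i_def)
    moreover have "act_cotranspose (rdual C c) c (coevr C c) z ?h = f"
      using eval[OF k'(1)] k'(2) unit[OF g] gf by simp
    ultimately have "?h = h" using cotr h by blast
    then have "k' = k" using ev k k'(1) by blast
    then show "(g \<boxtimes>\<^bsub>C\<^esub> ide C (rdual C x)) \<cdot>\<^bsub>C\<^esub> coevr C x = ?b" using mate[OF g] k'(2) by simp
  next
    assume "(g \<boxtimes>\<^bsub>C\<^esub> ide C (rdual C x)) \<cdot>\<^bsub>C\<^esub> coevr C x = ?b"
    then have "?m g = (ide C c \<boxtimes>\<^bsub>C\<^esub> k) \<cdot>\<^bsub>C\<^esub> coevr C c" using mate[OF g] by blast
    then show "(g \<unrhd> ide L (sob S y)) \<cdot>\<^bsub>L\<^esub> serre_unit C L M S y z = f"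
      using unit[OF g] eval[OF k(1)] k(2) h(2) by simp
  qed
  then show ?thesis using coev unfolding x_def by (smt (verit, ccfv_threshold))
qed

text \<open>The condition \<open>gh\<close> forces \<open>g\<close> to be the map of internal Homs
  induced by \<open>h\<close>. Naturality of \<open>siso\<close> turns precomposition with
  \<open>h\<close> into the dual of \<open>g\<close>, and the dual on one side of a coevaluation
  equals \<open>g\<close> on the other.\<close>

lemma serre_unit_nat:
  assumes y [simp]: "y \<in> Obj L" and h: "h \<in> Hom L z z'" and g: "g \<in> Hom C (ihom S y z) (ihom S y z')"
    and gh: "ihev S y z' \<cdot>\<^bsub>L\<^esub> (g \<unrhd> ide L y) = h \<cdot>\<^bsub>L\<^esub> ihev S y z"
  shows "(g \<unrhd> ide L (sob S y)) \<cdot>\<^bsub>L\<^esub> serre_unit C L M S y z = serre_unit C L M S y z' \<cdot>\<^bsub>L\<^esub> h"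
proof -
  have z [simp]: "z \<in> Obj L" "z' \<in> Obj L" using L.hom_obj[OF h] by auto
  have h' [simp]: "arrow L h" "src L h = z" "tgt L h = z'" using h by (auto simp: L.hom_iff)
  define w where "w = sob S y"
  define x where "x = ihom S y z"
  define x' where "x' = ihom S y z'"
  define p where "p = ihom_pre C L M S z z' w h"
  define b where "b = (ide C x' \<boxtimes>\<^bsub>C\<^esub> siso S y z') \<cdot>\<^bsub>C\<^esub> coevr C x'"
  have [simp]: "w \<in> Obj L" "x \<in> Obj C" "x' \<in> Obj C" by (simp_all add: w_def x_def x'_def)
  have g': "g \<in> Hom C x x'" using g by (simp add: x_def x'_def)
  have "h \<cdot>\<^bsub>L\<^esub> ihev S y z \<in> Hom L (x \<rhd> y) z'" by (simp add: L.hom_iff x_def)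
  from imate[OF y z(2) _ this] ihev_universal[OF y z(2) _ this]
  have post: "ihom_post C L M S y z z' h = g"
    using g gh unfolding ihom_post_def x_def by auto
  have "ihev S z' w \<cdot>\<^bsub>L\<^esub> (ide C (ihom S z' w) \<unrhd> h) \<in> Hom L (ihom S z' w \<rhd> z) w"
    by (simp add: L.hom_iff)
  from imate[OF z(1) _ _ this]
  have p: "p \<in> Hom C (ihom S z' w) (ihom S z w)"
    and ev_p: "ihev S z w \<cdot>\<^bsub>L\<^esub> (p \<unrhd> ide L z) = ihev S z' w \<cdot>\<^bsub>L\<^esub> (ide C (ihom S z' w) \<unrhd> h)"
    unfolding p_def ihom_pre_def by auto
  have p' [simp]: "arrow C p" "src C p = ihom S z' w" "tgt C p = ihom S z w"
    using p by (auto simp: C.hom_iff)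
  have b' [simp]: "arrow C b" "src C b = \<one>\<^bsub>C\<^esub>" "tgt C b = x' \<otimes>\<^bsub>C\<^esub> ihom S z' w"
    by (simp_all add: b_def x'_def w_def)
  note rd = C.rdualm_hom[OF right_dual g'] C.rdualm_coev[OF right_dual g']
  have "(ide C x' \<boxtimes>\<^bsub>C\<^esub> p) \<cdot>\<^bsub>C\<^esub> b = (ide C x' \<boxtimes>\<^bsub>C\<^esub> (p \<cdot>\<^bsub>C\<^esub> siso S y z')) \<cdot>\<^bsub>C\<^esub> coevr C x'"
    unfolding b_def by (simp add: C.ten.interchange_extend x'_def w_def)
  also have "p \<cdot>\<^bsub>C\<^esub> siso S y z' = siso S y z \<cdot>\<^bsub>C\<^esub> rdualm C x x' g"
    using siso_nat[OF y h] post by (simp add: p_def w_def x_def x'_def)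
  also have "(ide C x' \<boxtimes>\<^bsub>C\<^esub> \<dots>) \<cdot>\<^bsub>C\<^esub> coevr C x' = (ide C x' \<boxtimes>\<^bsub>C\<^esub> siso S y z) \<cdot>\<^bsub>C\<^esub> (g \<boxtimes>\<^bsub>C\<^esub> ide C (rdual C x)) \<cdot>\<^bsub>C\<^esub> coevr C x"
    using rd by (simp add: C.hom_iff C.ten.bifun_comp_right x_def)
  finally have pb: "(ide C x' \<boxtimes>\<^bsub>C\<^esub> p) \<cdot>\<^bsub>C\<^esub> b = \<dots>" .
  \<comment> \<open>\<open>h\<close> travels through the constraints to the evaluation, where
    \<open>ev_p\<close> exchanges it for \<open>p\<close>; the result is \<open>ihom_eval\<close> of
    the morphism computed in \<open>pb\<close>.\<close>
  have "serre_unit C L M S y z' \<cdot>\<^bsub>L\<^esub> h = (ide C x' \<unrhd> ihev S z' w) \<cdot>\<^bsub>L\<^esub> massoc M x' (ihom S z' w) z'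
      \<cdot>\<^bsub>L\<^esub> (b \<unrhd> ide L z') \<cdot>\<^bsub>L\<^esub> minv L (munit M z') \<cdot>\<^bsub>L\<^esub> h"
    unfolding serre_unit_eq ihom_eval_def b_def[symmetric] x'_def[symmetric] w_def[symmetric] by simp
  also have "minv L (munit M z') \<cdot>\<^bsub>L\<^esub> h = (ide C \<one>\<^bsub>C\<^esub> \<unrhd> h) \<cdot>\<^bsub>L\<^esub> minv L (munit M z)"
    using minv_munit_natural[of h] by simp
  also have "(b \<unrhd> ide L z') \<cdot>\<^bsub>L\<^esub> \<dots> = ((ide C x' \<boxtimes>\<^bsub>C\<^esub> ide C (ihom S z' w)) \<unrhd> h) \<cdot>\<^bsub>L\<^esub> (b \<unrhd> ide L z) \<cdot>\<^bsub>L\<^esub> minv L (munit M z)"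
    by (simp add: act.interchange_extend)
  also have "massoc M x' (ihom S z' w) z' \<cdot>\<^bsub>L\<^esub> \<dots>
      = (ide C x' \<unrhd> (ide C (ihom S z' w) \<unrhd> h)) \<cdot>\<^bsub>L\<^esub> massoc M x' (ihom S z' w) z \<cdot>\<^bsub>L\<^esub> (b \<unrhd> ide L z) \<cdot>\<^bsub>L\<^esub> minv L (munit M z)"
    using L.comp_extend[OF massoc_natural[of "ide C x'" "ide C (ihom S z' w)" h]] by simp
  also have "(ide C x' \<unrhd> ihev S z' w) \<cdot>\<^bsub>L\<^esub> \<dots> = (ide C x' \<unrhd> (ihev S z' w \<cdot>\<^bsub>L\<^esub> (ide C (ihom S z' w) \<unrhd> h)))
      \<cdot>\<^bsub>L\<^esub> massoc M x' (ihom S z' w) z \<cdot>\<^bsub>L\<^esub> (b \<unrhd> ide L z) \<cdot>\<^bsub>L\<^esub> minv L (munit M z)"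
    by (simp add: act.bifun_comp_right)
  also have "\<dots> = (ide C x' \<unrhd> ihev S z w) \<cdot>\<^bsub>L\<^esub> (ide C x' \<unrhd> (p \<unrhd> ide L z))
      \<cdot>\<^bsub>L\<^esub> massoc M x' (ihom S z' w) z \<cdot>\<^bsub>L\<^esub> (b \<unrhd> ide L z) \<cdot>\<^bsub>L\<^esub> minv L (munit M z)"
    unfolding ev_p[symmetric] by (simp add: act.bifun_comp_right)
  also have "\<dots> = (ide C x' \<unrhd> ihev S z w) \<cdot>\<^bsub>L\<^esub> massoc M x' (ihom S z w) z
      \<cdot>\<^bsub>L\<^esub> ((ide C x' \<boxtimes>\<^bsub>C\<^esub> p) \<unrhd> ide L z) \<cdot>\<^bsub>L\<^esub> (b \<unrhd> ide L z) \<cdot>\<^bsub>L\<^esub> minv L (munit M z)"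
    using L.comp_extend[OF massoc_natural[of "ide C x'" p "ide L z", symmetric]] by simp
  also have "\<dots> = ihom_eval x' z w ((ide C x' \<boxtimes>\<^bsub>C\<^esub> p) \<cdot>\<^bsub>C\<^esub> b)"
    unfolding ihom_eval_def by (simp add: act.bifun_comp_left)
  also have "\<dots> = (g \<unrhd> ide L w) \<cdot>\<^bsub>L\<^esub> serre_unit C L M S y z"
    unfolding pb using act_serre_unit[OF y z(1) g] by (simp add: w_def x_def x'_def)
  finally show ?thesis by (simp add: w_def)
qed

section \<open>The canonical isomorphism between Nakayama and relative Serre functors\<close>

lemma serre_unit_hom:
  "y \<in> Obj L \<Longrightarrow> z \<in> Obj L \<Longrightarrow> serre_unit C L M S y z \<in> Hom L z (ihom S y z \<rhd> sob S y)"
  by (simp add: serre_unit_def Let_def L.hom_iff)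

text \<open>The comparison theorem at the unit object, with the internal Hom out of
  \<open>S y\<close> as last adjoint; functoriality of the Nakayama functor replaces
  \<open>1 \<rhd> y\<close> by \<open>y\<close>.\<close>

lemma nakayama_serre_iso:
  assumes NC: "nakayama C NC" and NL: "nakayama L NL" and y [simp]: "y \<in> Obj L"
  shows "is_iso L (nob NL y) (nob NC \<one>\<^bsub>C\<^esub> \<rhd> sob S y) (nakayama_serre C L M NC NL S y)"
proof -
  interpret NL: nakayama_category L NL using NL by unfold_locales
  interpret chain: adjoint_chain C L "\<lambda>c. c \<rhd> y" "\<lambda>f. f \<unrhd> ide L y"
    "\<lambda>c. c \<rhd> sob S y" "\<lambda>f. f \<unrhd> ide L (sob S y)" NC NL
    "ihom S y" "ihev S y" "serre_unit C L M S y" "ihom S (sob S y)" "ihev S (sob S y)"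
    by unfold_locales (simp_all add: act.bifun_left NC NL L.hom_iff ihev_universal
        serre_unit_hom[unfolded L.hom_iff] serre_unit_universal serre_unit_nat)
  have "is_iso L y (\<one>\<^bsub>C\<^esub> \<rhd> y) (minv L (munit M y))" by (simp add: L.is_iso_iff)
  from NL.nmor_iso[OF this] chain.comparison_iso[OF C.one_obj]
  show ?thesis unfolding nakayama_serre_def by (simp add: L.is_iso_iff)
qed

lemma serre_nakayama_iso:
  assumes "nakayama C NC" "nakayama L NL" "y \<in> Obj L"
  shows "is_iso L (nob NC \<one>\<^bsub>C\<^esub> \<rhd> sob S y) (nob NL y) (serre_nakayama C L M NC NL S y)"
  using nakayama_serre_iso[OF assms] unfolding serre_nakayama_def by (simp add: L.is_iso_iff)

end

section \<open>Equality of the two traces\<close>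

theorem theorem3p12:
  fixes C :: "('oc, 'mc, 'k::alg_closed_field) tencat"
    and D :: "('od, 'md, 'k) tencat"
    and B :: "('oc, 'mc, 'od, 'md, 'ol, 'ml, 'k) serre_bimod"
    and pC :: "'oc \<Rightarrow> 'mc" and pD :: "'od \<Rightarrow> 'md"
    and pt qt :: "'ol \<Rightarrow> 'ml"
    and uC :: 'mc and uD :: 'md
  assumes "finite_tensor_category C" and "finite_tensor_category D"
    and "spherical C (nakC B) pC" and "spherical D (nakD B) pD"
    and "is_iso C \<one>\<^bsub>C\<^esub> (dist_inv C (nakC B)) uC"
    and "is_iso D \<one>\<^bsub>D\<^esub> (dist_inv D (nakD B)) uD"
    and "spherical_bimodule C D pC pD B pt qt uC uD"
  shows "trace_spherical_bimodule C D pC pD B pt qt uC uD"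
proof -
  interpret C: finite_tensor_category C by fact
  interpret D: finite_tensor_category D by fact
  have pivotal: "pivotal_bimodule C D pC pD B pt qt"
    and spherical: "\<And>y. y \<in> Obj (cat B) \<Longrightarrow> radford_untwisted C D B uC uD y \<cdot>\<^bsub>cat B\<^esub> pt y = qt y"
    using assms(7) by (auto simp: spherical_bimodule_def)
  have bimod: "bimodule_with_serre C D B"
    and pt: "\<And>y. y \<in> Obj (cat B) \<Longrightarrow> is_iso (cat B) y (sob (serC B) y) (pt y)"
    and qt: "\<And>y. y \<in> Obj (cat B) \<Longrightarrow> is_iso (cat B) y (sob (serD B) y) (qt y)"
    using pivotal by (auto simp: pivotal_bimodule_def serre_trivialization_def)
  have nak: "nakayama C (nakC B)" "nakayama (rev_tensor D) (nakD B)" "nakayama (cat B) (nakL B)"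
    and serre: "relative_serre C (cat B) (lact B) (serC B)"
      "relative_serre (rev_tensor D) (cat B) (ract B) (serD B)"
    and module: "module_category C (cat B) (lact B)" "module_category (rev_tensor D) (cat B) (ract B)"
    using bimod by (auto simp: bimodule_with_serre_def exact_bimodule_category_def Let_def
        bimod.truncate_def exact_module_category_def)
  interpret D': linear_monoidal_category D by (rule D.linear_monoidal)
  interpret l: relative_serre_module C "cat B" "lact B" "serC B"
    by (intro relative_serre_module.intro relative_serre_module_axioms.intro linear_module_categoryI
        C.linear_monoidal C.right_dual serre module)
  \<comment> \<open>Read in the reversed category, the left dual of \<open>a\<close> in
    \<open>D\<close> is a right dual.\<close>
  have "dual_pair (rev_tensor D) (rdual (rev_tensor D) a) a (evr (rev_tensor D) a) (coevr (rev_tensor D) a)"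
    if "a \<in> Obj (rev_tensor D)" for a
    using that D.left_dual[of a] D'.dual_pair_rev_tensor[of "ldual D a" a] by simp
  then interpret r: relative_serre_module "rev_tensor D" "cat B" "ract B" "serD B"
    by (intro relative_serre_module.intro relative_serre_module_axioms.intro linear_module_categoryI
        D'.linear_monoidal_rev_tensor serre module)
  have "left_trace C B uC pt p f = right_trace D B uD qt p f"
    if p: "projective (cat B) p" and f: "f \<in> Hom (cat B) p p" for p f
  proof -
    have p [simp]: "p \<in> Obj (cat B)" using p by (simp add: projective_def)
    define s where "s = sob (serC B) p"
    define t where "t = sob (serD B) p"
    define m where "m = left_serre_nakayama C B p"
    define n where "n = right_serre_nakayama D B p"
    \<comment> \<open>Formed in \<open>rev_tensor D\<close>, where it agrees with
      \<open>minv D uD\<close>, so that the calculus of the right action applies to it.\<close>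
    define v where "v = minv (rev_tensor D) uD"
    have [simp]: "s \<in> Obj (cat B)" "t \<in> Obj (cat B)"
      unfolding s_def t_def using l.sob_obj[OF p] r.sob_obj[OF p] .
    have [simp]: "arrow (cat B) (pt p)" "src (cat B) (pt p) = p" "tgt (cat B) (pt p) = s"
      using pt[OF p] by (simp_all add: l.L.is_iso_iff s_def)
    have [simp]: "arrow (cat B) (qt p)" "src (cat B) (qt p) = p" "tgt (cat B) (qt p) = t"
      using qt[OF p] by (simp_all add: l.L.is_iso_iff t_def)
    have [simp]: "invertible (cat B) m" "src (cat B) m = dist_inv C (nakC B) \<rhd>\<^bsub>lact B\<^esub> s"
      "tgt (cat B) m = nob (nakL B) p"
      using l.serre_nakayama_iso[OF nak(1,3) p] by (simp_all add: l.L.is_iso_iff s_def m_def)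
    have [simp]: "invertible (cat B) n" "src (cat B) n = dist_inv D (nakD B) \<rhd>\<^bsub>ract B\<^esub> t"
      "tgt (cat B) n = nob (nakL B) p"
      using r.serre_nakayama_iso[OF nak(2,3) p] by (simp_all add: l.L.is_iso_iff t_def n_def)
    have uC [simp]: "arrow C uC" "src C uC = \<one>\<^bsub>C\<^esub>" "tgt C uC = dist_inv C (nakC B)"
      using assms(5) by (simp_all add: C.is_iso_iff)
    have "is_iso (rev_tensor D) \<one>\<^bsub>D\<^esub> (dist_inv D (nakD B)) uD" using assms(6) by simp
    then have uD [simp]: "invertible (rev_tensor D) uD" "src (rev_tensor D) uD = \<one>\<^bsub>D\<^esub>"
      "tgt (rev_tensor D) uD = dist_inv D (nakD B)"
      unfolding r.C.is_iso_iff by blast+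
    have [simp]: "arrow (rev_tensor D) v" "src (rev_tensor D) v = dist_inv D (nakD B)"
      "tgt (rev_tensor D) v = \<one>\<^bsub>D\<^esub>" "uD \<cdot>\<^bsub>D\<^esub> v = ide D (dist_inv D (nakD B))"
      unfolding v_def using r.C.arrow_minv[OF uD(1)] r.C.src_minv[OF uD(1)] r.C.tgt_minv[OF uD(1)]
        r.C.comp_minv[OF uD(1)] uD(2,3) by simp_all
    have [simp]: "dist_inv D (nakD B) \<in> Obj D"
      using r.C.tgt_obj[of uD] uD by simp
    have [simp]: "ide D (dist_inv D (nakD B)) \<unrhd>\<^bsub>ract B\<^esub> ide (cat B) t = ide (cat B) (dist_inv D (nakD B) \<rhd>\<^bsub>ract B\<^esub> t)"
      using r.act.bifun_ide[of "dist_inv D (nakD B)" t] by simp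
    \<comment> \<open>By naturality of the unit constraint this is the argument of the left trace
      before composition with \<open>f\<close>.\<close>
    let ?l = "m \<cdot>\<^bsub>cat B\<^esub> (uC \<unrhd>\<^bsub>lact B\<^esub> ide (cat B) s) \<cdot>\<^bsub>cat B\<^esub> minv (cat B) (munit (lact B) s) \<cdot>\<^bsub>cat B\<^esub> pt p"
    have "qt p = munit (ract B) t \<cdot>\<^bsub>cat B\<^esub> (v \<unrhd>\<^bsub>ract B\<^esub> ide (cat B) t) \<cdot>\<^bsub>cat B\<^esub> minv (cat B) n \<cdot>\<^bsub>cat B\<^esub> ?l"
      unfolding spherical[OF p, symmetric] radford_untwisted_def radford_def Let_def
        s_def[symmetric] t_def[symmetric] m_def[symmetric] n_def[symmetric]
        rev_tensor_category(2)[of D, symmetric] v_def[symmetric]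
      by simp
    \<comment> \<open>Composing with the inverse unit constraint, \<open>uD\<close> and
      \<open>n\<close> strips the outer factors from the expression for \<open>qt p\<close>;
      invertibility of \<open>n\<close> enters here.\<close>
    then have "n \<cdot>\<^bsub>cat B\<^esub> (uD \<unrhd>\<^bsub>ract B\<^esub> ide (cat B) t) \<cdot>\<^bsub>cat B\<^esub> minv (cat B) (munit (ract B) t) \<cdot>\<^bsub>cat B\<^esub> qt p = ?l"
      by (simp add: r.act.interchange_extend)
    then have "m \<cdot>\<^bsub>cat B\<^esub> (uC \<unrhd>\<^bsub>lact B\<^esub> pt p) \<cdot>\<^bsub>cat B\<^esub> minv (cat B) (munit (lact B) p) =
      n \<cdot>\<^bsub>cat B\<^esub> (uD \<unrhd>\<^bsub>ract B\<^esub> qt p) \<cdot>\<^bsub>cat B\<^esub> minv (cat B) (munit (ract B) p)"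
      using l.act_minv_munit[of uC "pt p"] r.act_minv_munit[of uD "qt p"] by simp
    then have "(m \<cdot>\<^bsub>cat B\<^esub> (uC \<unrhd>\<^bsub>lact B\<^esub> pt p) \<cdot>\<^bsub>cat B\<^esub> minv (cat B) (munit (lact B) p)) \<cdot>\<^bsub>cat B\<^esub> f =
      (n \<cdot>\<^bsub>cat B\<^esub> (uD \<unrhd>\<^bsub>ract B\<^esub> qt p) \<cdot>\<^bsub>cat B\<^esub> minv (cat B) (munit (ract B) p)) \<cdot>\<^bsub>cat B\<^esub> f"
      by (rule arg_cong)
    then show ?thesis
      unfolding left_trace_def right_trace_def Let_def m_def[symmetric] n_def[symmetric]
      using f by (simp add: l.L.hom_iff)
  qed
  then show ?thesis using pivotal by (simp add: trace_spherical_bimodule_def)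
qed

end
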